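(* Let $K$ be an imaginary quadratic field whose only roots of unity are $\pm 1$. Let $E$ and $E'$ be complex elliptic curves with complex multiplication by $K$, of conductors $c$ and $c'$ respectively, and put $f=\mathrm{lcm}(c,c')$ and $f'=\gcd(c,c')$. Let $N(E,E')$ be the number of elliptic curves contained in the abelian surface $A=E\times E'$, counted up to the action of $\mathrm{Aut}(A)$. Then \[N(E,E') = \sum_{\ell \mid f} h_\ell \cdot \phi_u\!\left(f/\ell\right) \sum_{g \mid \ell} 2^{\omega(\ell/g)}\, r_{K}\!\left(f', g, f/\ell\right).\]
   Context: For a positive integer $n$, $\mathcal{O}_n=\mathbb{Z}+n\mathcal{O}_K$ is the order of conductor $n$ in $K$. A lattice $\mathfrak{a}\subset K$ (free abelian subgroup of rank 2) has ring of multipliers $\{\alpha\in K:\alpha\mathfrak{a}\subset\mathfrak{a}\}$, which equals $\mathcal{O}_n$ for a unique $n$, called the conductor of $\mathfrak{a}$; the conductor of an elliptic curve $E\cong\mathbb{C}/\mathfrak{a}$ with CM by $K$ is the conductor of $\mathfrak{a}$ (equivalently the index of $\mathrm{End}(E)$ in $\mathcal{O}_K$). $h_\ell=\#\mathrm{Pic}(\mathcal{O}_\ell)= h\cdot \ell\prod_{p\mid \ell}(1-\chi_K(p)/p)$, where $h$ is the class number of $K$ and $\chi_K$ is the quadratic Dirichlet character attached to $K$. $\phi_u(n)=\#\big((\mathbb{Z}/n\mathbb{Z})^\times/\{\pm1\}\big)$, i.e. $\phi(n)/2$ for $n\ge 3$ and $1$ for $n=1,2$. $\omega(n)$ is the number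 of distinct prime divisors of $n$. $r_K(a,b,N)$ is the number of cyclic subgroups $C$ of order $N$ of an elliptic curve $E_0$ with CM by $K$ and conductor $a$ such that $E_0/C$ has conductor $b$ (this number does not depend on the choice of $E_0$). Elliptic curves contained in $A$ means one-dimensional abelian subvarieties of $A$, and $\mathrm{Aut}(A)$ is the group of automorphisms of $A$ as an abelian variety. *)

theory Defs
  imports "HOL-Analysis.Analysis" "HOL-Computational_Algebra.Squarefree"
    "HOL-Computational_Algebra.Polynomial" "HOL-Number_Theory.Totient"
begin

definition imag_quadratic_field :: "complex set \<Rightarrow> bool" where
  "imag_quadratic_field K \<longleftrightarrow> (\<exists>d::nat. d > 0 \<and> squarefree d \<and>
     K = {of_rat p + of_rat q * \<i> * complex_of_real (sqrt (real d)) | p q. True})"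

definition only_roots_of_unity_pm1 :: "complex set \<Rightarrow> bool" where
  "only_roots_of_unity_pm1 K \<longleftrightarrow>
     (\<forall>z\<in>K. (\<exists>n::nat. n > 0 \<and> z ^ n = 1) \<longrightarrow> z = 1 \<or> z = -1)"

definition alg_integer :: "complex \<Rightarrow> bool" where
  "alg_integer z \<longleftrightarrow> (\<exists>p::int poly. lead_coeff p = 1 \<and> poly (map_poly of_int p) z = 0)"

definition ring_of_integers :: "complex set \<Rightarrow> complex set" where
  "ring_of_integers K = {z \<in> K. alg_integer z}"

definition order_cond :: "complex set \<Rightarrow> nat \<Rightarrow> complex set" where
  "order_cond K n = {of_int a + of_nat n * x | a x. x \<in> ring_of_integers K}"

definition R_indep :: "'a::real_vector \<Rightarrow> 'a \<Rightarrow> bool" where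
  "R_indep u v \<longleftrightarrow> (\<forall>r s::real. r *\<^sub>R u + s *\<^sub>R v = 0 \<longrightarrow> r = 0 \<and> s = 0)"

definition Z_span2 :: "'a::real_vector \<Rightarrow> 'a \<Rightarrow> 'a set" where
  "Z_span2 u v = {real_of_int a *\<^sub>R u + real_of_int b *\<^sub>R v | a b. True}"

definition C_lattice :: "complex set \<Rightarrow> bool" where
  "C_lattice L \<longleftrightarrow> (\<exists>u v. R_indep u v \<and> L = Z_span2 u v)"

definition K_lattice :: "complex set \<Rightarrow> complex set \<Rightarrow> bool" where
  "K_lattice K L \<longleftrightarrow> C_lattice L \<and> L \<subseteq> K"

definition multipliers :: "complex set \<Rightarrow> complex set \<Rightarrow> complex set" where
  "multipliers K L = {\<alpha> \<in> K. \<forall>x\<in>L. \<alpha> * x \<in> L}"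

definition lattice_conductor :: "complex set \<Rightarrow> complex set \<Rightarrow> nat" where
  "lattice_conductor K L = (THE n. n > 0 \<and> multipliers K L = order_cond K n)"

text \<open>E = C/Lam is an elliptic curve with CM by K and conductor c.\<close>
definition CM_curve_conductor :: "complex set \<Rightarrow> complex set \<Rightarrow> nat \<Rightarrow> bool" where
  "CM_curve_conductor K Lam c \<longleftrightarrow>
     (\<exists>s a. s \<noteq> 0 \<and> K_lattice K a \<and> lattice_conductor K a = c \<and> Lam = (\<lambda>x. s * x) ` a)"

text \<open>h_l = #Pic(O_l): number of homothety classes of lattices in K with conductor l.\<close>
definition homothety_class :: "complex set \<Rightarrow> complex set \<Rightarrow> complex set set" where
  "homothety_class K a = {(\<lambda>x. \<alpha> * x) ` a | \<alpha>. \<alpha> \<in> K \<and> \<alpha> \<noteq> 0}"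

definition pic_number :: "complex set \<Rightarrow> nat \<Rightarrow> nat" where
  "pic_number K l = card {homothety_class K a | a. K_lattice K a \<and> lattice_conductor K a = l}"

definition phi_u :: "nat \<Rightarrow> nat" where
  "phi_u n = (if n \<le> 2 then 1 else totient n div 2)"

definition omega :: "nat \<Rightarrow> nat" where
  "omega n = card (prime_factors n)"

text \<open>r_K(a,b,N), computed on E0 = C/O_a (which has conductor a). Cyclic subgroups of
 order N of C/L0 correspond to lattices L \<supseteq> L0 with L/L0 cyclic of order N; E0/C = C/L.\<close>
definition r_K :: "complex set \<Rightarrow> nat \<Rightarrow> nat \<Rightarrow> nat \<Rightarrow> nat" where
  "r_K K a b N = card {L. \<exists>z. L = {x + of_int k * z | x k. x \<in> order_cond K a}
       \<and> (\<forall>k::nat. of_nat k * z \<in> order_cond K a \<longleftrightarrow> N dvd k)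
       \<and> lattice_conductor K L = b}"

definition lin2 :: "complex \<times> complex \<times> complex \<times> complex \<Rightarrow> complex \<times> complex \<Rightarrow> complex \<times> complex" where
  "lin2 M z = (case M of (a, b, c, d) \<Rightarrow> (a * fst z + b * snd z, c * fst z + d * snd z))"

definition det2 :: "complex \<times> complex \<times> complex \<times> complex \<Rightarrow> complex" where
  "det2 M = (case M of (a, b, c, d) \<Rightarrow> a * d - b * c)"

text \<open>Automorphisms of the complex torus C^2/LA (as abelian variety: fixing the origin).\<close>
definition torus_aut :: "(complex \<times> complex) set \<Rightarrow> (complex \<times> complex \<times> complex \<times> complex) set" where
  "torus_aut LA = {M. det2 M \<noteq> 0 \<and> lin2 M ` LA = LA}"

text \<open>One-dimensional complex subtori of C^2/LA, given by their tangent line W.\<close>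
definition subtorus_line :: "(complex \<times> complex) set \<Rightarrow> (complex \<times> complex) set \<Rightarrow> bool" where
  "subtorus_line LA W \<longleftrightarrow>
     (\<exists>w. w \<noteq> 0 \<and> W = range (\<lambda>t::complex. (t * fst w, t * snd w)))
     \<and> (\<exists>u\<in>W \<inter> LA. \<exists>v\<in>W \<inter> LA. R_indep u v)"

definition num_elliptic_curves :: "complex set \<Rightarrow> complex set \<Rightarrow> nat" where
  "num_elliptic_curves Lam Lam' =
     (let LA = Lam \<times> Lam' in
      card {{lin2 M ` W | M. M \<in> torus_aut LA} | W. subtorus_line LA W})"

end

theory Submission
  imports Defs
begin

text \<open>
  After rescaling, \<open>A\<close> is the torus of a lattice \<open>M = a \<times> a'\<close> in \<open>K\<^sup>2\<close>, and the elliptic curves in \<open>A\<close> up to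
  automorphism are the \<open>K\<close>-lines \<open>W\<close> up to \<open>Aut M\<close>. Moving \<open>W\<close> to the first axis, \<open>M\<close> becomes an extension of
  the lattice \<open>L2 = M / (M \<inter> W)\<close> by \<open>L1 = M \<inter> W\<close>. Such an extension splits up to conjugate-linear maps,
  so it is given by a class \<open>e\<close> in \<open>K\<close> modulo \<open>P = L1 L2\<close>, and two triples \<open>(L1, L2, e)\<close> are isomorphic iff
  they differ by \<open>(L1, L2, e) \<mapsto> (\<lambda> L1, \<mu> L2, \<lambda> \<mu> e)\<close>. If \<open>l\<close> is the least common multiple of the conductors of
  \<open>L1\<close> and \<open>L2\<close>, and \<open>n\<close> the order of \<open>e\<close> modulo \<open>P\<close>, then the multiplier ring of the extension is the order of
  conductor \<open>l n\<close>, and its \<open>2 \<times> 2\<close> determinants generate \<open>P + \<int> e\<close>. By a Steinitz theorem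
  these two invariants determine the lattice of rank two up to isomorphism. Hence the orbits correspond to the
  triples with \<open>l n = f\<close> and \<open>P + \<int> e = a a'\<close>, up to \<open>\<lambda> \<mu> = \<plusminus>1\<close>.

  For fixed conductors with least common multiple \<open>l\<close> and greatest common divisor \<open>g\<close> there are
  \<open>r\<^sub>K(f', g, f/l)\<close> lattices \<open>P\<close>, then \<open>\<phi>\<^sub>u(f/l)\<close> classes \<open>\<plusminus>e\<close>, and finally \<open>h\<^sub>l\<close> pairs \<open>(L1, L2)\<close>
  with product \<open>P\<close>, because pairs of lattices of conductors \<open>l1\<close>, \<open>l2\<close> that agree over the order of
  conductor \<open>g\<close> glue to a lattice of conductor \<open>l\<close>. The factor \<open>2 ^ \<omega>(l/g)\<close> counts the pairs of conductors.
\<close>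


section \<open>Additive subgroups\<close>

text \<open>Everything rests on one feature of quadratic fields: a lattice is invertible over its
  own ring of multipliers, because its product with its conjugate is a scalar multiple of that ring.
  Lattices of different conductors can therefore be multiplied and inverted together. The
  conjugate-linear shape of the extensions is linear algebra: every additive map from a lattice of
  \<open>K\<close> to \<open>K\<close> has the form \<open>x * b + y * cnj b\<close>, and a shear of
  the plane removes the linear part. Multiplication by \<alpha> fails to commute with what remains
  by the factor \<open>\<alpha> - cnj \<alpha>\<close>, which is how the order of the class enters
  the multiplier ring. Two obstacles shape the count. The determinants present \<open>P\<close> as a
  sublattice of \<open>a a'\<close> with cyclic quotient, whereas \<open>r_K\<close> counts lattices
  above an order; multiplication by the order of the quotient exchanges the two. And \<lambda> and
  \<mu> are constrained only through their product, which must map \<open>a a'\<close> to itself; it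
  is thus a unit of an order, and the hypothesis on roots of unity leaves only the signs.\<close>

definition sgrp :: "'a::ab_group_add set \<Rightarrow> bool" where
  "sgrp H \<longleftrightarrow> 0 \<in> H \<and> (\<forall>x\<in>H. \<forall>y\<in>H. x - y \<in> H)"

definition ghull :: "'a::ab_group_add set \<Rightarrow> 'a set" where
  "ghull S = \<Inter>{H. sgrp H \<and> S \<subseteq> H}"

definition smul :: "complex \<Rightarrow> complex set \<Rightarrow> complex set" where
  "smul c L = (\<lambda>x. c * x) ` L"

definition lprod :: "complex set \<Rightarrow> complex set \<Rightarrow> complex set" where
  "lprod A B = ghull {a * b | a b. a \<in> A \<and> b \<in> B}"

lemma sgrp_0: "sgrp H \<Longrightarrow> 0 \<in> H" by (simp add: sgrp_def)
lemma sgrp_diff: "sgrp H \<Longrightarrow> x \<in> H \<Longrightarrow> y \<in> H \<Longrightarrow> x - y \<in> H" by (simp add: sgrp_def)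
lemma sgrp_uminus: "sgrp H \<Longrightarrow> x \<in> H \<Longrightarrow> - x \<in> H"
  using sgrp_diff[of H 0 x] sgrp_0[of H] by simp
lemma sgrp_add: "sgrp H \<Longrightarrow> x \<in> H \<Longrightarrow> y \<in> H \<Longrightarrow> x + y \<in> H"
  using sgrp_diff[of H x "- y"] sgrp_uminus by fastforce

lemma sgrp_uminus_iff: "sgrp H \<Longrightarrow> - x \<in> H \<longleftrightarrow> x \<in> H"
  using sgrp_uminus[of H x] sgrp_uminus[of H "-x"] by auto

lemma sgrp_add_iff: "sgrp H \<Longrightarrow> x \<in> H \<Longrightarrow> x + y \<in> H \<longleftrightarrow> y \<in> H"
  using sgrp_add[of H x y] sgrp_diff[of H "x + y" x] by auto

lemma sgrp_sum: "sgrp H \<Longrightarrow> (\<And>i. i \<in> I \<Longrightarrow> f i \<in> H) \<Longrightarrow> sum f I \<in> H"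
  by (induction I rule: infinite_finite_induct) (auto intro: sgrp_0 sgrp_add)

lemma sgrp_of_nat_mult: "sgrp H \<Longrightarrow> x \<in> H \<Longrightarrow> of_nat k * x \<in> H" for x :: "'a::comm_ring_1"
  by (induction k) (auto simp: sgrp_0 ring_distribs intro: sgrp_add)

lemma sgrp_of_int_mult: "sgrp H \<Longrightarrow> x \<in> H \<Longrightarrow> of_int k * x \<in> H" for x :: "'a::comm_ring_1"
  using sgrp_of_nat_mult[of H x "nat k"] sgrp_uminus[OF _ sgrp_of_nat_mult[of H x "nat (-k)"]]
  by (cases "k \<ge> 0") auto

lemma sgrp_ghull: "sgrp (ghull S)"
  by (auto simp: sgrp_def ghull_def)

lemma ghull_inc: "x \<in> S \<Longrightarrow> x \<in> ghull S" by (auto simp: ghull_def)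

lemma ghull_least: "sgrp H \<Longrightarrow> S \<subseteq> H \<Longrightarrow> ghull S \<subseteq> H" by (auto simp: ghull_def)

lemma sgrp_Int: "sgrp A \<Longrightarrow> sgrp B \<Longrightarrow> sgrp (A \<inter> B)" by (auto simp: sgrp_def)

lemma sgrp_image:
  assumes "sgrp A" "\<And>x y. h (x - y) = h x - h y" shows "sgrp (h ` A)"
proof -
  have "h 0 = 0" using assms(2)[of 0 0] by simp
  moreover have "h x - h y \<in> h ` A" if "x \<in> A" "y \<in> A" for x y
    using that assms sgrp_diff by (metis image_eqI)
  ultimately show ?thesis using sgrp_0[OF assms(1)] unfolding sgrp_def by (metis imageE image_eqI)
qed

lemma sgrp_vimage:
  assumes "sgrp A" "\<And>x y. h (x - y) = h x - h y" shows "sgrp {x. h x \<in> A}"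
proof -
  have "h 0 = 0" using assms(2)[of 0 0] by simp
  then show ?thesis using assms by (auto simp: sgrp_def)
qed

lemma int_sgrp_principal:
  assumes "sgrp (S :: int set)" shows "\<exists>d\<ge>0. S = {d * k | k. True}"
proof (cases "\<exists>x\<in>S. x \<noteq> 0")
  case False
  then have "S = {0}" using sgrp_0[OF assms] by auto
  then show ?thesis by (intro exI[of _ 0]) auto
next
  case True
  then obtain x where x: "x \<in> S" "x \<noteq> 0" by auto
  then have "\<bar>x\<bar> \<in> S" using sgrp_uminus[OF assms] by (auto simp: abs_if)
  then have ex: "\<exists>n::nat. n > 0 \<and> int n \<in> S" using x by (intro exI[of _ "nat \<bar>x\<bar>"]) auto
  define n where "n = (LEAST n::nat. n > 0 \<and> int n \<in> S)"
  have n: "n > 0" "int n \<in> S" using LeastI_ex[OF ex] by (auto simp: n_def)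
  have "y \<in> {int n * k | k. True}" if "y \<in> S" for y
  proof -
    have "y - of_int (y div int n) * int n \<in> S"
      using sgrp_diff[OF assms that sgrp_of_int_mult[OF assms n(2)]] by blast
    then have m: "y mod int n \<in> S" using minus_div_mult_eq_mod[of y "int n"] by simp
    have pos: "0 \<le> y mod int n" "y mod int n < int n" using n by simp_all
    have "y mod int n = 0"
    proof (rule ccontr)
      assume "y mod int n \<noteq> 0"
      then have "nat (y mod int n) > 0" "int (nat (y mod int n)) \<in> S" using m pos
        by auto
      then have "n \<le> nat (y mod int n)" unfolding n_def by (intro Least_le) auto
      then show False using pos by linarith
    qed
    then show ?thesis by auto
  qed
  moreover have "int n * k \<in> S" for k
    using sgrp_of_int_mult[OF assms n(2), of k] by (simp add: mult.commute)
  ultimately show ?thesis by (intro exI[of _ "int n"]) auto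
qed

lemma sgrp_smul: "sgrp L \<Longrightarrow> sgrp (smul c L)"
  unfolding smul_def by (rule sgrp_image) (simp_all add: algebra_simps)

lemma smul_smul [simp]: "smul a (smul b L) = smul (a * b) L"
  by (auto simp: smul_def image_image mult.assoc)

lemma smul_1 [simp]: "smul 1 L = L" by (simp add: smul_def)

lemma smul_uminus: "sgrp L \<Longrightarrow> smul (- c) L = smul c L"
proof -
  assume L: "sgrp L"
  have "uminus ` L = L" using sgrp_uminus[OF L] by (metis (no_types, lifting) image_subset_iff subsetI subset_antisym image_iff minus_minus)
  then show ?thesis unfolding smul_def by (metis (no_types, lifting) image_cong image_image minus_mult_commute)
qed

lemma in_smul_iff: "c \<noteq> 0 \<Longrightarrow> x \<in> smul c L \<longleftrightarrow> x / c \<in> L"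
  unfolding smul_def by (metis (no_types, lifting) image_iff nonzero_mult_div_cancel_left times_divide_eq_right)

lemma smul_memI: "x \<in> L \<Longrightarrow> c * x \<in> smul c L" by (auto simp: smul_def)

lemma smul_mono: "A \<subseteq> B \<Longrightarrow> smul c A \<subseteq> smul c B" by (auto simp: smul_def)

lemma smul_inj: "c \<noteq> 0 \<Longrightarrow> smul c A = smul c B \<longleftrightarrow> A = B"
  by (metis smul_1 smul_smul left_inverse)

lemma sgrp_lprod: "sgrp (lprod A B)" by (simp add: lprod_def sgrp_ghull)

lemma lprod_memI: "a \<in> A \<Longrightarrow> b \<in> B \<Longrightarrow> a * b \<in> lprod A B"
  unfolding lprod_def by (rule ghull_inc) auto

lemma lprod_least: "sgrp H \<Longrightarrow> (\<And>a b. a \<in> A \<Longrightarrow> b \<in> B \<Longrightarrow> a * b \<in> H) \<Longrightarrow> lprod A B \<subseteq> H"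
  unfolding lprod_def by (rule ghull_least) auto

lemma lprod_commute: "lprod A B = lprod B A"
  unfolding lprod_def by (rule arg_cong[of _ _ ghull]) (use mult.commute in blast)

lemma sgrp_mult_vimage: "sgrp H \<Longrightarrow> sgrp {x. x * c \<in> H}" for c :: "'a::comm_ring_1"
  by (rule sgrp_vimage) (simp_all add: algebra_simps)

text \<open>For fixed \<open>c\<close> the elements whose multiple by \<open>c\<close> lands in the
  target form a subgroup, so only products of generators have to be checked. Most later inclusions
  out of a product use the same preimage argument.\<close>

lemma lprod_assoc_le: "lprod (lprod A B) C \<subseteq> lprod A (lprod B C)"
proof (rule lprod_least[OF sgrp_lprod])
  fix x c assume x: "x \<in> lprod A B" and c: "c \<in> C"
  have "lprod A B \<subseteq> {x. x * c \<in> lprod A (lprod B C)}"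
    using c by (intro lprod_least sgrp_mult_vimage sgrp_lprod)
      (auto simp: mult.assoc intro!: lprod_memI)
  then show "x * c \<in> lprod A (lprod B C)" using x by auto
qed

lemma lprod_assoc: "lprod (lprod A B) C = lprod A (lprod B C)"
proof
  have "lprod A (lprod B C) = lprod (lprod C B) A" by (simp only: lprod_commute)
  also have "\<dots> \<subseteq> lprod C (lprod B A)" by (rule lprod_assoc_le)
  also have "\<dots> = lprod (lprod A B) C" by (simp only: lprod_commute)
  finally show "lprod A (lprod B C) \<subseteq> lprod (lprod A B) C" .
qed (rule lprod_assoc_le)

lemma lprod_left_commute: "lprod A (lprod B C) = lprod B (lprod A C)"
  by (metis lprod_assoc lprod_commute)

lemmas lprod_ac = lprod_assoc lprod_commute lprod_left_commute

lemma lprod_smul_left: "lprod (smul c A) B = smul c (lprod A B)"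
proof
  show "lprod (smul c A) B \<subseteq> smul c (lprod A B)"
  proof (rule lprod_least[OF sgrp_smul[OF sgrp_lprod]])
    fix x b assume "x \<in> smul c A" "b \<in> B"
    then obtain a where "a \<in> A" "x = c * a" by (auto simp: smul_def)
    then show "x * b \<in> smul c (lprod A B)"
      using smul_memI[OF lprod_memI[OF _ \<open>b \<in> B\<close>], of a A c] by (simp add: mult.assoc)
  qed
  have "lprod A B \<subseteq> {x. x * c \<in> lprod (smul c A) B}"
  proof (intro lprod_least sgrp_mult_vimage sgrp_lprod, clarify)
    fix a b assume "a \<in> A" "b \<in> B"
    then have "(c * a) * b \<in> lprod (smul c A) B" by (intro lprod_memI smul_memI)
    then show "a * b * c \<in> lprod (smul c A) B" by (simp add: mult_ac)
  qed
  then show "smul c (lprod A B) \<subseteq> lprod (smul c A) B" by (auto simp: smul_def mult.commute)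
qed

lemma lprod_smul_right: "lprod A (smul c B) = smul c (lprod A B)"
  by (metis lprod_commute lprod_smul_left)

lemma lprod_absorb:
  assumes "sgrp A" "1 \<in> R" "\<And>r a. r \<in> R \<Longrightarrow> a \<in> A \<Longrightarrow> r * a \<in> A"
  shows "lprod R A = A"
proof
  show "lprod R A \<subseteq> A" using assms by (intro lprod_least) auto
  show "A \<subseteq> lprod R A" using lprod_memI[OF assms(2)] by fastforce
qed

section \<open>Imaginary quadratic fields\<close>

text \<open>Clearing the denominators of trace and norm and dividing by the common factor makes the
  characteristic polynomial of \<open>z\<close> primitive. The relations for trace and norm are kept
  because they later supply the values of the norm form of a lattice.\<close>

lemma primitive_quadratic:
  fixes z :: complex
  assumes "z + cnj z = of_rat r" "z * cnj z = of_rat s"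
  obtains A B C :: int where "A > 0" "gcd A (gcd B C) = 1"
    "of_int A * z\<^sup>2 + of_int B * z + of_int C = 0"
    "of_int A * (z + cnj z) = - of_int B" "of_int A * (z * cnj z) = of_int C"
proof -
  obtain a b where ab: "quotient_of r = (a, b)" by fastforce
  obtain c d where cd: "quotient_of s = (c, d)" by fastforce
  have b: "b > 0" "of_rat r = (of_int a / of_int b :: complex)"
    using quotient_of_denom_pos[OF ab] quotient_of_div[OF ab] by (simp_all add: of_rat_divide)
  have d: "d > 0" "of_rat s = (of_int c / of_int d :: complex)"
    using quotient_of_denom_pos[OF cd] quotient_of_div[OF cd] by (simp_all add: of_rat_divide)
  define g where "g = gcd (b * d) (gcd (- a * d) (b * c))"
  have g: "g > 0" using b d by (simp add: g_def)
  define A where "A = b * d div g"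
  define B where "B = - a * d div g"
  define C where "C = b * c div g"
  have dv: "g * A = b * d" "g * B = - a * d" "g * C = b * c"
    unfolding A_def B_def C_def g_def by (metis dvd_mult_div_cancel gcd_dvd1 gcd_dvd2 dvd_trans)+
  have A: "A > 0" using dv(1) b d g by (metis mult_pos_pos zero_less_mult_pos)
  have cop: "gcd A (gcd B C) = 1"
  proof -
    have "g * gcd A (gcd B C) = gcd (g * A) (gcd (g * B) (g * C))"
      using g by (simp add: gcd_mult_left abs_mult)
    also have "\<dots> = g" unfolding dv by (simp add: g_def)
    finally show ?thesis using g by simp
  qed
  have gz: "(of_int g :: complex) \<noteq> 0" "(of_int b :: complex) \<noteq> 0" "(of_int d :: complex) \<noteq> 0"
    using g b d by auto
  have dv': "of_int g * of_int A = (of_int b * of_int d :: complex)"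
    "of_int g * of_int B = (- of_int a * of_int d :: complex)"
    "of_int g * of_int C = (of_int b * of_int c :: complex)"
    using dv by (metis of_int_mult of_int_minus)+
  have t: "of_int A * (z + cnj z) = - of_int B"
  proof -
    have "of_int g * (of_int A * (z + cnj z)) = of_int g * (- of_int B :: complex)"
      unfolding assms b(2) using dv' gz by (simp add: field_simps)
    then show ?thesis using gz(1) mult_cancel_left by blast
  qed
  have n: "of_int A * (z * cnj z) = of_int C"
  proof -
    have "of_int g * (of_int A * (z * cnj z)) = of_int g * (of_int C :: complex)"
      unfolding assms d(2) using dv' gz by (simp add: field_simps)
    then show ?thesis using gz by simp
  qed
  have "of_int A * z\<^sup>2 + of_int B * z + of_int C = 0"
    using t n by algebra
  then show ?thesis by (rule that[OF A cop _ t n])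
qed

text \<open>Gauss's lemma: the primitive quadratic divides every integral polynomial vanishing at
  \<open>z\<close> within the integral polynomials, so its leading coefficient divides 1.
  Pseudo-division stays over the integers; its remainder is at most linear and vanishes at the
  nonreal \<open>z\<close>, hence is zero.\<close>

lemma alg_integer_primitive_quadratic:
  fixes z :: complex and A B C :: int
  assumes "A > 0" "gcd A (gcd B C) = 1" "of_int A * z\<^sup>2 + of_int B * z + of_int C = 0"
    and "alg_integer z" "Im z \<noteq> 0"
  shows "A = 1"
proof -
  obtain p :: "int poly" where p: "lead_coeff p = 1" "poly (map_poly of_int p) z = 0"
    using assms(4) by (auto simp: alg_integer_def)
  define q where "q = [:C, B, A:]"
  have q0: "q \<noteq> 0" using assms(1) by (simp add: q_def)
  have degq: "degree q = 2" using assms(1) by (simp add: q_def)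
  have cq: "content q = 1" using assms(1,2) by (simp add: q_def content_def cCons_def gcd.commute gcd.left_commute)
  have qz: "poly (map_poly of_int q) z = 0"
    using assms(3) by (simp add: q_def map_poly_pCons power2_eq_square algebra_simps)
  obtain a Q where aQ: "a \<noteq> 0" "smult a p = q * Q + pseudo_mod p q"
    using pseudo_mod(1)[OF q0, of p] by blast
  define r where "r = pseudo_mod p q"
  have deg: "r = 0 \<or> degree r < 2" using pseudo_mod(2)[OF q0, of p] degq by (simp add: r_def)
  have hom: "map_poly complex_of_int (smult a p) = smult (of_int a) (map_poly of_int p)"
    "map_poly complex_of_int (q * Q + r) = map_poly of_int q * map_poly of_int Q + map_poly of_int r"
    by (auto intro!: poly_eqI simp: coeff_map_poly coeff_mult)
  have rz: "poly (map_poly of_int r) z = 0"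
    using arg_cong[OF aQ(2), of "\<lambda>p. poly (map_poly complex_of_int p) z"] p(2) qz
    by (simp add: r_def[symmetric] hom)
  have "r = 0"
  proof (rule ccontr)
    assume "r \<noteq> 0"
    then have "degree r \<le> 1" using deg by auto
    then have r: "r = [:coeff r 0, coeff r 1:]"
      by (intro poly_eqI) (auto simp: coeff_pCons coeff_eq_0 split: nat.split)
    have e: "of_int (coeff r 0) + z * of_int (coeff r 1) = 0"
      using rz by (subst (asm) r) (simp add: map_poly_pCons)
    then have "Im z * of_int (coeff r 1) = 0" by (auto simp: complex_eq_iff)
    then have "coeff r 1 = 0" using assms(5) by simp
    with e r have "r = 0" by simp
    with \<open>r \<noteq> 0\<close> show False ..
  qed
  then have e: "smult a p = q * Q" using aQ(2) by (simp add: r_def)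
  have "content p dvd coeff p (degree p)" by (rule content_dvd_coeff)
  then have "is_unit (content p)" using p(1) by simp
  then have cp: "content p = 1" by (metis is_unit_normalize normalize_content)
  have "content Q = \<bar>a\<bar>"
    using arg_cong[OF e, of content] by (simp add: content_mult cq cp)
  then have "[:a:] dvd Q" by (simp add: const_poly_dvd_iff_dvd_content)
  then obtain Q' where Q': "Q = smult a Q'" by (auto elim!: dvdE)
  then have "smult a (p - q * Q') = 0" using e by (simp add: smult_diff_right)
  then have "p = q * Q'" using aQ(1) by simp
  then have "A * lead_coeff Q' = 1" using p(1) assms(1) by (simp add: lead_coeff_mult degq) (simp add: q_def numeral_2_eq_2)
  then have "is_unit A" by (metis dvd_triv_left)
  then show "A = 1" using assms(1) by simp
qed

lemma alg_integer_quadratic: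
  assumes "z\<^sup>2 + of_int b * z + of_int c = 0" shows "alg_integer z"
  unfolding alg_integer_def
  by (intro exI[of _ "[:c, b, 1:]"])
    (use assms in \<open>simp add: map_poly_pCons power2_eq_square algebra_simps\<close>)

lemma alg_integer_of_rat: "alg_integer (of_rat p) \<Longrightarrow> \<exists>k. p = of_int k"
proof -
  assume "alg_integer (of_rat p)"
  then have "algebraic_int (of_rat p :: complex)"
    unfolding algebraic_int_altdef_ipoly alg_integer_def by auto
  then have "(of_rat p :: complex) \<in> \<int>" by (rule rational_algebraic_int_is_int) simp
  then obtain k where "(of_rat p :: complex) = of_int k" by (auto elim: Ints_cases)
  then have "(of_rat p :: complex) = of_rat (of_int k)" by simp
  then show ?thesis using of_rat_eq_iff by blast
qed

lemma squarefree_rat_square: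
  fixes q :: rat
  assumes "squarefree (d::nat)" "of_nat d * q\<^sup>2 \<in> \<int>" shows "q \<in> \<int>"
proof -
  obtain a b where ab: "quotient_of q = (a, b)" by fastforce
  have b: "b > 0" "q = of_int a / of_int b" "coprime a b"
    using quotient_of_denom_pos[OF ab] quotient_of_div[OF ab] quotient_of_coprime[OF ab] by auto
  obtain k where k: "of_nat d * q\<^sup>2 = of_int k" using assms(2) by (auto elim: Ints_cases)
  have "of_int (int d * a\<^sup>2) = (of_int (k * b\<^sup>2) :: rat)"
    using k b by (simp add: field_simps power2_eq_square)
  then have "int d * a\<^sup>2 = k * b\<^sup>2" by (simp only: of_int_eq_iff)
  then have "b\<^sup>2 dvd int d * a\<^sup>2" by simp
  moreover have "coprime (b\<^sup>2) (a\<^sup>2)" using b(3) by (simp add: coprime_commute)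
  ultimately have "b\<^sup>2 dvd int d" by (simp add: coprime_dvd_mult_left_iff)
  then have "(nat b)\<^sup>2 dvd d" using b(1)
    by (metis int_dvd_int_iff nat_0_le of_nat_power order_less_imp_le)
  then have "nat b = 1" using assms(1) by (auto dest: squarefreeD)
  then have "b = 1" by simp
  then show ?thesis using b by simp
qed

text \<open>An integral basis \<open>1, w\<close> of \<open>K\<close>, with \<open>tw\<close> and
  \<open>nw\<close> the trace and norm of \<open>w\<close>. The two shapes of the ring of integers,
  depending on \<open>d\<close> modulo 4, are both instances, so the distinction is made only
  once.\<close>

locale imag_quad =
  fixes K :: "complex set" and w :: complex and tw nw :: int
  assumes K_eq: "K = {of_rat p + of_rat q * w | p q. True}"
    and Im_w: "Im w \<noteq> 0"
    and w_sq: "w * w = of_int tw * w - of_int nw"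
    and ring_of_integers_eq: "ring_of_integers K = {of_int i + of_int j * w | i j. True}"

lemma imag_quadratic_field_cases:
  assumes "imag_quadratic_field K"
  obtains w t n where "imag_quad K w t n"
proof -
  obtain d :: nat where d: "d > 0" "squarefree d"
    and K: "K = {of_rat p + of_rat q * \<i> * complex_of_real (sqrt (real d)) | p q. True}"
    using assms by (auto simp: imag_quadratic_field_def)
  define s where "s = \<i> * complex_of_real (sqrt (real d))"
  have ss: "s * s = - of_nat d" "cnj s = - s" "Im s \<noteq> 0"
    using d by (simp_all add: s_def complex_eq_iff)
  have K: "K = {of_rat p + of_rat q * s | p q. True}" by (simp add: K s_def mult.assoc)
  \<comment> \<open>The trace \<open>2 * p\<close> and the norm are integers, and four times the
    norm is \<open>(2 * p)^2 + d * (2 * q)^2\<close>. Squarefreeness of \<open>d\<close> then makes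
    \<open>2 * q\<close> an integer.\<close>
  have int_cases: "\<exists>T S :: int. 2 * p = of_int T \<and> 2 * q = of_int S \<and> 4 dvd T\<^sup>2 + int d * S\<^sup>2"
    if "alg_integer (of_rat p + of_rat q * s)" for p q
  proof (cases "q = 0")
    case True
    with that obtain k where "p = of_int k" using alg_integer_of_rat by auto
    with True show ?thesis by (intro exI[of _ "2 * k"] exI[of _ 0]) auto
  next
    case False
    define z where "z = of_rat p + of_rat q * s"
    have cz: "cnj z = of_rat p - of_rat q * s"
    proof -
      have "cnj (of_rat r) = of_rat r" for r by (cases r) (simp add: of_rat_rat)
      then show ?thesis using ss by (simp add: z_def)
    qed
    have tr: "z + cnj z = of_rat (2 * p)" unfolding cz by (simp add: z_def of_rat_mult)
    have nm: "z * cnj z = of_rat (p\<^sup>2 + of_nat d * q\<^sup>2)"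
    proof -
      have "z * cnj z = of_rat p * of_rat p - of_rat q * of_rat q * (s * s)"
        unfolding cz by (simp add: z_def algebra_simps)
      then show ?thesis by (simp add: ss of_rat_add of_rat_mult power2_eq_square)
    qed
    have Imz: "Im z \<noteq> 0"
    proof -
      have "z - cnj z = 2 * of_rat q * s" unfolding cz by (simp add: z_def)
      then have "z \<noteq> cnj z" using False ss by auto
      then show ?thesis by (auto simp: complex_eq_iff)
    qed
    obtain A B C :: int where ABC: "A > 0" "gcd A (gcd B C) = 1"
      "of_int A * z\<^sup>2 + of_int B * z + of_int C = 0"
      "of_int A * (z + cnj z) = - of_int B" "of_int A * (z * cnj z) = of_int C"
      using primitive_quadratic[OF tr nm] by blast
    have A1: "A = 1" using alg_integer_primitive_quadratic[OF ABC(1-3) _ Imz] that by (simp add: z_def)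
    have "(of_rat (2 * p) :: complex) = of_rat (of_int (- B))" using ABC(4) A1 tr by (simp only: of_rat_of_int_eq) simp
    then have T: "2 * p = of_int (- B)" by (simp only: of_rat_eq_iff)
    have "(of_rat (p\<^sup>2 + of_nat d * q\<^sup>2) :: complex) = of_rat (of_int C)" using ABC(5) A1 nm by simp
    then have N: "p\<^sup>2 + of_nat d * q\<^sup>2 = of_int C" by (simp only: of_rat_eq_iff)
    have "of_nat d * (2 * q)\<^sup>2 = of_int (4 * C) - (2 * p)\<^sup>2" using N by (simp add: algebra_simps power2_eq_square)
    also have "\<dots> = of_int (4 * C - B\<^sup>2)" unfolding T by simp
    finally have Sq: "of_nat d * (2 * q)\<^sup>2 = of_int (4 * C - B\<^sup>2)" .
    then have "of_nat d * (2 * q)\<^sup>2 \<in> \<int>" by (metis Ints_of_int)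
    then have "2 * q \<in> \<int>" by (rule squarefree_rat_square[OF d(2)])
    then obtain S where S: "2 * q = of_int S" by (auto elim: Ints_cases)
    have "of_int (int d * S\<^sup>2) = (of_int (4 * C - B\<^sup>2) :: rat)" using Sq unfolding S by simp
    then have "int d * S\<^sup>2 = 4 * C - B\<^sup>2" by (simp only: of_int_eq_iff)
    then show ?thesis using T S by (intro exI[of _ "- B"] exI[of _ S]) auto
  qed
  have d4: "\<not> 4 dvd d" using d(2) by (auto simp: squarefree_def dest: spec[of _ 2])
  \<comment> \<open>Squares are 0 or 1 modulo 4 and \<open>d\<close> is 1, 2 or 3 modulo 4. Only the
    residue 3 allows \<open>T\<close> and \<open>S\<close> to be both odd.\<close>
  have parity: "even (T - S) \<and> (d mod 4 \<noteq> 3 \<longrightarrow> even S)" if "4 dvd T\<^sup>2 + int d * S\<^sup>2" for T S :: int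
  proof -
    have sq: "x\<^sup>2 mod 4 = (if even x then 0 else 1)" for x :: int
    proof (cases "even x")
      case True
      then obtain y where "x = 2 * y" by (elim evenE)
      then show ?thesis by (simp add: power2_eq_square)
    next
      case False
      then obtain y where "x = 2 * y + 1" by (elim oddE)
      then have "x\<^sup>2 = 4 * (y * y + y) + 1" by (simp add: power2_eq_square algebra_simps)
      then have "x\<^sup>2 mod 4 = 1" by presburger
      then show ?thesis using False by simp
    qed
    define r where "r = int d mod 4"
    have "r = 1 \<or> r = 2 \<or> r = 3" unfolding r_def using d4 by presburger
    moreover have "r = 3 \<longleftrightarrow> d mod 4 = 3" unfolding r_def by presburger
    ultimately have r: "r \<in> {1, 2, 3}" "r = 3 \<longleftrightarrow> d mod 4 = 3" by auto
    have "(T\<^sup>2 + int d * S\<^sup>2) mod 4 = (T\<^sup>2 mod 4 + r * (S\<^sup>2 mod 4)) mod 4"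
    proof -
      have "(int d * S\<^sup>2) mod 4 = (r * (S\<^sup>2 mod 4)) mod 4" by (simp only: r_def mod_mult_eq)
      then show ?thesis by (metis mod_add_eq mod_add_right_eq)
    qed
    then have "(T\<^sup>2 mod 4 + r * (S\<^sup>2 mod 4)) mod 4 = 0" using that by simp
    then show ?thesis using r unfolding sq by (auto split: if_splits)
  qed
  show ?thesis
  proof (cases "d mod 4 = 3")
    case False
    have "imag_quad K s 0 (int d)"
    proof
      show "K = {of_rat p + of_rat q * s | p q. True}" by (fact K)
      show "Im s \<noteq> 0" by (fact ss)
      show "s * s = of_int 0 * s - of_int (int d)" using ss by simp
      have "z \<in> {of_int i + of_int j * s | i j. True}" if z: "z \<in> K" "alg_integer z" for z
      proof -
        obtain p q where pq: "z = of_rat p + of_rat q * s" using z K by auto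
        obtain T S :: int where TS: "2 * p = of_int T" "2 * q = of_int S" "4 dvd T\<^sup>2 + int d * S\<^sup>2"
          using int_cases z(2) pq by blast
        have "even S" "even T" using parity[OF TS(3)] False by auto
        then obtain i j where "T = 2 * i" "S = 2 * j" by (auto elim!: evenE)
        then have "p = of_int i" "q = of_int j" using TS by auto
        then show ?thesis using pq by auto
      qed
      moreover have "of_int i + of_int j * s \<in> K" "alg_integer (of_int i + of_int j * s)" for i j
      proof -
        show "of_int i + of_int j * s \<in> K"
          unfolding K by (intro CollectI exI[of _ "of_int i"] exI[of _ "of_int j"]) simp
        show "alg_integer (of_int i + of_int j * s)"
          by (rule alg_integer_quadratic[of _ "- 2 * i" "i\<^sup>2 + int d * j\<^sup>2"])
            (use ss(1) in \<open>simp add: power2_eq_square, algebra\<close>)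
      qed
      ultimately show "ring_of_integers K = {of_int i + of_int j * s | i j. True}"
        unfolding ring_of_integers_def by blast
    qed
    then show ?thesis by (rule that)
  next
    case True
    \<comment> \<open>With \<open>d = 4 * n - 1\<close> this half-integral element satisfies
      \<open>w * w = w - n\<close>.\<close>
    define w where "w = (1 + s) / 2"
    obtain n where n: "int d = 4 * n - 1"
    proof
      show "int d = 4 * (int d div 4 + 1) - 1" using True by presburger
    qed
    have s: "s = 2 * w - 1" by (simp add: w_def field_simps)
    have ww: "w * w = w - of_int n"
    proof -
      have "s * s = - of_int (4 * n - 1)" using ss(1) n by (metis of_int_of_nat_eq)
      then have "4 * (w * w) = 4 * (w - of_int n)" by (simp add: s algebra_simps)
      then show ?thesis using mult_cancel_left by (metis zero_neq_numeral)
    qed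
    have "imag_quad K w 1 n"
    proof
      have "of_rat p + of_rat q * s = of_rat (p - q) + of_rat (2 * q) * w" for p q
        by (simp add: s of_rat_diff of_rat_mult algebra_simps)
      moreover have "of_rat p + of_rat q * w = of_rat (p + q / 2) + of_rat (q / 2) * s" for p q
        by (simp add: w_def of_rat_add of_rat_divide add_divide_distrib distrib_left)
      ultimately show Kw: "K = {of_rat p + of_rat q * w | p q. True}" unfolding K by blast
      show "Im w \<noteq> 0" using ss by (simp add: w_def)
      show "w * w = of_int 1 * w - of_int n" using ww by simp
      have "z \<in> {of_int i + of_int j * w | i j. True}" if z: "z \<in> K" "alg_integer z" for z
      proof -
        obtain p q where pq: "z = of_rat p + of_rat q * s" using z K by auto
        obtain T S :: int where TS: "2 * p = of_int T" "2 * q = of_int S" "4 dvd T\<^sup>2 + int d * S\<^sup>2"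
          using int_cases z(2) pq by blast
        have "2 dvd T - S" using parity[OF TS(3)] by blast
        then obtain i where i: "T - S = 2 * i" by (rule dvdE)
        have "2 * p - 2 * q = 2 * of_int i" unfolding TS using i by (metis of_int_diff of_int_mult of_int_numeral)
        then have "p = q + of_int i" by simp
        then have "z = of_int i + of_rat (2 * q) * w" by (simp add: pq s of_rat_add of_rat_mult algebra_simps)
        then show ?thesis using TS(2) by auto
      qed
      moreover have "of_int i + of_int j * w \<in> K" "alg_integer (of_int i + of_int j * w)" for i j
      proof -
        show "of_int i + of_int j * w \<in> K"
          unfolding Kw by (intro CollectI exI[of _ "of_int i"] exI[of _ "of_int j"]) simp
        show "alg_integer (of_int i + of_int j * w)"
          by (rule alg_integer_quadratic[of _ "- 2 * i - j" "i\<^sup>2 + i * j + n * j\<^sup>2"])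
            (use ww in \<open>simp add: power2_eq_square, algebra\<close>)
      qed
      ultimately show "ring_of_integers K = {of_int i + of_int j * w | i j. True}"
        unfolding ring_of_integers_def by blast
    qed
    then show ?thesis by (rule that)
  qed
qed

section \<open>Lattices in an imaginary quadratic field\<close>

definition zspan :: "complex \<Rightarrow> complex \<Rightarrow> complex set" where
  "zspan u v = {of_int a * u + of_int b * v | a b. True}"

lemma Z_span2_eq_zspan: "Z_span2 u v = zspan u v"
  by (simp add: Z_span2_def zspan_def scaleR_conv_of_real)

lemma sgrp_zspan: "sgrp (zspan u v)"
  unfolding sgrp_def
proof (intro conjI ballI)
  show "0 \<in> zspan u v" unfolding zspan_def by (intro CollectI exI[of _ 0]) simp
  fix x y assume "x \<in> zspan u v" "y \<in> zspan u v"
  then obtain a b a' b' where "x = of_int a * u + of_int b * v" "y = of_int a' * u + of_int b' * v"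
    by (auto simp: zspan_def)
  then have "x - y = of_int (a - a') * u + of_int (b - b') * v" by (simp add: algebra_simps)
  then show "x - y \<in> zspan u v" unfolding zspan_def by blast
qed

lemma zspan_memI: "of_int a * u + of_int b * v \<in> zspan u v"
  by (auto simp: zspan_def)

lemma zspan_memI': "x = of_int a * u + of_int b * v \<Longrightarrow> x \<in> zspan u v"
  by (auto simp: zspan_def)

lemma zspan_basis: "u \<in> zspan u v" "v \<in> zspan u v"
  using zspan_memI[of 1 u 0 v] zspan_memI[of 0 u 1 v] by simp_all

lemma zspan_least: "sgrp H \<Longrightarrow> u \<in> H \<Longrightarrow> v \<in> H \<Longrightarrow> zspan u v \<subseteq> H"
  by (auto simp: zspan_def intro!: sgrp_add sgrp_of_int_mult)

lemma smul_zspan: "smul c (zspan u v) = zspan (c * u) (c * v)"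
proof (intro equalityI zspan_least sgrp_smul sgrp_zspan)
  show "smul c (zspan u v) \<subseteq> zspan (c * u) (c * v)"
  proof
    fix x assume "x \<in> smul c (zspan u v)"
    then obtain a b where "x = c * (of_int a * u + of_int b * v)" by (auto simp: smul_def zspan_def)
    then show "x \<in> zspan (c * u) (c * v)" by (intro zspan_memI'[of x a _ b]) (simp add: algebra_simps)
  qed
qed (simp_all add: smul_memI zspan_basis)

lemma Im_of_real_mult: "Im (complex_of_real r * z) = r * Im z" by simp

text \<open>The imaginary part of \<open>cnj u * v\<close> is the determinant of \<open>u\<close>
  and \<open>v\<close> as vectors of the real plane.\<close>

lemma R_indep_complex: "R_indep u v \<longleftrightarrow> Im (cnj u * v) \<noteq> 0" for u v :: complex
proof
  assume R: "R_indep u v"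
  show "Im (cnj u * v) \<noteq> 0"
  proof
    assume I: "Im (cnj u * v) = 0"
    have "cnj u * v = of_real (Re (cnj u * v))" using I by (simp add: complex_eq_iff)
    then have "(Re (cnj u * v)) *\<^sub>R u + (- ((cmod u)\<^sup>2)) *\<^sub>R v = u * (cnj u * v) - (u * cnj u) * v"
      by (simp add: scaleR_conv_of_real complex_norm_square[symmetric] del: of_real_power) 
    also have "\<dots> = 0" by simp
    finally have "- ((cmod u)\<^sup>2) = 0" using R unfolding R_indep_def by blast
    then have "u = 0" by simp
    then have "1 *\<^sub>R u + 0 *\<^sub>R v = 0" by simp
    then show False using R unfolding R_indep_def by (metis zero_neq_one)
  qed
next
  assume I: "Im (cnj u * v) \<noteq> 0"
  show "R_indep u v" unfolding R_indep_def
  proof (intro allI impI)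
    fix r s :: real assume e: "r *\<^sub>R u + s *\<^sub>R v = 0"
    have "Im (cnj u * (r *\<^sub>R u + s *\<^sub>R v)) = s * Im (cnj u * v)"
      by (simp add: algebra_simps)
    moreover have "Im (cnj (r *\<^sub>R u + s *\<^sub>R v) * v) = r * Im (cnj u * v)"
      by (simp add: algebra_simps)
    ultimately show "r = 0 \<and> s = 0" using I e by simp
  qed
qed

section \<open>Arithmetic of the field and of conjugation\<close>

context imag_quad
begin

lemma cnj_w: "cnj w = of_int tw - w"
proof -
  have "Im (w * w) = of_int tw * Im w" unfolding w_sq by simp
  then have "2 * Re w = of_int tw" using Im_w by simp
  then show ?thesis by (simp add: complex_eq_iff)
qed

lemma K_memI: "of_rat p + of_rat q * w \<in> K" by (auto simp: K_eq)

lemma K_memE: assumes "x \<in> K" obtains p q where "x = of_rat p + of_rat q * w"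
  using assms by (auto simp: K_eq)

lemma K_of_rat: "of_rat p \<in> K" using K_memI[of p 0] by simp
lemma K_of_int: "of_int i \<in> K" using K_of_rat[of "of_int i"] by simp
lemma K_of_nat: "of_nat i \<in> K" using K_of_rat[of "of_nat i"] by simp
lemma K_0: "0 \<in> K" and K_1: "1 \<in> K" using K_of_int[of 0] K_of_int[of 1] by simp_all
lemma K_w: "w \<in> K" using K_memI[of 0 1] by simp

lemma K_diff: "x \<in> K \<Longrightarrow> y \<in> K \<Longrightarrow> x - y \<in> K"
proof (elim K_memE)
  fix p q p' q' assume "x = of_rat p + of_rat q * w" "y = of_rat p' + of_rat q' * w"
  then have "x - y = of_rat (p - p') + of_rat (q - q') * w" by (simp add: of_rat_diff algebra_simps)
  then show "x - y \<in> K" using K_memI by metis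
qed

lemma sgrp_K: "sgrp K" by (simp add: sgrp_def K_0 K_diff)

lemma K_add: "x \<in> K \<Longrightarrow> y \<in> K \<Longrightarrow> x + y \<in> K" by (rule sgrp_add[OF sgrp_K])
lemma K_uminus: "x \<in> K \<Longrightarrow> - x \<in> K" by (rule sgrp_uminus[OF sgrp_K])

lemma K_mult: "x \<in> K \<Longrightarrow> y \<in> K \<Longrightarrow> x * y \<in> K"
proof (elim K_memE)
  fix p q p' q' assume "x = of_rat p + of_rat q * w" "y = of_rat p' + of_rat q' * w"
  then have "x * y = of_rat p * of_rat p' + (of_rat p * of_rat q' + of_rat q * of_rat p') * w
      + of_rat q * of_rat q' * (w * w)" by (simp add: algebra_simps)
  also have "\<dots> = of_rat (p * p' - q * q' * of_int nw) + of_rat (p * q' + q * p' + q * q' * of_int tw) * w"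
    by (simp add: w_sq of_rat_diff of_rat_add of_rat_mult algebra_simps)
  finally show "x * y \<in> K" using K_memI by metis
qed

lemma cnj_of_rat [simp]: "cnj (of_rat r) = of_rat r" by (cases r) (simp add: of_rat_rat)

lemma cnj_K_rep: "cnj (of_rat p + of_rat q * w) = of_rat (p + q * of_int tw) + of_rat (- q) * w"
  by (simp add: cnj_w of_rat_add of_rat_mult of_rat_minus algebra_simps)

lemma K_cnj: "x \<in> K \<Longrightarrow> cnj x \<in> K"
  by (elim K_memE) (metis cnj_K_rep K_memI)

lemma K_trace_norm:
  assumes "x \<in> K" shows "\<exists>r. x + cnj x = of_rat r" "\<exists>s. x * cnj x = of_rat s"
proof -
  obtain p q where x: "x = of_rat p + of_rat q * w" using assms by (rule K_memE)
  have "x + cnj x = of_rat (2 * p + q * of_int tw)"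
    unfolding x cnj_K_rep by (simp add: of_rat_add of_rat_mult of_rat_minus algebra_simps)
  then show "\<exists>r. x + cnj x = of_rat r" ..
  have "x * cnj x = of_rat p * of_rat p + of_rat p * of_rat q * of_int tw
      + of_rat q * of_rat q * (of_int tw * w - w * w)"
    unfolding x cnj_K_rep by (simp add: of_rat_add of_rat_mult of_rat_minus algebra_simps)
  also have "\<dots> = of_rat (p * p + p * q * of_int tw + q * q * of_int nw)"
    by (simp add: w_sq of_rat_add of_rat_mult)
  finally show "\<exists>s. x * cnj x = of_rat s" ..
qed

lemma K_inverse: assumes "x \<in> K" shows "inverse x \<in> K"
proof (cases "x = 0")
  case False
  obtain s where s: "x * cnj x = of_rat s" using K_trace_norm[OF assms] by auto
  have "inverse x = cnj x * inverse (x * cnj x)" using False by (simp add: field_simps)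
  also have "\<dots> = cnj x * of_rat (inverse s)" by (simp add: s of_rat_inverse)
  finally show ?thesis using K_mult[OF K_cnj[OF assms] K_of_rat] by simp
qed (simp add: K_0)

lemma K_divide: "x \<in> K \<Longrightarrow> y \<in> K \<Longrightarrow> x / y \<in> K"
  by (simp add: divide_inverse K_mult K_inverse)

lemmas K_closed = K_0 K_1 K_of_int K_of_nat K_add K_diff K_uminus K_mult K_inverse K_divide K_cnj K_w

section \<open>Orders in coordinates\<close>

definition Ord :: "nat \<Rightarrow> complex set" where
  "Ord n = {of_int i + of_int j * w | i j. int n dvd j}"

lemma rep_unique: "of_int i + of_int j * w = of_int i' + of_int j' * w \<longleftrightarrow> i = i' \<and> j = j'"
proof
  assume e: "of_int i + of_int j * w = of_int i' + of_int j' * w"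
  then have "Im (of_int i + of_int j * w) = Im (of_int i' + of_int j' * w)" by simp
  then have "j = j'" using Im_w by simp
  with e show "i = i' \<and> j = j'" by simp
qed simp

lemma Ord_iff: "of_int i + of_int j * w \<in> Ord n \<longleftrightarrow> int n dvd j"
  by (auto simp: Ord_def rep_unique)

lemma Ord_memI: "int n dvd j \<Longrightarrow> of_int i + of_int j * w \<in> Ord n" by (simp add: Ord_iff)

lemma Ord_memI': "x = of_int i + of_int j * w \<Longrightarrow> int n dvd j \<Longrightarrow> x \<in> Ord n" by (simp add: Ord_iff)

lemma Ord_memE: assumes "x \<in> Ord n" obtains i j where "x = of_int i + of_int j * w" "int n dvd j"
  using assms by (auto simp: Ord_def)

lemma Ord_of_int: "of_int i \<in> Ord n" using Ord_iff[of i 0] by simp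
lemma Ord_1_mem: "1 \<in> Ord n" using Ord_of_int[of 1] by simp
lemma Ord_of_int_w: "of_int j * w \<in> Ord n \<longleftrightarrow> int n dvd j" using Ord_iff[of 0 j] by simp
lemma Ord_of_nat_w: "of_nat j * w \<in> Ord n \<longleftrightarrow> n dvd j" using Ord_of_int_w[of "int j"] by simp

lemma order_cond_eq: "order_cond K n = Ord n"
proof (intro set_eqI iffI)
  fix x assume "x \<in> order_cond K n"
  then obtain a i j where "x = of_int a + of_nat n * (of_int i + of_int j * w)"
    unfolding order_cond_def ring_of_integers_eq by blast
  then have "x = of_int (a + int n * i) + of_int (int n * j) * w" by (simp add: algebra_simps)
  then show "x \<in> Ord n" by (rule Ord_memI') simp
next
  fix x assume "x \<in> Ord n"
  then obtain i j where x: "x = of_int i + of_int j * w" "int n dvd j" by (rule Ord_memE)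
  then obtain k where "j = int n * k" by (auto elim: dvdE)
  then have "x = of_int i + of_nat n * (of_int 0 + of_int k * w)" using x by simp
  then show "x \<in> order_cond K n" unfolding order_cond_def ring_of_integers_eq by blast
qed

lemma sgrp_Ord: "sgrp (Ord n)"
  unfolding sgrp_def
proof (intro conjI ballI)
  show "0 \<in> Ord n" using Ord_of_int[of 0] by simp
  fix x y assume "x \<in> Ord n" "y \<in> Ord n"
  then obtain i j i' j' where "x = of_int i + of_int j * w" "y = of_int i' + of_int j' * w"
    "int n dvd j" "int n dvd j'" by (auto elim!: Ord_memE)
  then have "x - y = of_int (i - i') + of_int (j - j') * w" "int n dvd j - j'"
    by (auto simp: algebra_simps)
  then show "x - y \<in> Ord n" using Ord_memI by metis
qed

lemma Ord_mult: "x \<in> Ord n \<Longrightarrow> y \<in> Ord n \<Longrightarrow> x * y \<in> Ord n"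
proof (elim Ord_memE)
  fix i j i' j' assume *: "x = of_int i + of_int j * w" "y = of_int i' + of_int j' * w"
    "int n dvd j" "int n dvd j'"
  then have "x * y = of_int (i * i') + of_int (i * j' + j * i') * w + of_int (j * j') * (w * w)"
    by (simp add: algebra_simps)
  also have "\<dots> = of_int (i * i' - j * j' * nw) + of_int (i * j' + j * i' + j * j' * tw) * w"
    by (simp add: w_sq algebra_simps)
  finally show "x * y \<in> Ord n" using * by (elim Ord_memI') simp
qed

lemma cnj_rep: "cnj (of_int i + of_int j * w) = of_int (i + j * tw) + of_int (- j) * w"
  by (simp add: cnj_w algebra_simps)

lemma Ord_cnj: "x \<in> Ord n \<Longrightarrow> cnj x \<in> Ord n"
  by (elim Ord_memE) (metis cnj_rep Ord_memI dvd_minus_iff)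

lemma Ord_mono: "m dvd n \<Longrightarrow> Ord n \<subseteq> Ord m"
proof
  fix x assume "m dvd n" "x \<in> Ord n"
  then obtain i j where "x = of_int i + of_int j * w" "int n dvd j" "int m dvd int n" by (auto elim: Ord_memE)
  then show "x \<in> Ord m" by (intro Ord_memI'[of x i j]) (auto intro: dvd_trans)
qed

lemma Ord_subset_iff: "Ord n \<subseteq> Ord m \<longleftrightarrow> m dvd n"
  using Ord_mono Ord_of_nat_w[of n n] Ord_of_nat_w[of n m] by auto

lemma Ord_eq_iff: "Ord n = Ord m \<longleftrightarrow> n = m"
  by (metis Ord_subset_iff dvd_antisym order_refl)

lemma Ord_subset_K: "Ord n \<subseteq> K"
  by (auto elim!: Ord_memE intro!: K_closed)

lemma Ord_Int: "Ord a \<inter> Ord b = Ord (lcm a b)"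
proof (intro set_eqI iffI)
  fix x assume "x \<in> Ord a \<inter> Ord b"
  then obtain i j where x: "x = of_int i + of_int j * w" "int a dvd j" "x \<in> Ord b" by (auto elim: Ord_memE)
  then have "int b dvd j" by (simp add: Ord_iff)
  then have "int (lcm a b) dvd j" using x(2) by (simp flip: lcm_int_int_eq)
  then show "x \<in> Ord (lcm a b)" using x by (simp add: Ord_iff)
next
  fix x assume "x \<in> Ord (lcm a b)"
  then show "x \<in> Ord a \<inter> Ord b" using Ord_mono[of a "lcm a b"] Ord_mono[of b "lcm a b"] by auto
qed

text \<open>The product contains \<open>a * w\<close> and \<open>b * w\<close>, hence
  \<open>gcd a b * w\<close> by Bezout.\<close>

lemma lprod_Ord: "lprod (Ord a) (Ord b) = Ord (gcd a b)"
proof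
  have *: "Ord a \<subseteq> Ord (gcd a b)" "Ord b \<subseteq> Ord (gcd a b)" by (auto intro!: Ord_mono)
  then show "lprod (Ord a) (Ord b) \<subseteq> Ord (gcd a b)"
    by (intro lprod_least sgrp_Ord) (auto intro: Ord_mult)
  let ?P = "lprod (Ord a) (Ord b)"
  have 1: "Ord a \<subseteq> ?P" using lprod_memI[OF _ Ord_1_mem, of _ "Ord a" b] by fastforce
  have 2: "Ord b \<subseteq> ?P" using lprod_memI[OF Ord_1_mem, of _ "Ord b" a] by fastforce
  show "Ord (gcd a b) \<subseteq> ?P"
  proof
    fix x assume "x \<in> Ord (gcd a b)"
    then obtain i j where x: "x = of_int i + of_int j * w" "int (gcd a b) dvd j" by (rule Ord_memE)
    obtain k where k: "j = gcd (int a) (int b) * k" using x(2) by (auto elim!: dvdE)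
    obtain r s where rs: "r * int a + s * int b = gcd (int a) (int b)" using bezout_int by blast
    have "x = (of_int i + of_int (k * r * int a) * w) + of_int (k * s * int b) * w"
      unfolding x k rs[symmetric] by (simp add: algebra_simps)
    moreover have "of_int i + of_int (k * r * int a) * w \<in> ?P" using 1 by (rule subsetD) (rule Ord_memI, simp)
    moreover have "of_int (k * s * int b) * w \<in> ?P" using 2 by (rule subsetD) (simp only: Ord_of_int_w, simp)
    ultimately show "x \<in> ?P" using sgrp_add[OF sgrp_lprod] by metis
  qed
qed

section \<open>Lattices of the field\<close>

lemma K_denom: assumes "x \<in> K" obtains m :: nat where "m > 0" "of_nat m * x \<in> Ord 1"
proof -
  obtain p q where x: "x = of_rat p + of_rat q * w" using assms by (rule K_memE)
  obtain a b where ab: "quotient_of p = (a, b)" by fastforce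
  obtain c d where cd: "quotient_of q = (c, d)" by fastforce
  have b: "b > 0" "of_rat p = (of_int a / of_int b :: complex)"
    using quotient_of_denom_pos[OF ab] quotient_of_div[OF ab] by (simp_all add: of_rat_divide)
  have d: "d > 0" "of_rat q = (of_int c / of_int d :: complex)"
    using quotient_of_denom_pos[OF cd] quotient_of_div[OF cd] by (simp_all add: of_rat_divide)
  have "of_nat (nat (b * d)) = (of_int b * of_int d :: complex)" using b d by simp
  then have "of_nat (nat (b * d)) * x = of_int (a * d) + of_int (c * b) * w"
    unfolding x b d using b(1) d(1) by (simp add: field_simps)
  then have "of_nat (nat (b * d)) * x \<in> Ord 1" by (rule Ord_memI') simp
  then show ?thesis using that[of "nat (b * d)"] b d by simp
qed

text \<open>Commensurability with the maximal order is used in place of a basis, because closure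
  under products, intersections, scaling and conjugation then only concerns denominators.
  \<open>klat_iff\<close> gives the link with \<open>K_lattice\<close>.\<close>

definition klat :: "complex set \<Rightarrow> bool" where
  "klat L \<longleftrightarrow> sgrp L \<and> L \<subseteq> K \<and>
     (\<exists>m::nat. m > 0 \<and> (\<forall>x\<in>Ord 1. of_nat m * x \<in> L) \<and> (\<forall>x\<in>L. of_nat m * x \<in> Ord 1))"

lemma klat_sgrp: "klat L \<Longrightarrow> sgrp L" and klat_K: "klat L \<Longrightarrow> L \<subseteq> K"
  by (auto simp: klat_def)

lemma klatE:
  assumes "klat L" obtains m :: nat where "m > 0" "\<And>x. x \<in> Ord 1 \<Longrightarrow> of_nat m * x \<in> L"
    "\<And>x. x \<in> L \<Longrightarrow> of_nat m * x \<in> Ord 1"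
  using assms by (auto simp: klat_def)

lemma klat_Ord: "n > 0 \<Longrightarrow> klat (Ord n)"
  unfolding klat_def
proof (intro conjI sgrp_Ord Ord_subset_K exI[of _ n] ballI)
  fix x assume "x \<in> Ord 1"
  then obtain i j where "x = of_int i + of_int j * w" by (auto elim: Ord_memE)
  then have "of_nat n * x = of_int (int n * i) + of_int (int n * j) * w" by (simp add: algebra_simps)
  then show "of_nat n * x \<in> Ord n" by (simp only: Ord_iff) simp
next
  fix x assume "x \<in> Ord n"
  then show "of_nat n * x \<in> Ord 1" using Ord_mono[of 1 n] sgrp_of_nat_mult[OF sgrp_Ord] by auto
qed

lemma klat_between:
  assumes "sgrp H" "klat A" "klat B" "A \<subseteq> H" "H \<subseteq> B" shows "klat H"
proof -
  obtain m where m: "m > 0" "\<And>x. x \<in> Ord 1 \<Longrightarrow> of_nat m * x \<in> A" using assms(2) by (rule klatE) blast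
  obtain m' where m': "m' > 0" "\<And>x. x \<in> B \<Longrightarrow> of_nat m' * x \<in> Ord 1" using assms(3) by (rule klatE) blast
  show ?thesis unfolding klat_def
  proof (intro conjI exI[of _ "m * m'"] ballI)
    show "H \<subseteq> K" using klat_K assms by blast
    show "of_nat (m * m') * x \<in> H" if "x \<in> Ord 1" for x
      using sgrp_of_nat_mult[OF assms(1), of "of_nat m * x" m'] m(2)[OF that] assms(4)
      by (simp add: mult_ac subset_iff)
    show "of_nat (m * m') * x \<in> Ord 1" if "x \<in> H" for x
      using sgrp_of_nat_mult[OF sgrp_Ord, of "of_nat m' * x" 1 m] m'(2)[of x] that assms(5)
      by (simp add: mult_ac subset_iff)
  qed (use m m' assms in auto)
qed

lemma klat_smul: assumes "klat L" "c \<in> K" "c \<noteq> 0" shows "klat (smul c L)"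
proof -
  obtain m where m: "m > 0" "\<And>x. x \<in> Ord 1 \<Longrightarrow> of_nat m * x \<in> L"
    "\<And>x. x \<in> L \<Longrightarrow> of_nat m * x \<in> Ord 1" using assms(1) by (rule klatE) blast
  obtain k where k: "k > 0" "of_nat k * c \<in> Ord 1" using K_denom[OF assms(2)] .
  obtain l where l: "l > 0" "of_nat l * inverse c \<in> Ord 1" using K_denom[OF K_inverse[OF assms(2)]] .
  show ?thesis unfolding klat_def
  proof (intro conjI exI[of _ "m * k * l"] ballI)
    show "sgrp (smul c L)" using assms klat_sgrp sgrp_smul by blast
    show "smul c L \<subseteq> K" using assms klat_K K_mult by (auto simp: smul_def)
    show "m * k * l > 0" using m k l by simp
    fix x assume x: "x \<in> Ord 1"
    have "of_nat m * (of_nat l * inverse c * x) \<in> L" using l x Ord_mult m by blast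
    then have "of_nat k * (of_nat m * (of_nat l * inverse c * x)) \<in> L"
      using sgrp_of_nat_mult[OF klat_sgrp[OF assms(1)]] by blast
    then have "c * (of_nat k * (of_nat m * (of_nat l * inverse c * x))) \<in> smul c L" by (rule smul_memI)
    then show "of_nat (m * k * l) * x \<in> smul c L" using assms(3) by (simp add: field_simps)
  next
    fix x assume "x \<in> smul c L"
    then obtain y where y: "y \<in> L" "x = c * y" by (auto simp: smul_def)
    have "of_nat l * ((of_nat k * c) * (of_nat m * y)) \<in> Ord 1"
      using sgrp_of_nat_mult[OF sgrp_Ord] Ord_mult[OF k(2) m(3)[OF y(1)]] by blast
    then show "of_nat (m * k * l) * x \<in> Ord 1" using y by (simp add: mult_ac)
  qed
qed

lemma klat_nonzero: assumes "klat L" obtains x where "x \<in> L" "x \<noteq> 0"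
proof -
  obtain m where m: "m > 0" "\<And>x. x \<in> Ord 1 \<Longrightarrow> of_nat m * x \<in> L"
    using assms by (rule klatE) blast
  from m(2)[OF Ord_1_mem] m(1) that show ?thesis by simp
qed

lemma klat_lprod: assumes "klat A" "klat B" shows "klat (lprod A B)"
proof -
  obtain a where a: "a \<in> A" "a \<noteq> 0" using klat_nonzero[OF assms(1)] .
  obtain m where m: "m > 0" "\<And>x. x \<in> A \<Longrightarrow> of_nat m * x \<in> Ord 1" using assms(1) by (rule klatE) blast
  obtain k where k: "k > 0" "\<And>x. x \<in> B \<Longrightarrow> of_nat k * x \<in> Ord 1" using assms(2) by (rule klatE) blast
  have mk: "of_nat (m * k) \<noteq> (0::complex)" using m k by simp
  show ?thesis
  proof (rule klat_between[OF sgrp_lprod])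
    show "klat (smul a B)" using a assms klat_K by (auto intro!: klat_smul)
    show "klat (smul (1 / of_nat (m * k)) (Ord 1))"
      using mk by (intro klat_smul klat_Ord K_closed) auto
    show "smul a B \<subseteq> lprod A B" using a by (auto simp: smul_def intro: lprod_memI)
    show "lprod A B \<subseteq> smul (1 / of_nat (m * k)) (Ord 1)"
    proof (rule lprod_least[OF sgrp_smul[OF sgrp_Ord]])
      fix x y assume "x \<in> A" "y \<in> B"
      then have "(of_nat m * x) * (of_nat k * y) \<in> Ord 1" using m k Ord_mult by blast
      then show "x * y \<in> smul (1 / of_nat (m * k)) (Ord 1)"
        using mk by (simp add: in_smul_iff mult_ac)
    qed
  qed
qed

lemma klat_Int: assumes "klat A" "klat B" shows "klat (A \<inter> B)"
proof -
  obtain m where m: "m > 0" "\<And>x. x \<in> Ord 1 \<Longrightarrow> of_nat m * x \<in> A" using assms(1) by (rule klatE) blast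
  obtain k where k: "k > 0" "\<And>x. x \<in> Ord 1 \<Longrightarrow> of_nat k * x \<in> B" using assms(2) by (rule klatE) blast
  show ?thesis
  proof (rule klat_between[of _ "smul (of_nat (m * k)) (Ord 1)" A])
    show "klat (smul (of_nat (m * k)) (Ord 1))" using m k by (intro klat_smul klat_Ord K_closed) auto
    show "sgrp (A \<inter> B)" using assms by (intro sgrp_Int klat_sgrp)
    show "smul (of_nat (m * k)) (Ord 1) \<subseteq> A \<inter> B"
    proof
      fix x assume "x \<in> smul (of_nat (m * k)) (Ord 1)"
      then obtain y where y: "y \<in> Ord 1" "x = of_nat k * (of_nat m * y)" "x = of_nat m * (of_nat k * y)"
        by (auto simp: smul_def mult_ac)
      then show "x \<in> A \<inter> B"
        using sgrp_of_nat_mult[OF klat_sgrp[OF assms(1)] m(2)[OF y(1)], of k]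
          sgrp_of_nat_mult[OF klat_sgrp[OF assms(2)] k(2)[OF y(1)], of m] y(2,3) by (metis IntI)
    qed
  qed (use assms in auto)
qed

lemma klat_cnj: assumes "klat L" shows "klat (cnj ` L)"
proof -
  obtain m where m: "m > 0" "\<And>x. x \<in> Ord 1 \<Longrightarrow> of_nat m * x \<in> L"
    "\<And>x. x \<in> L \<Longrightarrow> of_nat m * x \<in> Ord 1" using assms(1) by (rule klatE) blast
  show ?thesis unfolding klat_def
  proof (intro conjI exI[of _ m] ballI)
    show "sgrp (cnj ` L)" using klat_sgrp[OF assms] by (rule sgrp_image) simp
    show "cnj ` L \<subseteq> K" using klat_K[OF assms] K_cnj by auto
    show "of_nat m * x \<in> cnj ` L" if "x \<in> Ord 1" for x
      using m(2)[OF Ord_cnj[OF that]] by (intro image_eqI[of _ _ "of_nat m * cnj x"]) simp_all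
    show "of_nat m * x \<in> Ord 1" if "x \<in> cnj ` L" for x
    proof -
      have "cnj x \<in> L" using that by auto
      then show ?thesis using Ord_cnj[OF m(3), of "cnj x"] by simp
    qed
  qed (use m in auto)
qed

lemma klat_zspan: assumes "u \<in> K" "v \<in> K" "Im (cnj u * v) \<noteq> 0" shows "klat (zspan u v)"
proof -
  obtain k where k: "k > 0" "of_nat k * u \<in> Ord 1" using K_denom[OF assms(1)] .
  obtain l where l: "l > 0" "of_nat l * v \<in> Ord 1" using K_denom[OF assms(2)] .
  define m where "m = k * l"
  have m: "m > 0" using k l by (simp add: m_def)
  have mu: "of_nat m * u \<in> Ord 1" "of_nat m * v \<in> Ord 1"
    using sgrp_of_nat_mult[OF sgrp_Ord k(2), of l] sgrp_of_nat_mult[OF sgrp_Ord l(2), of k]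
    by (simp_all add: m_def mult_ac)
  obtain i j where ij: "of_nat m * u = of_int i + of_int j * w" using mu(1) by (rule Ord_memE)
  obtain i' j' where ij': "of_nat m * v = of_int i' + of_int j' * w" using mu(2) by (rule Ord_memE)
  \<comment> \<open>The determinant of \<open>m * u\<close> and \<open>m * v\<close> in the basis
    \<open>1, w\<close>. By Cramer's rule \<open>D\<close> and \<open>D * w\<close> lie in the
    span.\<close>
  define D where "D = i * j' - i' * j"
  have "Im (cnj (of_nat m * u) * (of_nat m * v)) = of_int D * Im w"
    unfolding ij ij' D_def by (simp add: algebra_simps)
  moreover have "cnj (of_nat m * u) * (of_nat m * v) = of_real ((of_nat m)\<^sup>2) * (cnj u * v)"
    by (simp add: power2_eq_square)
  ultimately have "(of_nat m)\<^sup>2 * Im (cnj u * v) = of_int D * Im w" by (metis Im_of_real_mult)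
  then have D: "D \<noteq> 0" using assms(3) m by auto
  have "of_int D * (1::complex) = of_int j' * (of_nat m * u) - of_int j * (of_nat m * v)"
    unfolding ij ij' D_def by (simp add: algebra_simps)
  also have "\<dots> = of_int (j' * int m) * u + of_int (- j * int m) * v" by (simp add: algebra_simps)
  finally have D1: "of_int D \<in> zspan u v" by (simp only: mult_1_right) (rule zspan_memI)
  have "of_int D * w = of_int i * (of_nat m * v) - of_int i' * (of_nat m * u)"
    unfolding ij ij' D_def by (simp add: algebra_simps)
  also have "\<dots> = of_int (- i' * int m) * u + of_int (i * int m) * v" by (simp add: algebra_simps)
  finally have D2: "of_int D * w \<in> zspan u v" by (rule zspan_memI')
  show ?thesis
  proof (rule klat_between[OF sgrp_zspan])
    show "klat (smul (of_int D) (Ord 1))" using D by (intro klat_smul klat_Ord K_closed) auto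
    show "klat (smul (1 / of_nat m) (Ord 1))" using m by (intro klat_smul klat_Ord K_closed) auto
    show "smul (of_int D) (Ord 1) \<subseteq> zspan u v"
    proof
      fix x assume "x \<in> smul (of_int D) (Ord 1)"
      then obtain y where y: "y \<in> Ord 1" "x = of_int D * y" by (auto simp: smul_def)
      obtain a b where "y = of_int a + of_int b * w" using y(1) by (rule Ord_memE)
      then have "x = of_int D * (of_int a + of_int b * w)" using y by simp
      then have "x = of_int a * of_int D + of_int b * (of_int D * w)" by (simp add: algebra_simps)
      then show "x \<in> zspan u v" using D1 D2 by (simp add: sgrp_add sgrp_of_int_mult sgrp_zspan)
    qed
    show "zspan u v \<subseteq> smul (1 / of_nat m) (Ord 1)"
      by (rule zspan_least[OF sgrp_smul[OF sgrp_Ord]]) (use mu m in \<open>simp_all add: in_smul_iff mult.commute\<close>)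
  qed
qed

text \<open>Hermite normal form: after scaling into the maximal order, \<open>e\<close> generates
  the intersection with the integers and \<open>d\<close> generates the projection to the coordinate
  of \<open>w\<close>. Both are positive, so the basis is oriented like \<open>1, w\<close>.\<close>

lemma klat_basis:
  assumes "klat L"
  obtains u v where "L = zspan u v" "u \<in> K" "v \<in> K" "Im (cnj u * v) / Im w > 0"
proof -
  obtain m where m: "m > 0" "\<And>x. x \<in> Ord 1 \<Longrightarrow> of_nat m * x \<in> L"
    "\<And>x. x \<in> L \<Longrightarrow> of_nat m * x \<in> Ord 1" using assms(1) by (rule klatE) blast
  define H where "H = smul (of_nat m) L"
  have H: "sgrp H" unfolding H_def using assms klat_sgrp sgrp_smul by blast
  have m0: "(of_nat m :: complex) \<noteq> 0" using m by simp
  have "\<exists>d\<ge>0. {j. \<exists>i. of_int i + of_int j * w \<in> H} = {d * k | k. True}"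
  proof (rule int_sgrp_principal, unfold sgrp_def, intro conjI ballI)
    show "0 \<in> {j. \<exists>i. of_int i + of_int j * w \<in> H}"
      using sgrp_0[OF H] by (auto intro!: exI[of _ 0])
    fix x y assume "x \<in> {j. \<exists>i. of_int i + of_int j * w \<in> H}" "y \<in> {j. \<exists>i. of_int i + of_int j * w \<in> H}"
    then obtain a b where "of_int a + of_int x * w \<in> H" "of_int b + of_int y * w \<in> H" by auto
    then have "(of_int a + of_int x * w) - (of_int b + of_int y * w) \<in> H" by (rule sgrp_diff[OF H])
    then show "x - y \<in> {j. \<exists>i. of_int i + of_int j * w \<in> H}"
      by (intro CollectI exI[of _ "a - b"]) (simp add: algebra_simps)
  qed
  then obtain d where d: "d \<ge> 0" "{j. \<exists>i. of_int i + of_int j * w \<in> H} = {d * k | k. True}" by blast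
  have "\<exists>e\<ge>0. {i. of_int i \<in> H} = {e * k | k. True}"
    by (rule int_sgrp_principal) (rule sgrp_vimage[OF H], simp)
  then obtain e where e: "e \<ge> 0" "{i. of_int i \<in> H} = {e * k | k. True}" by blast
  have "of_nat m * of_nat m \<in> H" using m(2)[OF Ord_1_mem] smul_memI unfolding H_def by fastforce
  then have "int (m * m) \<in> {i. of_int i \<in> H}" by simp
  then have e0: "e > 0" using e m by (cases "e = 0") auto
  have "of_nat m * (of_nat m * w) \<in> H" unfolding H_def
    using m(2)[of w] Ord_of_nat_w[of 1 1] by (auto intro: smul_memI)
  then have "of_int 0 + of_int (int (m * m)) * w \<in> H" by (simp add: mult.assoc)
  then have "int (m * m) \<in> {j. \<exists>i. of_int i + of_int j * w \<in> H}" by blast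
  then have d0: "d > 0" using d m by (cases "d = 0") auto
  have "d \<in> {d * k | k. True}" by (auto intro!: exI[of _ 1])
  then obtain i1 where i1: "of_int i1 + of_int d * w \<in> H" using d(2) by blast
  have "e \<in> {e * k | k. True}" by (auto intro!: exI[of _ 1])
  then have e1: "of_int e \<in> H" using e(2) by blast
  have "H = zspan (of_int e) (of_int i1 + of_int d * w)"
  proof
    show "zspan (of_int e) (of_int i1 + of_int d * w) \<subseteq> H" using zspan_least[OF H e1 i1] .
    show "H \<subseteq> zspan (of_int e) (of_int i1 + of_int d * w)"
    proof
      fix x assume x: "x \<in> H"
      then have "x \<in> Ord 1" using m(3) by (auto simp: H_def smul_def)
      then obtain i j where ij: "x = of_int i + of_int j * w" by (rule Ord_memE)
      then obtain k where k: "j = d * k" using x d(2) by blast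
      have "x - of_int k * (of_int i1 + of_int d * w) \<in> H"
        using sgrp_diff[OF H x sgrp_of_int_mult[OF H i1]] .
      then have "of_int (i - k * i1) \<in> H" by (simp add: ij k algebra_simps)
      then obtain l where "i - k * i1 = e * l" using e(2) by blast
      then have "i = e * l + k * i1" by simp
      then have "x = of_int l * of_int e + of_int k * (of_int i1 + of_int d * w)"
        by (simp add: ij k algebra_simps)
      then show "x \<in> zspan (of_int e) (of_int i1 + of_int d * w)" by (rule zspan_memI')
    qed
  qed
  then have "smul (1 / of_nat m) H = zspan (1 / of_nat m * of_int e) (1 / of_nat m * (of_int i1 + of_int d * w))"
    using smul_zspan by simp
  moreover have "smul (1 / of_nat m) H = L" using m0 by (simp add: H_def)
  moreover have "Im (cnj (1 / of_nat m * of_int e) * (1 / of_nat m * (of_int i1 + of_int d * w))) / Im w > 0"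
  proof -
    have "cnj (1 / of_nat m * of_int e) * (1 / of_nat m * (of_int i1 + of_int d * w))
       = of_real (of_int e / (of_nat m)\<^sup>2) * (of_int i1 + of_int d * w)"
      by (simp add: power2_eq_square)
    also have "Im \<dots> = of_int e / (of_nat m)\<^sup>2 * (of_int d * Im w)" by (subst Im_of_real_mult) simp
    finally show ?thesis using Im_w d0 e0 m by simp
  qed
  ultimately show ?thesis
    using that[of "1 / of_nat m * of_int e" "1 / of_nat m * (of_int i1 + of_int d * w)"]
    by (auto intro!: K_closed)
qed

lemma klat_iff: "K_lattice K L \<longleftrightarrow> klat L"
proof
  assume "K_lattice K L"
  then obtain u v where "Im (cnj u * v) \<noteq> 0" "L = zspan u v" "L \<subseteq> K"
    by (auto simp: K_lattice_def C_lattice_def R_indep_complex Z_span2_eq_zspan)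
  then show "klat L" using zspan_basis klat_zspan by (metis subsetD)
next
  assume L: "klat L"
  obtain u v where uv: "L = zspan u v" "u \<in> K" "v \<in> K" "Im (cnj u * v) / Im w > 0"
    using klat_basis[OF L] .
  then have "Im (cnj u * v) \<noteq> 0" by auto
  then show "K_lattice K L" using uv klat_K[OF L]
    by (auto simp: K_lattice_def C_lattice_def R_indep_complex Z_span2_eq_zspan)
qed


lemma zspan_1_eq_Ord: "zspan 1 (of_int i + of_nat n * w) = Ord n"
proof (intro equalityI zspan_least sgrp_Ord Ord_1_mem)
  show "of_int i + of_nat n * w \<in> Ord n" by (rule Ord_memI'[of _ i "int n"]) simp_all
  show "Ord n \<subseteq> zspan 1 (of_int i + of_nat n * w)"
  proof
    fix x assume "x \<in> Ord n"
    then obtain a b where x: "x = of_int a + of_int b * w" "int n dvd b" by (rule Ord_memE)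
    obtain k where "b = int n * k" using x(2) by (rule dvdE)
    then show "x \<in> zspan 1 (of_int i + of_nat n * w)"
      using x by (intro zspan_memI'[of _ "a - k * i" _ k]) (simp add: algebra_simps)
  qed
qed

text \<open>Let \<open>t = v / u\<close> be a root of the primitive form \<open>A, B, C\<close>.
  Then \<open>\<theta> = A * t\<close> is integral, and the products of \<open>u, v\<close> with
  their conjugates are \<open>N\<close> times \<open>A\<close>, \<open>C\<close>, \<theta> and its
  conjugate, where \<open>N\<close> is the squared length of \<open>u\<close> over \<open>A\<close>.
  By primitivity they span \<open>N\<close> times the ring generated by \<theta>, which is thus the
  multiplier ring, and \<open>L\<close> is invertible over it. The form \<open>A, B, C\<close>
  returned here is the norm form of \<open>L\<close> divided by \<open>N\<close>.\<close>

lemma lattice_structure: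
  assumes "klat L"
  obtains u v and N :: real and n :: nat and A B C :: int
  where "L = zspan u v" "u \<in> K" "v \<in> K" "u \<noteq> 0" "N > 0" "n > 0" "multipliers K L = Ord n"
    "lprod L (cnj ` L) = smul (of_real N) (Ord n)"
    "cnj u * v - u * cnj v = of_real N * of_nat n * (w - cnj w)"
    "gcd A (gcd B C) = 1" "u * cnj u = of_real N * of_int A" "v * cnj v = of_real N * of_int C"
    "u * cnj v + v * cnj u = of_real N * of_int B"
proof -
  obtain u v where uv: "L = zspan u v" "u \<in> K" "v \<in> K" "Im (cnj u * v) / Im w > 0"
    using klat_basis[OF assms] .
  have u0: "u \<noteq> 0" using uv(4) by auto
  define t where "t = v / u"
  have tK: "t \<in> K" using uv by (simp add: t_def K_divide)
  have vt: "v = u * t" using u0 by (simp add: t_def)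
  obtain r where r: "t + cnj t = of_rat r" using K_trace_norm[OF tK] by auto
  obtain s where s: "t * cnj t = of_rat s" using K_trace_norm[OF tK] by auto
  obtain A B C :: int where ABC: "A > 0" "gcd A (gcd B C) = 1"
    "of_int A * t\<^sup>2 + of_int B * t + of_int C = 0"
    "of_int A * (t + cnj t) = - of_int B" "of_int A * (t * cnj t) = of_int C"
    using primitive_quadratic[OF r s] by blast
  define N where "N = (cmod u)\<^sup>2 / of_int A"
  have N0: "N > 0" using ABC(1) u0 by (simp add: N_def)
  have A0: "(of_int A :: complex) \<noteq> 0" using ABC(1) by simp
  define \<theta> where "\<theta> = of_int A * t"
  have uu: "u * cnj u = of_real N * of_int A"
    using A0 unfolding N_def by (simp add: complex_norm_square[symmetric])
  have cuv: "cnj u * v = of_real N * \<theta>"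
    using uu by (simp add: vt \<theta>_def mult_ac)
  then have ucv: "u * cnj v = of_real N * cnj \<theta>"
    by (metis complex_cnj_cnj complex_cnj_complex_of_real complex_cnj_mult)
  have vv: "v * cnj v = of_real N * of_int C"
  proof -
    have "v * cnj v = (u * cnj u) * (t * cnj t)" by (simp add: vt)
    also have "\<dots> = of_real N * (of_int A * (t * cnj t))" by (simp add: uu)
    finally show ?thesis by (simp add: ABC)
  qed
  have th: "\<theta> + cnj \<theta> = - of_int B" using ABC(4) by (simp add: \<theta>_def distrib_left)
  have "\<theta> * \<theta> + of_int B * \<theta> + of_int (A * C) = of_int A * (of_int A * t\<^sup>2 + of_int B * t + of_int C)"
    by (simp add: \<theta>_def power2_eq_square algebra_simps)
  then have th2: "\<theta>\<^sup>2 + of_int B * \<theta> + of_int (A * C) = 0" by (simp only: ABC(3) power2_eq_square[of \<theta>] mult_zero_right)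
  have "\<theta> \<in> ring_of_integers K"
    using alg_integer_quadratic[OF th2] tK by (simp add: ring_of_integers_def \<theta>_def K_mult K_of_int)
  then obtain i j where ij: "\<theta> = of_int i + of_int j * w" unfolding ring_of_integers_eq by blast
  have "Im (cnj u * v) = N * (of_int j * Im w)"
    unfolding cuv by (subst Im_of_real_mult) (simp add: ij)
  then have "N * of_int j > 0" using uv(4) Im_w by simp
  then have j: "j > 0" using N0 by (simp add: zero_less_mult_iff)
  define n where "n = nat j"
  have n: "n > 0" "j = int n" using j by (simp_all add: n_def)
  have R: "zspan 1 \<theta> = Ord n" using zspan_1_eq_Ord[of i n] by (simp add: ij n)
  have thR: "\<theta> \<in> Ord n" using R zspan_basis(2) by blast
  define P where "P = lprod L (cnj ` L)"
  have uL: "u \<in> L" "v \<in> L" using zspan_basis uv by auto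
  have P_eq: "P = smul (of_real N) (Ord n)"
  proof
    show "P \<subseteq> smul (of_real N) (Ord n)"
      unfolding P_def
    proof (rule lprod_least[OF sgrp_smul[OF sgrp_Ord]])
      fix x y assume "x \<in> L" "y \<in> cnj ` L"
      then obtain a b c d where x: "x = of_int a * u + of_int b * v" and y: "y = cnj (of_int c * u + of_int d * v)"
        by (auto simp: uv zspan_def)
      have "x * y = of_int (a * c) * (u * cnj u) + of_int (a * d) * (u * cnj v)
          + of_int (b * c) * (cnj u * v) + of_int (b * d) * (v * cnj v)"
        by (simp add: x y algebra_simps)
      also have "\<dots> = of_real N * (of_int (a * c * A + b * d * C) + of_int (a * d) * cnj \<theta> + of_int (b * c) * \<theta>)"
        unfolding uu ucv cuv vv by (simp add: algebra_simps)
      finally show "x * y \<in> smul (of_real N) (Ord n)"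
        by (auto intro!: smul_memI sgrp_add[OF sgrp_Ord] sgrp_of_int_mult[OF sgrp_Ord] thR Ord_cnj Ord_of_int
            simp del: of_int_add of_int_mult)
    qed
    have sP: "sgrp P" by (simp add: P_def sgrp_lprod)
    have "v * cnj u + u * cnj v = of_real N * (\<theta> + cnj \<theta>)"
      by (simp only: ucv mult.commute[of v] cuv distrib_left)
    then have uBv: "v * cnj u + u * cnj v = of_real N * (- of_int B)" by (simp only: th)
    \<comment> \<open>Primitivity enters here: the Bezout coefficients of \<open>A, B, C\<close>
      express \<open>N\<close> by the two norms and the trace term, all of which lie in
      \<open>P\<close>.\<close>
    obtain \<alpha> \<beta>' where ab: "\<alpha> * A + \<beta>' * gcd B C = 1" using ABC(2) bezout_int[of A "gcd B C"] by auto
    obtain \<beta> \<gamma> where bg: "\<beta> * B + \<gamma> * C = gcd B C" using bezout_int[of B C] by auto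
    have 1: "1 = \<alpha> * A + \<beta>' * (\<beta> * B + \<gamma> * C)" using ab bg by simp
    have "complex_of_real N = of_real N * of_int (\<alpha> * A + \<beta>' * (\<beta> * B + \<gamma> * C))" by (simp only: 1[symmetric]) simp
    also have "\<dots> = of_int \<alpha> * (of_real N * of_int A) - of_int (\<beta>' * \<beta>) * (of_real N * (- of_int B))
        + of_int (\<beta>' * \<gamma>) * (of_real N * of_int C)"
      by (simp add: algebra_simps)
    also have "\<dots> = of_int \<alpha> * (u * cnj u) - of_int (\<beta>' * \<beta>) * (v * cnj u + u * cnj v) + of_int (\<beta>' * \<gamma>) * (v * cnj v)"
      by (simp only: uu vv uBv)
    finally have NP: "of_real N \<in> P"
      unfolding P_def by (elim ssubst) (intro sgrp_add[OF sgrp_lprod] sgrp_diff[OF sgrp_lprod]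
        sgrp_of_int_mult[OF sgrp_lprod] lprod_memI imageI uL)
    have "of_real N * \<theta> \<in> P" unfolding cuv[symmetric] P_def
      by (subst mult.commute) (intro lprod_memI imageI uL)
    then show "smul (of_real N) (Ord n) \<subseteq> P"
      unfolding R[symmetric] smul_zspan using NP by (intro zspan_least sP) auto
  qed
  have N0c: "complex_of_real N \<noteq> 0" using N0 by simp
  have mult: "multipliers K L = Ord n"
  proof
    show "multipliers K L \<subseteq> Ord n"
    proof
      fix \<alpha> assume "\<alpha> \<in> multipliers K L"
      then have a: "\<And>x. x \<in> L \<Longrightarrow> \<alpha> * x \<in> L" by (auto simp: multipliers_def)
      \<comment> \<open>A multiplier of \<open>L\<close> also multiplies \<open>P\<close> into
        itself, and \<open>P\<close> is a scalar multiple of an order. Applied to the scalar, this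
        puts the multiplier into the order.\<close>
      have "P \<subseteq> {x. x * \<alpha> \<in> P}" unfolding P_def
      proof (intro lprod_least sgrp_mult_vimage sgrp_lprod CollectI)
        fix x y assume "x \<in> L" "y \<in> cnj ` L"
        then have "(\<alpha> * x) * y \<in> lprod L (cnj ` L)" by (intro lprod_memI a)
        then show "x * y * \<alpha> \<in> lprod L (cnj ` L)" by (simp add: mult_ac)
      qed
      moreover have "of_real N \<in> P" unfolding P_eq using smul_memI[OF Ord_1_mem] by fastforce
      ultimately have "of_real N * \<alpha> \<in> P" by auto
      then show "\<alpha> \<in> Ord n" using N0c by (simp add: P_eq in_smul_iff)
    qed
    show "Ord n \<subseteq> multipliers K L"
    proof
      fix \<alpha> assume a: "\<alpha> \<in> Ord n"
      have sL: "sgrp L" using assms by (rule klat_sgrp)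
      have "\<theta> * u \<in> L" unfolding uv by (rule zspan_memI'[of _ 0 _ A]) (simp add: \<theta>_def vt)
      moreover have "\<theta> * v \<in> L"
      proof -
        have "of_int A * t\<^sup>2 = - of_int B * t - of_int C" using ABC(3) by algebra
        moreover have "\<theta> * v = u * (of_int A * t\<^sup>2)" by (simp add: \<theta>_def vt power2_eq_square)
        moreover have "u * (- of_int B * t - of_int C) = of_int (- C) * u + of_int (- B) * v"
          by (simp add: vt algebra_simps)
        ultimately have "\<theta> * v = of_int (- C) * u + of_int (- B) * v" by simp
        then show ?thesis unfolding uv by (rule zspan_memI')
      qed
      ultimately have "L \<subseteq> {x. x * \<theta> \<in> L}"
        using zspan_least[OF sgrp_mult_vimage[OF sL], of u \<theta> v] by (simp add: uv(1) mult.commute)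
      then have tL: "\<theta> * x \<in> L" if "x \<in> L" for x using that by (auto simp: mult.commute)
      obtain k l where "\<alpha> = of_int k * 1 + of_int l * \<theta>" using a unfolding R[symmetric] zspan_def by auto
      then have "\<alpha> * x \<in> L" if "x \<in> L" for x
        using that tL sL by (simp add: algebra_simps) (metis sgrp_add sgrp_of_int_mult mult.left_commute mult.commute)
      then show "\<alpha> \<in> multipliers K L" using a Ord_subset_K by (auto simp: multipliers_def)
    qed
  qed
  have "cnj u * v - u * cnj v = of_real N * of_nat n * (w - cnj w)"
    unfolding cuv ucv ij by (simp add: n algebra_simps)
  \<comment> \<open>The middle coefficient changes sign when passing from the equation of
    \<open>t\<close> to the norm of \<open>x * u + y * v\<close>.\<close>
  moreover have "gcd A (gcd (- B) C) = 1" using ABC(2) by simp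
  moreover have "u * cnj v + v * cnj u = of_real N * of_int (- B)"
    by (simp only: ucv mult.commute[of v] cuv of_int_minus th[symmetric] distrib_left add.commute)
  ultimately show ?thesis
    by (rule that[OF uv(1-3) u0 N0 n(1) mult P_eq[unfolded P_def] _ _ uu vv])
qed

section \<open>Conductor, norm and inverse of a lattice\<close>

abbreviation "cond \<equiv> lattice_conductor K"

lemma cond_eqI: assumes "n > 0" "multipliers K L = Ord n" shows "cond L = n"
  unfolding lattice_conductor_def
  by (rule the_equality) (use assms in \<open>auto simp: order_cond_eq Ord_eq_iff\<close>)

lemma cond_pos: "klat L \<Longrightarrow> cond L > 0"
  by (erule lattice_structure) (simp add: cond_eqI)

lemma multipliers_eq: "klat L \<Longrightarrow> multipliers K L = Ord (cond L)"
  by (erule lattice_structure) (simp add: cond_eqI)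

lemma cond_structure:
  assumes "klat L"
  obtains u v and N :: real and A B C :: int
  where "L = zspan u v" "u \<in> K" "v \<in> K" "u \<noteq> 0" "N > 0"
    "lprod L (cnj ` L) = smul (of_real N) (Ord (cond L))"
    "cnj u * v - u * cnj v = of_real N * of_nat (cond L) * (w - cnj w)"
    "gcd A (gcd B C) = 1" "u * cnj u = of_real N * of_int A" "v * cnj v = of_real N * of_int C"
    "u * cnj v + v * cnj u = of_real N * of_int B"
proof (rule lattice_structure[OF assms])
  fix u v and N :: real and n :: nat and A B C :: int
  assume *: "L = zspan u v" "u \<in> K" "v \<in> K" "u \<noteq> 0" "N > 0" "n > 0" "multipliers K L = Ord n"
    "lprod L (cnj ` L) = smul (of_real N) (Ord n)"
    "cnj u * v - u * cnj v = of_real N * of_nat n * (w - cnj w)"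
    "gcd A (gcd B C) = 1" "u * cnj u = of_real N * of_int A" "v * cnj v = of_real N * of_int C"
    "u * cnj v + v * cnj u = of_real N * of_int B"
  have "cond L = n" using * by (intro cond_eqI)
  then show thesis using * by (intro that[of u v N A B C]) simp_all
qed

lemma mult_mem_lat: "klat L \<Longrightarrow> r \<in> Ord (cond L) \<Longrightarrow> x \<in> L \<Longrightarrow> r * x \<in> L"
  using multipliers_eq[of L] by (auto simp: multipliers_def)

lemma mult_mem_lat': "klat L \<Longrightarrow> cond L dvd n \<Longrightarrow> r \<in> Ord n \<Longrightarrow> x \<in> L \<Longrightarrow> r * x \<in> L"
  using mult_mem_lat Ord_mono by blast

lemma mem_OrdI: "klat L \<Longrightarrow> \<alpha> \<in> K \<Longrightarrow> (\<And>x. x \<in> L \<Longrightarrow> \<alpha> * x \<in> L) \<Longrightarrow> \<alpha> \<in> Ord (cond L)"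
  using multipliers_eq[of L] by (auto simp: multipliers_def)

lemma cond_dvdI:
  assumes "klat L" "\<And>r x. r \<in> Ord n \<Longrightarrow> x \<in> L \<Longrightarrow> r * x \<in> L" shows "cond L dvd n"
  using mem_OrdI[OF assms(1)] assms(2) Ord_subset_K Ord_subset_iff by (metis subset_iff)

lemma cond_Ord: "n > 0 \<Longrightarrow> cond (Ord n) = n"
proof (rule cond_eqI)
  show "multipliers K (Ord n) = Ord n"
  proof
    show "multipliers K (Ord n) \<subseteq> Ord n"
      using Ord_1_mem[of n] by (force simp: multipliers_def)
    show "Ord n \<subseteq> multipliers K (Ord n)"
      using Ord_mult Ord_subset_K by (fastforce simp: multipliers_def)
  qed
qed

lemma cond_smul: assumes "klat L" "c \<in> K" "c \<noteq> 0" shows "cond (smul c L) = cond L"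
proof (rule cond_eqI[OF cond_pos[OF assms(1)]])
  have "multipliers K (smul c L) = multipliers K L"
  proof -
    have "\<alpha> * (c * x) \<in> smul c L \<longleftrightarrow> \<alpha> * x \<in> L" for \<alpha> x
      using assms(3) by (simp add: in_smul_iff)
    then show ?thesis unfolding multipliers_def by (auto simp: smul_def)
  qed
  then show "multipliers K (smul c L) = Ord (cond L)" using multipliers_eq[OF assms(1)] by simp
qed

lemma cond_cnj: assumes "klat L" shows "cond (cnj ` L) = cond L"
proof (rule cond_eqI[OF cond_pos[OF assms(1)]])
  have "\<alpha> \<in> multipliers K (cnj ` L) \<longleftrightarrow> cnj \<alpha> \<in> multipliers K L" for \<alpha>
  proof -
    have "cnj \<alpha> \<in> K \<longleftrightarrow> \<alpha> \<in> K" using K_cnj by (metis complex_cnj_cnj)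
    moreover have "\<alpha> * cnj x \<in> cnj ` L \<longleftrightarrow> cnj \<alpha> * x \<in> L" for x
      by (metis (no_types, lifting) complex_cnj_cnj complex_cnj_mult image_iff)
    ultimately show ?thesis by (auto simp: multipliers_def)
  qed
  then show "multipliers K (cnj ` L) = Ord (cond L)"
    using multipliers_eq[OF assms(1)] by (metis Ord_cnj complex_cnj_cnj set_eqI)
qed

lemma lprod_Ord_absorb: "klat L \<Longrightarrow> cond L dvd n \<Longrightarrow> lprod (Ord n) L = L"
  by (rule lprod_absorb[OF klat_sgrp Ord_1_mem mult_mem_lat'])

text \<open>The norm of \<open>L\<close> as an ideal of its own multiplier ring, not of the maximal
  order.\<close>

definition nrm :: "complex set \<Rightarrow> real" where
  "nrm L = (THE N. N > 0 \<and> lprod L (cnj ` L) = smul (of_real N) (Ord (cond L)))"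

text \<open>Two such scalars have a positive ratio which, together with its inverse, lies in an
  order. Real elements of an order are integers, so the ratio is 1.\<close>

lemma nrm_eqI:
  assumes "N > 0" "lprod L (cnj ` L) = smul (of_real N) (Ord (cond L))" shows "nrm L = N"
  unfolding nrm_def
proof (rule the_equality)
  have int: "\<exists>k. x = of_int k" if "of_real x \<in> Ord (cond L)" for x
  proof -
    obtain i j where "complex_of_real x = of_int i + of_int j * w" using \<open>of_real x \<in> Ord (cond L)\<close> by (auto elim: Ord_memE)
    moreover from this have "Im (of_int i + of_int j * w) = 0" by (metis Im_complex_of_real)
    ultimately have "complex_of_real x = of_real (of_int i)" using Im_w by simp
    then show ?thesis by (metis of_real_eq_iff)
  qed
  show "N > 0 \<and> lprod L (cnj ` L) = smul (of_real N) (Ord (cond L))" using assms by simp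
  fix M :: real assume M: "M > 0 \<and> lprod L (cnj ` L) = smul (of_real M) (Ord (cond L))"
  have e: "smul (of_real N) (Ord (cond L)) = smul (of_real M) (Ord (cond L))" using M assms by simp
  have "of_real N \<in> smul (of_real M) (Ord (cond L))" unfolding e[symmetric] using smul_memI[OF Ord_1_mem] by fastforce
  then have "of_real (N / M) \<in> Ord (cond L)" using M by (simp add: in_smul_iff)
  then obtain k where k: "N / M = of_int k" using int by blast
  have "of_real M \<in> smul (of_real N) (Ord (cond L))" unfolding e using smul_memI[OF Ord_1_mem] by fastforce
  then have "of_real (M / N) \<in> Ord (cond L)" using assms(1) by (simp add: in_smul_iff)
  then obtain l where l: "M / N = of_int l" using int by blast
  have "of_int (k * l) = (N / M) * (M / N)" unfolding k l by simp
  also have "\<dots> = 1" using M assms by simp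
  finally have "k * l = 1" by linarith
  moreover have "of_int k > (0::real)" unfolding k[symmetric] using M assms by simp
  ultimately have "k = 1" by (auto simp: zmult_eq_1_iff)
  then show "M = N" using k M by simp
qed

lemma nrm_pos: "klat L \<Longrightarrow> nrm L > 0"
  by (erule cond_structure) (simp add: nrm_eqI)

lemma lprod_cnj: "klat L \<Longrightarrow> lprod L (cnj ` L) = smul (of_real (nrm L)) (Ord (cond L))"
  by (erule cond_structure) (simp add: nrm_eqI)

lemma nrm_structure:
  assumes "klat L"
  obtains u v and A B C :: int
  where "L = zspan u v" "u \<in> K" "v \<in> K" "u \<noteq> 0"
    "cnj u * v - u * cnj v = of_real (nrm L) * of_nat (cond L) * (w - cnj w)"
    "gcd A (gcd B C) = 1" "u * cnj u = of_real (nrm L) * of_int A" "v * cnj v = of_real (nrm L) * of_int C"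
    "u * cnj v + v * cnj u = of_real (nrm L) * of_int B"
proof (rule cond_structure[OF assms])
  fix u v and N :: real and A B C :: int
  assume *: "L = zspan u v" "u \<in> K" "v \<in> K" "u \<noteq> 0" "N > 0"
    "lprod L (cnj ` L) = smul (of_real N) (Ord (cond L))"
    "cnj u * v - u * cnj v = of_real N * of_nat (cond L) * (w - cnj w)"
    "gcd A (gcd B C) = 1" "u * cnj u = of_real N * of_int A" "v * cnj v = of_real N * of_int C"
    "u * cnj v + v * cnj u = of_real N * of_int B"
  have "nrm L = N" using * by (intro nrm_eqI)
  then show thesis using * by (intro that[of u v A B C]) simp_all
qed

lemma nrm_K: assumes "klat L" shows "of_real (nrm L) \<in> K"
proof -
  have "of_real (nrm L) \<in> lprod L (cnj ` L)"
    unfolding lprod_cnj[OF assms] using smul_memI[OF Ord_1_mem] by fastforce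
  then show ?thesis using klat_K[OF klat_lprod[OF assms klat_cnj[OF assms]]] by blast
qed

lemma cnj_image_smul: "cnj ` smul c L = smul (cnj c) (cnj ` L)"
  by (auto simp: smul_def image_image)

lemma nrm_smul: assumes "klat L" "c \<in> K" "c \<noteq> 0" shows "nrm (smul c L) = (cmod c)\<^sup>2 * nrm L"
proof (rule nrm_eqI)
  show "(cmod c)\<^sup>2 * nrm L > 0" using assms nrm_pos by simp
  show "lprod (smul c L) (cnj ` smul c L) = smul (of_real ((cmod c)\<^sup>2 * nrm L)) (Ord (cond (smul c L)))"
    unfolding cnj_image_smul lprod_smul_left lprod_smul_right lprod_cnj[OF assms(1)] cond_smul[OF assms]
    by (simp add: complex_norm_square mult_ac del: of_real_power)
qed

text \<open>The inverse of \<open>L\<close> as an invertible ideal of its multiplier ring; see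
  \<open>lprod_linv\<close>.\<close>

definition linv :: "complex set \<Rightarrow> complex set" where
  "linv L = smul (1 / of_real (nrm L)) (cnj ` L)"

lemma klat_linv: "klat L \<Longrightarrow> klat (linv L)"
  using nrm_pos[of L] by (auto simp: linv_def intro!: klat_smul klat_cnj K_closed nrm_K)

lemma cond_linv: "klat L \<Longrightarrow> cond (linv L) = cond L"
  using nrm_pos[of L] by (auto simp: linv_def cond_smul klat_cnj cond_cnj K_divide K_1 nrm_K)

lemma lprod_linv: "klat L \<Longrightarrow> lprod L (linv L) = Ord (cond L)"
  using nrm_pos[of L] by (simp add: linv_def lprod_smul_right lprod_cnj)

lemma lprod_linv': "klat L \<Longrightarrow> lprod (linv L) L = Ord (cond L)"
  by (metis lprod_linv lprod_commute)

text \<open>The product of the two orders is the order of conductor \<open>?g\<close> and acts on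
  the product lattice. Conversely, multiplication by both inverses turns the product lattice into
  this order, so every multiplier already lies in it.\<close>

lemma cond_lprod: assumes "klat A" "klat B" shows "cond (lprod A B) = gcd (cond A) (cond B)"
proof (rule dvd_antisym)
  let ?P = "lprod A B" and ?g = "gcd (cond A) (cond B)"
  have P: "klat ?P" using assms by (rule klat_lprod)
  have "lprod (lprod (Ord (cond A)) (Ord (cond B))) (lprod A B)
      = lprod (lprod (Ord (cond A)) A) (lprod (Ord (cond B)) B)" by (simp only: lprod_ac)
  then have AB: "lprod (Ord ?g) ?P = ?P"
    by (simp add: lprod_Ord lprod_Ord_absorb assms)
  show "cond ?P dvd ?g"
    by (rule cond_dvdI[OF P], subst AB[symmetric]) (rule lprod_memI)
  have "lprod ?P (lprod (linv A) (linv B)) = lprod (lprod A (linv A)) (lprod B (linv B))"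
    by (simp only: lprod_ac)
  also have "\<dots> = Ord ?g" by (simp add: lprod_linv assms lprod_Ord)
  finally have I: "lprod ?P (lprod (linv A) (linv B)) = Ord ?g" .
  have "lprod (Ord (cond ?P)) (Ord ?g) = Ord ?g"
    using arg_cong[OF lprod_Ord_absorb[OF P dvd_refl], of "\<lambda>X. lprod X (lprod (linv A) (linv B))"]
    by (simp only: lprod_assoc[of "Ord (cond ?P)"] I)
  then have "Ord (gcd (cond ?P) ?g) = Ord ?g" by (simp add: lprod_Ord)
  then have "gcd (cond ?P) ?g = ?g" by (simp add: Ord_eq_iff)
  then show "?g dvd cond ?P" by (metis gcd_dvd1)
qed

text \<open>For a prime of \<open>m\<close> exactly one of the three terms survives:
  \<open>x\<close> collects the primes dividing \<open>A\<close> but not \<open>C\<close>, which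
  leaves the term of \<open>C\<close>, and \<open>y\<close> those not dividing \<open>A\<close>,
  which leaves the term of \<open>A\<close>. At primes dividing both, \<open>B\<close> and hence the
  mixed term is prime to them.\<close>

lemma represents_coprime:
  fixes A B C :: int and m :: nat
  assumes "gcd A (gcd B C) = 1" "m > 0"
  shows "\<exists>x y. coprime (A * x\<^sup>2 + B * x * y + C * y\<^sup>2) (int m)"
proof -
  define S1 where "S1 = {p \<in> prime_factors (int m). \<not> p dvd A}"
  define S2 where "S2 = {p \<in> prime_factors (int m). p dvd A \<and> \<not> p dvd C}"
  define x where "x = \<Prod>S2"
  define y where "y = \<Prod>S1"
  have dx: "p dvd x \<longleftrightarrow> p \<in> S2" if "prime p" for p
  proof -
    have "p dvd x \<longleftrightarrow> (\<exists>q\<in>S2. p dvd q)"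
      unfolding x_def by (rule prime_dvd_prod_iff) (use that in \<open>auto simp: S2_def\<close>)
    also have "\<dots> \<longleftrightarrow> p \<in> S2" using that by (auto simp: S2_def dest: primes_dvd_imp_eq[OF that in_prime_factors_imp_prime])
    finally show ?thesis .
  qed
  have dy: "p dvd y \<longleftrightarrow> p \<in> S1" if "prime p" for p
  proof -
    have "p dvd y \<longleftrightarrow> (\<exists>q\<in>S1. p dvd q)"
      unfolding y_def by (rule prime_dvd_prod_iff) (use that in \<open>auto simp: S1_def\<close>)
    also have "\<dots> \<longleftrightarrow> p \<in> S1" using that by (auto simp: S1_def dest: primes_dvd_imp_eq[OF that in_prime_factors_imp_prime])
    finally show ?thesis .
  qed
  have nd: "\<not> p dvd A * x\<^sup>2 + B * x * y + C * y\<^sup>2" if p: "prime p" "p dvd int m" for p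
  proof -
    have pm: "p \<in> prime_factors (int m)" using p assms(2) by (simp add: prime_factors_dvd)
    show ?thesis
    proof (cases "p dvd A")
      case False
      then have "p \<in> S1" "p \<notin> S2" using pm by (auto simp: S1_def S2_def)
      then have "p dvd y" "\<not> p dvd x" using dx dy p by auto
      then have "\<not> p dvd A * x\<^sup>2" using False p by (simp add: prime_dvd_mult_iff prime_dvd_power_iff)
      moreover have "p dvd B * x * y + C * y\<^sup>2" using \<open>p dvd y\<close> by (simp add: power2_eq_square)
      ultimately show ?thesis by (metis add.assoc dvd_add_left_iff)
    next
      case pA: True
      show ?thesis
      proof (cases "p dvd C")
        case False
        then have "p \<in> S2" "p \<notin> S1" using pm pA by (auto simp: S1_def S2_def)
        then have "p dvd x" "\<not> p dvd y" using dx dy p by auto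
        then have "\<not> p dvd C * y\<^sup>2" using False p by (simp add: prime_dvd_mult_iff prime_dvd_power_iff)
        moreover have "p dvd A * x\<^sup>2 + B * x * y" using \<open>p dvd x\<close> by (simp add: power2_eq_square)
        ultimately show ?thesis by (metis dvd_add_right_iff)
      next
        case True
        then have "\<not> p dvd B" using pA assms(1) p by (metis not_prime_unit gcd_greatest)
        moreover have "\<not> p dvd x" "\<not> p dvd y" using pA True dx dy p by (auto simp: S1_def S2_def)
        ultimately have "\<not> p dvd B * x * y" using p by (simp add: prime_dvd_mult_iff)
        moreover have "p dvd A * x\<^sup>2" "p dvd C * y\<^sup>2" using pA True by auto
        ultimately show ?thesis by (metis dvd_add_left_iff dvd_add_right_iff)
      qed
    qed
  qed
  have "coprime (A * x\<^sup>2 + B * x * y + C * y\<^sup>2) (int m)"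
  proof (rule ccontr)
    assume "\<not> coprime (A * x\<^sup>2 + B * x * y + C * y\<^sup>2) (int m)"
    then have "\<not> is_unit (gcd (A * x\<^sup>2 + B * x * y + C * y\<^sup>2) (int m))" by (simp add: coprime_iff_gcd_eq_1)
    moreover have "gcd (A * x\<^sup>2 + B * x * y + C * y\<^sup>2) (int m) \<noteq> 0" using assms(2) by simp
    ultimately obtain p where "prime p" "p dvd gcd (A * x\<^sup>2 + B * x * y + C * y\<^sup>2) (int m)"
      using prime_divisor_exists by blast
    then show False using nd[of p] by simp
  qed
  then show ?thesis by blast
qed

text \<open>The lattice \<open>L / \<alpha>\<close> lies between \<open>Ord (cond L)\<close> and \<open>(1/k) Ord (cond L)\<close>: away from the primes
  dividing \<open>k\<close> it is the order itself. This replaces localisation throughout.\<close>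
lemma coprime_generator:
  assumes "klat L" "m > 0"
  obtains \<alpha> and k :: nat where "\<alpha> \<in> L" "\<alpha> \<noteq> 0" "k > 0" "coprime k m"
    "Ord (cond L) \<subseteq> smul (1 / \<alpha>) L" "\<And>x. x \<in> smul (1 / \<alpha>) L \<Longrightarrow> of_nat k * x \<in> Ord (cond L)"
proof -
  obtain u v A B C where uv: "L = zspan u v" "u \<in> K" "v \<in> K" "u \<noteq> 0"
    and eps: "cnj u * v - u * cnj v = of_real (nrm L) * of_nat (cond L) * (w - cnj w)"
    and *: "gcd A (gcd B C) = 1" "u * cnj u = of_real (nrm L) * of_int A" "v * cnj v = of_real (nrm L) * of_int C"
    "u * cnj v + v * cnj u = of_real (nrm L) * of_int B"
    by (rule nrm_structure[OF assms(1)])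
  obtain x y where xy: "coprime (A * x\<^sup>2 + B * x * y + C * y\<^sup>2) (int m)"
    using represents_coprime[OF *(1) assms(2)] by blast
  have uL: "u \<in> L" "v \<in> L" using zspan_basis uv by auto
  have "w \<noteq> cnj w" using Im_w by (auto simp: complex_eq_iff)
  then have nz: "cnj u * v - u * cnj v \<noteq> 0"
    unfolding eps using nrm_pos[OF assms(1)] cond_pos[OF assms(1)] by simp
  have "\<exists>\<alpha> q. \<alpha> \<in> L \<and> \<alpha> \<noteq> 0 \<and> \<alpha> * cnj \<alpha> = of_real (nrm L) * of_int q \<and> coprime q (int m)"
  proof (cases "of_int x * u + of_int y * v = 0")
    case False
    have "(of_int x * u + of_int y * v) * cnj (of_int x * u + of_int y * v)
      = of_int (x\<^sup>2) * (u * cnj u) + of_int (x * y) * (u * cnj v + v * cnj u) + of_int (y\<^sup>2) * (v * cnj v)"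
      by (simp add: power2_eq_square algebra_simps)
    also have "\<dots> = of_real (nrm L) * of_int (A * x\<^sup>2 + B * x * y + C * y\<^sup>2)"
      unfolding * by (simp add: algebra_simps)
    finally show ?thesis using False xy uv(1) zspan_memI by blast
  next
    case True
    \<comment> \<open>If the represented vector vanishes, so does the value of the form; being prime
      to \<open>m\<close>, it forces \<open>m = 1\<close>, and \<open>u\<close> itself will
      do.\<close>
    have "x = 0 \<and> y = 0"
    proof -
      have e: "of_int x * (cnj u * u) + of_int y * (cnj u * v) = 0"
        using arg_cong[OF True, of "\<lambda>z. cnj u * z"] by (simp add: algebra_simps)
      have "Im (cnj u * v) \<noteq> 0"
      proof
        assume "Im (cnj u * v) = 0"
        then have "cnj (cnj u * v) = cnj u * v" by (simp add: complex_eq_iff)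
        then have "cnj u * v - u * cnj v = 0" by simp
        then show False using nz by simp
      qed
      moreover have "of_int y * Im (cnj u * v) = 0"
        using arg_cong[OF e, of Im] by (simp add: algebra_simps)
      ultimately have "y = 0" by simp
      then show ?thesis using e uv(4) by simp
    qed
    then have "int m = 1" using xy by simp
    then show ?thesis using *(2) uv(4) uL by (intro exI[of _ u] exI[of _ A]) simp
  qed
  then obtain \<alpha> q where q: "\<alpha> \<in> L" "\<alpha> \<noteq> 0" "\<alpha> * cnj \<alpha> = of_real (nrm L) * of_int q" "coprime q (int m)"
    by blast
  have N: "nrm L > 0" using assms(1) by (rule nrm_pos)
  have "complex_of_real ((cmod \<alpha>)\<^sup>2) = of_real (nrm L * of_int q)" using q(3) by (simp add: complex_norm_square del: of_real_power)
  then have "(cmod \<alpha>)\<^sup>2 = nrm L * of_int q" by (simp only: of_real_eq_iff)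
  then have "nrm L * of_int q > 0" using q(2) by (metis zero_less_norm_iff zero_less_power)
  then have q0: "q > 0" using N by (simp add: zero_less_mult_iff)
  show ?thesis
  proof (rule that[of \<alpha> "nat q"])
    show "nat q > 0" "coprime (nat q) m" using q0 q(4) by (simp_all flip: coprime_int_iff)
    show "Ord (cond L) \<subseteq> smul (1 / \<alpha>) L"
      using mult_mem_lat[OF assms(1) _ q(1)] q(2) by (auto simp: in_smul_iff)
    fix x assume "x \<in> smul (1 / \<alpha>) L"
    then have xL: "\<alpha> * x \<in> L" using q(2) by (auto simp: in_smul_iff mult.commute)
    \<comment> \<open>\<open>cnj \<alpha> / nrm L\<close> belongs to the inverse lattice, so it
      carries \<open>\<alpha> * x\<close> into the order, and the result is \<open>q * x\<close>.
      This is the origin of \<open>k\<close>.\<close>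
    have "(\<alpha> * x) * cnj \<alpha> \<in> lprod L (cnj ` L)" using xL q(1) by (intro lprod_memI) auto
    then have "(\<alpha> * x) * cnj \<alpha> / of_real (nrm L) \<in> Ord (cond L)"
      using N by (simp add: lprod_cnj assms(1) in_smul_iff)
    also have "(\<alpha> * x) * cnj \<alpha> / of_real (nrm L) = (\<alpha> * cnj \<alpha>) * x / of_real (nrm L)" by simp
    also have "\<dots> = of_nat (nat q) * x" unfolding q(3) using N q0 by simp
    finally show "of_nat (nat q) * x \<in> Ord (cond L)" .
  qed (use q in auto)
qed

end

section \<open>Cyclic extensions of subgroups\<close>

lemma coprime_bezout:
  assumes "coprime k l" obtains a c :: int where "a * int k + c * int l = 1"
  using assms bezout_int[of "int k" "int l"] that by (metis coprime_iff_gcd_eq_1 gcd_int_int_eq of_nat_1)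

text \<open>A Bezout combination of the two multiples is \<open>z\<close>. Together with
  \<open>coprime_generator\<close> it plays the part of checking a membership prime by
  prime.\<close>

lemma sgrp_coprime_combine:
  fixes z :: "'a::comm_ring_1"
  assumes "sgrp H" "coprime k l" "of_nat k * z \<in> H" "of_nat l * z \<in> H" shows "z \<in> H"
proof -
  obtain a c where ac: "a * int k + c * int l = 1" using coprime_bezout[OF assms(2)] .
  have "z = of_int (a * int k + c * int l) * z" unfolding ac by simp
  also have "\<dots> = of_int a * (of_nat k * z) + of_int c * (of_nat l * z)" by (simp add: algebra_simps)
  finally show ?thesis using assms by (metis sgrp_add sgrp_of_int_mult)
qed

text \<open>The encoding of cyclic quotients is that of \<open>r_K\<close>: \<open>adj H z\<close> is \<open>H + \<int> z\<close>, and \<open>rel_order H z n\<close> says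
  that \<open>z\<close> has order \<open>n\<close> modulo \<open>H\<close> (infinite order for \<open>n = 0\<close>).\<close>
definition adj :: "complex set \<Rightarrow> complex \<Rightarrow> complex set" where
  "adj H z = {x + of_int k * z | x k. x \<in> H}"

definition rel_order :: "complex set \<Rightarrow> complex \<Rightarrow> nat \<Rightarrow> bool" where
  "rel_order H z n \<longleftrightarrow> (\<forall>k::nat. of_nat k * z \<in> H \<longleftrightarrow> n dvd k)"

lemma adj_memI: "y = x + of_int k * z \<Longrightarrow> x \<in> H \<Longrightarrow> y \<in> adj H z"
  unfolding adj_def by blast

lemma adj_memE: assumes "y \<in> adj H z" obtains x k where "y = x + of_int k * z" "x \<in> H"
  using assms unfolding adj_def by blast

lemma adj_subset: "H \<subseteq> adj H z"
  by (auto intro: adj_memI[of _ _ 0])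

lemma adj_self: "sgrp H \<Longrightarrow> z \<in> adj H z"
  by (rule adj_memI[of _ 0 1]) (auto simp: sgrp_0)

lemma sgrp_adj: assumes "sgrp H" shows "sgrp (adj H z)"
  unfolding sgrp_def
proof (intro conjI ballI)
  show "0 \<in> adj H z" using adj_subset sgrp_0[OF assms] by blast
  fix x y assume "x \<in> adj H z" "y \<in> adj H z"
  then obtain a k b l where "x = a + of_int k * z" "a \<in> H" "y = b + of_int l * z" "b \<in> H"
    by (auto elim!: adj_memE)
  then show "x - y \<in> adj H z"
    by (intro adj_memI[of _ "a - b" "k - l"]) (auto simp: algebra_simps intro: sgrp_diff[OF assms])
qed

lemma adj_least: "sgrp G \<Longrightarrow> H \<subseteq> G \<Longrightarrow> z \<in> G \<Longrightarrow> adj H z \<subseteq> G"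
  by (auto elim!: adj_memE intro!: sgrp_add sgrp_of_int_mult)

lemma adj_eq_iff_mem: "sgrp H \<Longrightarrow> z \<in> H \<Longrightarrow> adj H z = H"
  by (intro equalityI adj_least adj_subset) auto

lemma smul_adj: "smul c (adj H z) = adj (smul c H) (c * z)"
proof (intro equalityI subsetI)
  fix y assume "y \<in> smul c (adj H z)"
  then obtain x k where "x \<in> H" "y = c * (x + of_int k * z)" by (auto simp: smul_def elim!: adj_memE)
  then show "y \<in> adj (smul c H) (c * z)"
    by (intro adj_memI[of _ "c * x" k]) (auto simp: algebra_simps smul_memI)
next
  fix y assume "y \<in> adj (smul c H) (c * z)"
  then obtain x k where "x \<in> H" "y = c * x + of_int k * (c * z)" by (auto simp: smul_def elim!: adj_memE)
  then have "x + of_int k * z \<in> adj H z" "y = c * (x + of_int k * z)"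
    by (auto intro: adj_memI simp: algebra_simps)
  then show "y \<in> smul c (adj H z)" using smul_memI by metis
qed

lemma rel_order_int:
  assumes "sgrp H" "rel_order H z n" shows "of_int k * z \<in> H \<longleftrightarrow> int n dvd k"
proof (cases "k \<ge> 0")
  case True
  then obtain m where "k = int m" by (metis nat_0_le)
  then show ?thesis using assms(2) by (simp add: rel_order_def)
next
  case False
  then obtain m where m: "k = - int m" by (metis add.inverse_inverse linear neg_0_le_iff_le nat_0_le)
  have "of_int k * z \<in> H \<longleftrightarrow> - (of_nat m * z) \<in> H" by (simp add: m)
  also have "\<dots> \<longleftrightarrow> of_nat m * z \<in> H" by (rule sgrp_uminus_iff[OF assms(1)])
  finally show ?thesis using assms(2) by (simp add: rel_order_def m)
qed

lemma rel_order_smul: "c \<noteq> 0 \<Longrightarrow> rel_order (smul c H) (c * z) n \<longleftrightarrow> rel_order H z n"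
  by (simp add: rel_order_def in_smul_iff)

lemma rel_order_1_iff: "sgrp H \<Longrightarrow> rel_order H z 1 \<longleftrightarrow> z \<in> H"
  unfolding rel_order_def by (metis mult_1 of_nat_1 one_dvd sgrp_of_nat_mult)

context imag_quad
begin

lemma klat_denom: assumes "klat H" "z \<in> K" obtains m :: nat where "m > 0" "of_nat m * z \<in> H"
proof -
  obtain m where m: "m > 0" "\<And>x. x \<in> Ord 1 \<Longrightarrow> of_nat m * x \<in> H" using assms(1) by (rule klatE) blast
  obtain k where k: "k > 0" "of_nat k * z \<in> Ord 1" using K_denom[OF assms(2)] .
  show ?thesis using that[of "m * k"] m k by (simp add: mult.assoc)
qed

lemma klat_adj: assumes "klat H" "z \<in> K" shows "klat (adj H z)"
proof -
  obtain m where m: "m > 0" "of_nat m * z \<in> H" using klat_denom[OF assms] .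
  show ?thesis
  proof (rule klat_between[OF _ assms(1) _ adj_subset])
    show "sgrp (adj H z)" using assms klat_sgrp sgrp_adj by blast
    show "klat (smul (1 / of_nat m) H)" using m assms by (intro klat_smul K_closed) auto
    show "adj H z \<subseteq> smul (1 / of_nat m) H"
    proof (rule adj_least[OF sgrp_smul[OF klat_sgrp[OF assms(1)]]])
      show "H \<subseteq> smul (1 / of_nat m) H"
      proof
        fix x assume "x \<in> H"
        then have "of_nat m * x \<in> H" by (rule sgrp_of_nat_mult[OF klat_sgrp[OF assms(1)]])
        then show "x \<in> smul (1 / of_nat m) H" using m by (simp add: in_smul_iff mult.commute)
      qed
      show "z \<in> smul (1 / of_nat m) H" using m by (simp add: in_smul_iff mult.commute)
    qed
  qed
qed

lemma rel_order_exists: assumes "klat H" "z \<in> K" obtains n where "n > 0" "rel_order H z n"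
proof -
  have sH: "sgrp H" using assms(1) by (rule klat_sgrp)
  have "\<exists>d\<ge>0. {k. of_int k * z \<in> H} = {d * k | k. True}"
    by (rule int_sgrp_principal, rule sgrp_vimage[OF sH]) (simp add: algebra_simps)
  then obtain d where d: "d \<ge> 0" "{k. of_int k * z \<in> H} = {d * k | k. True}" by blast
  then have *: "of_int k * z \<in> H \<longleftrightarrow> d dvd k" for k by (auto simp: dvd_def)
  obtain m where m: "m > 0" "of_nat m * z \<in> H" using klat_denom[OF assms] .
  then have "d dvd int m" using *[of "int m"] by simp
  then have "d > 0" using m d(1) by (cases "d = 0") auto
  moreover have "rel_order H z (nat d)"
    unfolding rel_order_def
  proof
    fix k
    have "of_nat k * z \<in> H \<longleftrightarrow> d dvd int k" using *[of "int k"] by simp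
    also have "\<dots> \<longleftrightarrow> nat d dvd k" using d(1) by (simp add: nat_dvd_iff flip: int_dvd_int_iff)
    finally show "of_nat k * z \<in> H \<longleftrightarrow> nat d dvd k" .
  qed
  ultimately show ?thesis using that[of "nat d"] by simp
qed

section \<open>Changing, gluing and separating conductors\<close>

lemma of_nat_mult_Ord: assumes "x \<in> Ord g" shows "of_nat n * x \<in> Ord (n * g)"
proof -
  obtain i j where "x = of_int i + of_int j * w" "int g dvd j" using assms by (rule Ord_memE)
  then show ?thesis by (intro Ord_memI'[of _ "int n * i" "int n * j"]) (auto simp: algebra_simps)
qed

text \<open>Scaling makes \<open>P\<close> into a lattice \<open>B\<close> that agrees with its
  order away from the primes of \<open>k\<close>, where \<open>k\<close> is prime to
  \<open>l\<close>. Prime by prime, \<open>Q\<close> is then \<open>Ord l\<close> where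
  \<open>k\<close> is a unit and \<open>B\<close> where \<open>l\<close> is a unit, so it has
  conductor \<open>l\<close> and generates \<open>B\<close> over the larger order.\<close>

lemma lift_conductor:
  assumes "klat P" "cond P dvd l" "l > 0"
  obtains P' where "klat P'" "cond P' = l" "lprod P' (Ord (cond P)) = P"
proof -
  define g where "g = cond P"
  obtain \<alpha> k where \<alpha>: "\<alpha> \<in> P" "\<alpha> \<noteq> 0" and k: "k > 0" "coprime k l"
    and B1: "Ord (cond P) \<subseteq> smul (1 / \<alpha>) P" and B2: "\<And>x. x \<in> smul (1 / \<alpha>) P \<Longrightarrow> of_nat k * x \<in> Ord (cond P)"
    using coprime_generator[OF assms(1,3)] by metis
  have aK: "\<alpha> \<in> K" using \<alpha> klat_K assms by blast
  define B where "B = smul (1 / \<alpha>) P"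
  have B: "klat B" "cond B = g" unfolding B_def g_def using assms \<alpha> aK by (auto intro!: klat_smul cond_smul K_closed)
  have OB: "Ord g \<subseteq> B" using B1 by (simp add: B_def g_def)
  have BO: "of_nat k * x \<in> Ord g" if "x \<in> B" for x using B2 that by (simp add: B_def g_def)
  define Q where "Q = B \<inter> smul (1 / of_nat k) (Ord l)"
  have Q_iff: "x \<in> Q \<longleftrightarrow> x \<in> B \<and> of_nat k * x \<in> Ord l" for x
    unfolding Q_def using k by (simp add: in_smul_iff mult.commute)
  have Q: "klat Q" unfolding Q_def using B k assms by (intro klat_Int klat_smul klat_Ord K_closed) auto
  have gl: "g dvd l" using assms by (simp add: g_def)
  have Q1: "1 \<in> Q" using OB Ord_1_mem Ord_of_int[of "int k"] by (auto simp: Q_iff)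
  have cond: "cond Q = l"
  proof (rule dvd_antisym)
    show "cond Q dvd l"
    proof (rule cond_dvdI[OF Q])
      fix r x assume r: "r \<in> Ord l" and x: "x \<in> Q"
      then show "r * x \<in> Q" using Ord_mult[OF r, of "of_nat k * x"] mult_mem_lat'[OF B(1) _ r] gl B(2)
        by (auto simp: Q_iff mult.left_commute)
    qed
    \<comment> \<open>The lattice contains 1, so it contains \<open>cond Q * w\<close>; its multiple
      by \<open>k\<close> lies in \<open>Ord l\<close>, and \<open>k\<close> is prime to
      \<open>l\<close>.\<close>
    have "of_nat (cond Q) * w \<in> Ord (cond Q)" by (simp add: Ord_of_nat_w)
    then have "of_nat (cond Q) * w * 1 \<in> Q" using Q1 by (rule mult_mem_lat[OF Q])
    then have "of_nat (k * cond Q) * w \<in> Ord l" by (simp add: Q_iff mult.assoc)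
    then have "l dvd k * cond Q" by (simp only: Ord_of_nat_w)
    then show "l dvd cond Q" using k by (simp add: coprime_dvd_mult_right_iff coprime_commute)
  qed
  have "lprod Q (Ord g) = B"
  proof
    show "lprod Q (Ord g) \<subseteq> B"
    proof (rule lprod_least[OF klat_sgrp[OF B(1)]])
      fix x r assume "x \<in> Q" "r \<in> Ord g"
      then show "x * r \<in> B" using mult_mem_lat[OF B(1), of r x] B(2) by (simp add: Q_iff mult.commute)
    qed
    show "B \<subseteq> lprod Q (Ord g)"
    proof
      fix b assume b: "b \<in> B"
      have "1 * (of_nat k * b) \<in> lprod Q (Ord g)" using Q1 BO[OF b] by (rule lprod_memI)
      moreover have "of_nat l * b * 1 \<in> lprod Q (Ord g)"
      proof (intro lprod_memI Ord_1_mem)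
        have "of_nat l * (of_nat k * b) \<in> Ord (l * g)" using of_nat_mult_Ord[OF BO[OF b]] .
        then have "of_nat l * (of_nat k * b) \<in> Ord l" using Ord_mono[of l "l * g"] by auto
        then show "of_nat l * b \<in> Q"
          using sgrp_of_nat_mult[OF klat_sgrp[OF B(1)] b] by (simp add: Q_iff mult.left_commute)
      qed
      ultimately show "b \<in> lprod Q (Ord g)"
        using sgrp_coprime_combine[OF sgrp_lprod k(2)] by simp
    qed
  qed
  then have "lprod (smul \<alpha> Q) (Ord g) = P" using \<alpha> by (simp add: lprod_smul_left B_def)
  then show ?thesis using that[of "smul \<alpha> Q"] klat_smul[OF Q aK \<alpha>(2)] cond_smul[OF Q aK \<alpha>(2)] cond
    by (simp add: g_def)
qed

lemma lprod_Ord_cond_left: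
  assumes "klat B" shows "lprod B (Ord (gcd (cond B) a)) = lprod B (Ord a)"
proof -
  have "lprod B (Ord a) = lprod (lprod (Ord (cond B)) B) (Ord a)" by (simp add: lprod_Ord_absorb assms)
  also have "\<dots> = lprod B (lprod (Ord (cond B)) (Ord a))" by (simp only: lprod_ac)
  finally show ?thesis by (simp add: lprod_Ord)
qed

lemma subset_lprod_Ord: "A \<subseteq> lprod A (Ord n)"
  using lprod_memI[OF _ Ord_1_mem, of _ A n] by fastforce

text \<open>Let \<open>X\<close> be the common extension over the order of conductor
  \<open>g\<close>. The coprime cofactors satisfy that \<open>n1 * X\<close> lies in
  \<open>A\<close> and \<open>n2 * X\<close> in \<open>B\<close>. So at each prime one of
  \<open>A, B\<close> equals \<open>X\<close>, and the intersection is the other one.\<close>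

lemma Int_lprod_Ord:
  assumes "klat A" "klat B"
    and "lprod A (Ord (gcd (cond A) (cond B))) = lprod B (Ord (gcd (cond A) (cond B)))"
  shows "lprod (A \<inter> B) (Ord (cond A)) = A"
proof
  define a where "a = cond A"
  define b where "b = cond B"
  define g where "g = gcd a b"
  define X where "X = lprod A (Ord g)"
  have ab: "a > 0" "b > 0" using assms cond_pos by (auto simp: a_def b_def)
  have "gcd a b \<noteq> 0" using ab by simp
  then obtain n1 n2 where n': "a = n1 * gcd a b" "b = n2 * gcd a b" "coprime n1 n2"
    using gcd_coprime_exists by blast
  then have n: "a = g * n1" "b = g * n2" "coprime n2 n1" by (simp_all add: g_def mult.commute coprime_commute)
  have XB: "X = lprod B (Ord g)" unfolding X_def using assms by (simp add: g_def a_def b_def)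
  have XB': "X = lprod B (Ord a)"
    using lprod_Ord_cond_left[OF assms(2), of a] XB by (simp add: g_def b_def gcd.commute)
  have sA: "sgrp A" "sgrp B" using assms klat_sgrp by auto
  have n1X: "of_nat n1 * x \<in> A" if "x \<in> X" for x
  proof -
    have "X \<subseteq> {x. x * of_nat n1 \<in> A}" unfolding X_def
    proof (intro lprod_least sgrp_mult_vimage sA CollectI)
      fix y r assume "y \<in> A" "r \<in> Ord g"
      then have "(of_nat n1 * r) * y \<in> A" using of_nat_mult_Ord[of r g n1] n(1)
        by (intro mult_mem_lat[OF assms(1)]) (auto simp: a_def mult.commute)
      then show "y * r * of_nat n1 \<in> A" by (simp add: mult_ac)
    qed
    then show ?thesis using that by (auto simp: mult.commute)
  qed
  have n2X: "of_nat n2 * x \<in> B" if "x \<in> X" for x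
  proof -
    have "X \<subseteq> {x. x * of_nat n2 \<in> B}" unfolding XB
    proof (intro lprod_least sgrp_mult_vimage sA CollectI)
      fix y r assume "y \<in> B" "r \<in> Ord g"
      then have "(of_nat n2 * r) * y \<in> B" using of_nat_mult_Ord[of r g n2] n(2)
        by (intro mult_mem_lat[OF assms(2)]) (auto simp: b_def mult.commute)
      then show "y * r * of_nat n2 \<in> B" by (simp add: mult_ac)
    qed
    then show ?thesis using that by (auto simp: mult.commute)
  qed
  have AX: "A \<subseteq> X" "B \<subseteq> X" unfolding X_def by (rule subset_lprod_Ord) (unfold XB[unfolded X_def], rule subset_lprod_Ord)
  let ?P = "lprod (A \<inter> B) (Ord (cond A))"
  show "?P \<subseteq> A"
  proof (rule lprod_least[OF sA(1)])
    fix x r assume "x \<in> A \<inter> B" "r \<in> Ord (cond A)"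
    then show "x * r \<in> A" using mult_mem_lat[OF assms(1), of r x] by (simp add: mult.commute)
  qed
  show "A \<subseteq> ?P"
  proof
    fix x assume x: "x \<in> A"
    have "of_nat n2 * x \<in> A \<inter> B" using x AX n2X sgrp_of_nat_mult[OF sA(1)] by blast
    then have 2: "of_nat n2 * x \<in> ?P" using subset_lprod_Ord by blast
    have "X \<subseteq> {x. x * of_nat n1 \<in> ?P}" unfolding XB'
    proof (intro lprod_least sgrp_mult_vimage sgrp_lprod CollectI)
      fix y r assume y: "y \<in> B" and r: "r \<in> Ord a"
      have "of_nat n1 * y \<in> A \<inter> B" using y AX n1X sgrp_of_nat_mult[OF sA(2)] by blast
      then have "(of_nat n1 * y) * r \<in> ?P" using r by (intro lprod_memI) (auto simp: a_def)
      then show "y * r * of_nat n1 \<in> ?P" by (simp add: mult_ac)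
    qed
    then have "of_nat n1 * x \<in> ?P" using x AX by (auto simp: mult.commute)
    then show "x \<in> ?P" using sgrp_coprime_combine[OF sgrp_lprod n(3) 2] by blast
  qed
qed

text \<open>Extending the intersection to the order of \<open>A\<close> gives back \<open>A\<close>,
  and \<open>cond_lprod\<close> then shows that \<open>cond A\<close> divides the conductor of the
  intersection; likewise for \<open>B\<close>.\<close>

lemma cond_Int:
  assumes "klat A" "klat B"
    and "lprod A (Ord (gcd (cond A) (cond B))) = lprod B (Ord (gcd (cond A) (cond B)))"
  shows "cond (A \<inter> B) = lcm (cond A) (cond B)"
proof (rule dvd_antisym)
  have I: "klat (A \<inter> B)" using assms klat_Int by blast
  show "cond (A \<inter> B) dvd lcm (cond A) (cond B)"
    by (rule cond_dvdI[OF I]) (use assms(1,2) in \<open>auto intro: mult_mem_lat'\<close>)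
  have "gcd (cond (A \<inter> B)) (cond A) = cond (lprod (A \<inter> B) (Ord (cond A)))"
    using I assms by (simp add: cond_lprod klat_Ord cond_pos cond_Ord)
  also have "\<dots> = cond A" by (simp add: Int_lprod_Ord assms)
  finally have 1: "cond A dvd cond (A \<inter> B)" by (metis gcd_dvd1)
  have "gcd (cond (A \<inter> B)) (cond B) = cond (lprod (B \<inter> A) (Ord (cond B)))"
    using I assms by (simp add: cond_lprod klat_Ord cond_pos cond_Ord Int_commute)
  also have "\<dots> = cond B" by (subst Int_lprod_Ord) (simp_all add: assms gcd.commute)
  finally have 2: "cond B dvd cond (A \<inter> B)" by (metis gcd_dvd1)
  show "lcm (cond A) (cond B) dvd cond (A \<inter> B)" using 1 2 by simp
qed

text \<open>As 1 lies in the product of \<open>linv L\<close> and \<open>L\<close>, an element is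
  recovered from its products with \<open>linv L\<close>.\<close>

lemma mem_lat_if_linv:
  assumes "klat L" "\<And>y. y \<in> linv L \<Longrightarrow> z * y \<in> Ord (cond L)" shows "z \<in> L"
proof -
  have "lprod (linv L) L \<subseteq> {x. x * z \<in> L}"
  proof (intro lprod_least sgrp_mult_vimage klat_sgrp assms(1) CollectI)
    fix y l assume "y \<in> linv L" "l \<in> L"
    then have "(z * y) * l \<in> L" using mult_mem_lat[OF assms(1) assms(2)] by blast
    then show "y * l * z \<in> L" by (simp add: mult_ac)
  qed
  moreover have "1 \<in> lprod (linv L) L" by (simp add: lprod_linv' assms(1) Ord_1_mem)
  ultimately show ?thesis by auto
qed

text \<open>Tested against \<open>linv L\<close>, an element of both extensions gives values in
  \<open>Ord a\<close> and in \<open>Ord b\<close>, hence in the order of \<open>L\<close>. This is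
  the uniqueness part of the gluing in \<open>Int_lprod_Ord\<close>.\<close>

lemma lprod_Ord_Int:
  assumes "klat L" "cond L = lcm a b"
  shows "lprod L (Ord a) \<inter> lprod L (Ord b) = L"
proof
  show "L \<subseteq> lprod L (Ord a) \<inter> lprod L (Ord b)" using subset_lprod_Ord by blast
  have *: "z * y \<in> Ord c" if z: "z \<in> lprod L (Ord c)" and y: "y \<in> linv L" and c: "c dvd lcm a b" for z y c
  proof -
    have "lprod L (Ord c) \<subseteq> {x. x * y \<in> Ord c}"
    proof (intro lprod_least sgrp_mult_vimage sgrp_Ord CollectI)
      fix l r assume l: "l \<in> L" and r: "r \<in> Ord c"
      have "l * y \<in> Ord (cond L)" unfolding lprod_linv[OF assms(1), symmetric] using l y by (rule lprod_memI)
      then have "l * y \<in> Ord c" using Ord_mono[OF c] assms(2) by auto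
      then show "l * r * y \<in> Ord c" using Ord_mult[OF _ r, of "l * y"] by (simp add: mult_ac)
    qed
    then show ?thesis using z by blast
  qed
  show "lprod L (Ord a) \<inter> lprod L (Ord b) \<subseteq> L"
    using *[of _ a] *[of _ b] by (auto intro!: mem_lat_if_linv[OF assms(1)] simp: assms(2) Ord_Int[symmetric])
qed

text \<open>Comparing norms shows that \<open>c\<close> is an integral element of absolute value 1.
  Its trace \<open>T\<close> is an integer between -2 and 2 with \<open>c * c = T * c - 1\<close>,
  and in each of the five cases \<open>c\<close> is a root of unity.\<close>

lemma homothety_unit:
  assumes "klat L" "smul c L = L" "only_roots_of_unity_pm1 K" shows "c = 1 \<or> c = -1"
proof -
  obtain x where x: "x \<in> L" "x \<noteq> 0" using klat_nonzero[OF assms(1)] .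
  have cL: "c * y \<in> L" if "y \<in> L" for y using assms(2) smul_memI[OF that, of c] by simp
  have "c * x / x \<in> K" using cL[OF x(1)] x klat_K[OF assms(1)] by (intro K_divide) auto
  then have cK: "c \<in> K" using x by simp
  have c0: "c \<noteq> 0"
  proof
    assume "c = 0"
    then have "L \<subseteq> {0}" using assms(2) by (auto simp: smul_def)
    then show False using x by auto
  qed
  have "c \<in> Ord (cond L)" using mem_OrdI[OF assms(1) cK] cL by blast
  then obtain i j where ij: "c = of_int i + of_int j * w" by (rule Ord_memE)
  have "(cmod c)\<^sup>2 * nrm L = nrm L" using nrm_smul[OF assms(1) cK c0] assms(2) by simp
  then have n1: "(cmod c)\<^sup>2 = 1" using nrm_pos[OF assms(1)] by simp
  then have cc: "c * cnj c = 1" by (metis complex_norm_square of_real_1)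
  define T where "T = 2 * i + j * tw"
  have T: "c + cnj c = of_int T" unfolding ij cnj_rep T_def by (simp add: algebra_simps)
  have "\<bar>Re c\<bar> \<le> 1" using abs_Re_le_cmod[of c] n1 by (simp add: power2_eq_1_iff) (metis abs_norm_cancel abs_minus_cancel abs_one order_refl)
  moreover have "2 * Re c = of_int T" using arg_cong[OF T, of Re] by simp
  ultimately have "\<bar>T\<bar> \<le> 2" by linarith
  then have "T = -2 \<or> T = -1 \<or> T = 0 \<or> T = 1 \<or> T = 2" by arith
  moreover have q: "c * c = of_int T * c - 1" using cc unfolding T[symmetric] by (simp add: algebra_simps)
  ultimately have "\<exists>n::nat. n > 0 \<and> c ^ n = 1 \<or> c = 1 \<or> c = -1"
  proof (elim disjE)
    assume t: "T = -2"
    have "(c + 1) * (c + 1) = 0" using q unfolding t by (simp, algebra)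
    then have "c = -1" by (simp add: eq_neg_iff_add_eq_0)
    then show ?thesis by simp
  next
    assume t: "T = 2"
    have "(c - 1) * (c - 1) = 0" using q unfolding t by (simp, algebra)
    then show ?thesis by simp
  next
    assume t: "T = -1"
    have "c ^ 3 = 1" using q unfolding t by (simp add: power3_eq_cube) algebra
    then show ?thesis by (intro exI[of _ 3]) simp
  next
    assume t: "T = 0"
    have "c ^ 4 = (c * c) * (c * c)" by (simp add: power4_eq_xxxx)
    also have "\<dots> = 1" using q t by simp
    finally show ?thesis by (intro exI[of _ 4]) simp
  next
    assume t: "T = 1"
    have "c ^ 3 = -1" using q unfolding t by (simp add: power3_eq_cube) algebra
    then have "(c ^ 3) ^ 2 = 1" by simp
    then have "c ^ 6 = 1" by (simp flip: power_mult)
    then show ?thesis by (intro exI[of _ 6]) simp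
  qed
  then show ?thesis using assms(3) cK unfolding only_roots_of_unity_pm1_def by blast
qed

end

section \<open>Lattices of rank two over the quadratic field\<close>

type_synonym mat2 = "complex \<times> complex \<times> complex \<times> complex"

fun mm :: "mat2 \<Rightarrow> mat2 \<Rightarrow> mat2" where
  "mm (a, b, c, d) (a', b', c', d') = (a * a' + b * c', a * b' + b * d', c * a' + d * c', c * b' + d * d')"

fun minv :: "mat2 \<Rightarrow> mat2" where
  "minv (a, b, c, d) = (let D = a * d - b * c in (d / D, - b / D, - c / D, a / D))"

lemma lin2_simp [simp]: "lin2 (a, b, c, d) (x, y) = (a * x + b * y, c * x + d * y)"
  by (simp add: lin2_def)

lemma det2_simp [simp]: "det2 (a, b, c, d) = a * d - b * c"
  by (simp add: det2_def)

lemma lin2_mm: "lin2 (mm g h) x = lin2 g (lin2 h x)"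
  by (cases g; cases h; cases x) (simp add: algebra_simps)

lemma det2_mm: "det2 (mm g h) = det2 g * det2 h"
  by (cases g; cases h) (simp add: algebra_simps)

lemma lin2_minv: assumes "det2 g \<noteq> 0" shows "lin2 (minv g) (lin2 g x) = x"
proof -
  obtain a b c d where g: "g = (a, b, c, d)" by (cases g)
  obtain s t where x: "x = (s, t)" by (cases x)
  have D: "a * d - b * c \<noteq> 0" using assms by (simp add: g)
  have "d * (a * s + b * t) - b * (c * s + d * t) = (a * d - b * c) * s"
    "a * (c * s + d * t) - c * (a * s + b * t) = (a * d - b * c) * t" by (simp_all add: algebra_simps)
  then show ?thesis using D unfolding g x
    by (simp add: Let_def minus_divide_left[symmetric] times_divide_eq_left flip: diff_divide_distrib add_divide_distrib)
qed

lemma lin2_minv': assumes "det2 g \<noteq> 0" shows "lin2 g (lin2 (minv g) x) = x"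
proof -
  obtain a b c d where g: "g = (a, b, c, d)" by (cases g)
  obtain s t where x: "x = (s, t)" by (cases x)
  have D: "a * d - b * c \<noteq> 0" using assms by (simp add: g)
  then show ?thesis unfolding g x by (simp add: Let_def divide_simps) (simp add: algebra_simps)
qed

lemma det2_minv: assumes "det2 g \<noteq> 0" shows "det2 (minv g) \<noteq> 0"
proof -
  obtain a b c d where g: "g = (a, b, c, d)" by (cases g)
  have D: "a * d - b * c \<noteq> 0" using assms by (simp add: g)
  then have "det2 (minv g) = 1 / (a * d - b * c)" unfolding g by (simp add: Let_def divide_simps) 
  then show ?thesis using D by simp
qed

lemma lin2_image_mm: "lin2 (mm g h) ` X = lin2 g ` lin2 h ` X"
  by (simp add: image_image lin2_mm)

lemma lin2_image_minv: "det2 g \<noteq> 0 \<Longrightarrow> lin2 (minv g) ` lin2 g ` X = X"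
  by (simp add: image_image lin2_minv)

lemma lin2_image_mem: "det2 g \<noteq> 0 \<Longrightarrow> x \<in> lin2 g ` X \<longleftrightarrow> lin2 (minv g) x \<in> X"
  by (metis (no_types, lifting) image_iff lin2_minv lin2_minv')

lemma lin2_diff: "lin2 g (x - y) = lin2 g x - lin2 g y"
  by (cases g; cases x; cases y) (simp add: algebra_simps)

lemma lin2_scale: "lin2 g (t * fst x, t * snd x) = (t * fst (lin2 g x), t * snd (lin2 g x))"
  by (cases g; cases x) (simp add: algebra_simps)

definition iso2 :: "(complex \<times> complex) set \<Rightarrow> (complex \<times> complex) set \<Rightarrow> bool" where
  "iso2 X Y \<longleftrightarrow> (\<exists>g. det2 g \<noteq> 0 \<and> lin2 g ` X = Y)"

lemma iso2_I: "det2 g \<noteq> 0 \<Longrightarrow> lin2 g ` X = Y \<Longrightarrow> iso2 X Y" unfolding iso2_def by blast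

lemma iso2_sym: "iso2 X Y \<Longrightarrow> iso2 Y X"
  unfolding iso2_def using det2_minv lin2_image_minv by metis

lemma iso2_trans: "iso2 X Y \<Longrightarrow> iso2 Y Z \<Longrightarrow> iso2 X Z"
  unfolding iso2_def using det2_mm lin2_image_mm by (metis mult_eq_0_iff)

text \<open>The image of the second exterior power of \<open>M\<close>. A linear map scales it by
  its determinant, so its homothety class is the Steinitz class of \<open>M\<close>.\<close>

definition ddet :: "(complex \<times> complex) set \<Rightarrow> complex set" where
  "ddet M = ghull {fst x * snd y - snd x * fst y | x y. x \<in> M \<and> y \<in> M}"

lemma sgrp_ddet: "sgrp (ddet M)" by (simp add: ddet_def sgrp_ghull)

lemma ddet_memI: "(a, b) \<in> M \<Longrightarrow> (c, d) \<in> M \<Longrightarrow> a * d - b * c \<in> ddet M"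
  unfolding ddet_def by (rule ghull_inc) force

lemma ddet_least:
  "sgrp H \<Longrightarrow> (\<And>a b c d. (a, b) \<in> M \<Longrightarrow> (c, d) \<in> M \<Longrightarrow> a * d - b * c \<in> H) \<Longrightarrow> ddet M \<subseteq> H"
  unfolding ddet_def by (rule ghull_least) auto

lemma ddet_lin2_le: "ddet (lin2 g ` M) \<subseteq> smul (det2 g) (ddet M)"
proof (rule ddet_least[OF sgrp_smul[OF sgrp_ddet]])
  fix a b c d assume "(a, b) \<in> lin2 g ` M" "(c, d) \<in> lin2 g ` M"
  then obtain x y x' y' where xy: "(x, y) \<in> M" "(a, b) = lin2 g (x, y)" "(x', y') \<in> M" "(c, d) = lin2 g (x', y')"
    by auto
  obtain p q r s where g: "g = (p, q, r, s)" by (cases g)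
  have "a * d - b * c = det2 g * (x * y' - y * x')" using xy by (simp add: g algebra_simps)
  then show "a * d - b * c \<in> smul (det2 g) (ddet M)" using ddet_memI[OF xy(1,3)] smul_memI by metis
qed

lemma ddet_lin2: assumes "det2 g \<noteq> 0" shows "ddet (lin2 g ` M) = smul (det2 g) (ddet M)"
proof
  have "ddet M \<subseteq> smul (det2 (minv g)) (ddet (lin2 g ` M))"
    using ddet_lin2_le[of "minv g" "lin2 g ` M"] by (simp add: lin2_image_minv assms)
  then have "smul (det2 g) (ddet M) \<subseteq> smul (det2 g * det2 (minv g)) (ddet (lin2 g ` M))"
    by (subst smul_smul[symmetric]) (rule smul_mono)
  moreover have "det2 g * det2 (minv g) = 1"
    using assms by (cases g) (simp add: Let_def divide_simps)
  ultimately show "smul (det2 g) (ddet M) \<subseteq> ddet (lin2 g ` M)" by simp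
qed (rule ddet_lin2_le)

lemma adj_0: "sgrp H \<Longrightarrow> adj H 0 = H"
  by (intro adj_eq_iff_mem sgrp_0) auto

section \<open>Extensions of lattices and their multiplier rings\<close>

context imag_quad
begin

text \<open>The alternating form \<open>cnj b * b' - b * cnj b'\<close> takes on \<open>L\<close>
  exactly the integer multiples of this number (\<open>eps_basis\<close>, \<open>eps_wedge\<close>).
  Up to the factor \<open>2 * \<i>\<close> it is an oriented covolume.\<close>

definition eps :: "complex set \<Rightarrow> complex" where
  "eps L = of_real (nrm L) * of_nat (cond L) * (w - cnj w)"

lemma w_diff_nz: "w - cnj w \<noteq> 0" using Im_w by (auto simp: complex_eq_iff)

lemma eps_nz: "klat L \<Longrightarrow> eps L \<noteq> 0"
  using nrm_pos[of L] cond_pos[of L] w_diff_nz by (simp add: eps_def)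

lemma eps_K: "klat L \<Longrightarrow> eps L \<in> K"
  unfolding eps_def by (intro K_closed nrm_K)

lemma eps_smul: "klat L \<Longrightarrow> c \<in> K \<Longrightarrow> c \<noteq> 0 \<Longrightarrow> eps (smul c L) = c * cnj c * eps L"
  by (simp add: eps_def nrm_smul cond_smul complex_norm_square[symmetric])

lemma eps_basis:
  assumes "klat L"
  obtains u v where "L = zspan u v" "u \<in> K" "v \<in> K" "u \<noteq> 0" "cnj u * v - u * cnj v = eps L"
  by (rule nrm_structure[OF assms]) (metis eps_def that)

lemma eps_wedge:
  assumes "klat L" "b \<in> L" "b' \<in> L" obtains k :: int where "cnj b * b' - b * cnj b' = of_int k * eps L"
proof -
  obtain u v where uv: "L = zspan u v" "cnj u * v - u * cnj v = eps L" using eps_basis[OF assms(1)] by blast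
  obtain i j where b: "b = of_int i * u + of_int j * v" using assms uv by (auto simp: zspan_def)
  obtain i' j' where b': "b' = of_int i' * u + of_int j' * v" using assms uv by (auto simp: zspan_def)
  have "cnj b * b' - b * cnj b' = of_int (i * j' - j * i') * (cnj u * v - u * cnj v)"
    unfolding b b' by (simp add: algebra_simps)
  then show ?thesis unfolding uv(2) by (rule that)
qed

text \<open>A \<open>\<int>\<close>-linear splitting of an extension of \<open>L2\<close> by \<open>L1\<close> is, up to a \<open>K\<close>-linear map, of the form
  \<open>b \<mapsto> y * cnj b\<close>. With \<open>y = e / eps L2\<close> the class of \<open>e\<close> is well defined modulo \<open>lprod L1 L2\<close>.\<close>
definition Mod :: "complex set \<Rightarrow> complex set \<Rightarrow> complex \<Rightarrow> (complex \<times> complex) set" where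
  "Mod L1 L2 e = {(a + e / eps L2 * cnj b, b) | a b. a \<in> L1 \<and> b \<in> L2}"

lemma Mod_iff: "(x, b) \<in> Mod L1 L2 e \<longleftrightarrow> b \<in> L2 \<and> x - e / eps L2 * cnj b \<in> L1"
  unfolding Mod_def by (auto intro!: exI[of _ "x - e / eps L2 * cnj b"])

lemma Mod_0: "Mod L1 L2 0 = L1 \<times> L2"
  by (auto simp: Mod_iff)

text \<open>A determinant of two vectors splits into a part in the product of \<open>L1\<close> and
  \<open>L2\<close> and \<open>e / eps L2\<close> times the alternating form on \<open>L2\<close>.
  The values of that form are the integer multiples of \<open>eps L2\<close>, which is why the class
  is normalised by this division.\<close>

lemma ddet_Mod:
  assumes "klat L1" "klat L2" shows "ddet (Mod L1 L2 e) = adj (lprod L1 L2) e"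
proof
  have s: "sgrp L1" "sgrp L2" using assms klat_sgrp by auto
  show "ddet (Mod L1 L2 e) \<subseteq> adj (lprod L1 L2) e"
  proof (rule ddet_least[OF sgrp_adj[OF sgrp_lprod]])
    fix x b x' b' assume "(x, b) \<in> Mod L1 L2 e" "(x', b') \<in> Mod L1 L2 e"
    then obtain a a' where a: "a \<in> L1" "a' \<in> L1" "b \<in> L2" "b' \<in> L2" and
      x: "x = a + e / eps L2 * cnj b" "x' = a' + e / eps L2 * cnj b'" unfolding Mod_def by blast
    obtain k where k: "cnj b * b' - b * cnj b' = of_int k * eps L2" using eps_wedge[OF assms(2) a(3,4)] .
    have "x * b' - b * x' = (a * b' - a' * b) + e / eps L2 * (cnj b * b' - b * cnj b')"
      unfolding x by (simp add: algebra_simps)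
    also have "\<dots> = (a * b' - a' * b) + of_int k * e" unfolding k using eps_nz[OF assms(2)] by simp
    finally show "x * b' - b * x' \<in> adj (lprod L1 L2) e"
      using a by (elim adj_memI) (intro sgrp_diff[OF sgrp_lprod] lprod_memI)
  qed
  show "adj (lprod L1 L2) e \<subseteq> ddet (Mod L1 L2 e)"
  proof (intro adj_least lprod_least sgrp_ddet)
    fix a b assume "a \<in> L1" "b \<in> L2"
    then have "(a, 0) \<in> Mod L1 L2 e" "(e / eps L2 * cnj b, b) \<in> Mod L1 L2 e"
      using s by (auto simp: Mod_iff sgrp_0)
    from ddet_memI[OF this] show "a * b \<in> ddet (Mod L1 L2 e)" by simp
  next
    obtain u v where uv: "L2 = zspan u v" "cnj u * v - u * cnj v = eps L2" using eps_basis[OF assms(2)] by blast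
    have "(e / eps L2 * cnj u, u) \<in> Mod L1 L2 e" "(e / eps L2 * cnj v, v) \<in> Mod L1 L2 e"
      using s uv zspan_basis by (auto simp: Mod_iff sgrp_0)
    from ddet_memI[OF this] have "e / eps L2 * (cnj u * v - u * cnj v) \<in> ddet (Mod L1 L2 e)"
      by (simp add: algebra_simps)
    then show "e \<in> ddet (Mod L1 L2 e)" using uv eps_nz[OF assms(2)] by simp
  qed
qed

definition mult2 :: "(complex \<times> complex) set \<Rightarrow> complex set" where
  "mult2 M = {\<alpha> \<in> K. \<forall>x\<in>M. (\<alpha> * fst x, \<alpha> * snd x) \<in> M}"

lemma mult2_lin2_le: "mult2 M \<subseteq> mult2 (lin2 g ` M)"
  unfolding mult2_def by (auto simp: lin2_scale[symmetric])

lemma mult2_lin2: assumes "det2 g \<noteq> 0" shows "mult2 (lin2 g ` M) = mult2 M"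
  using mult2_lin2_le[of M g] mult2_lin2_le[of "lin2 g ` M" "minv g"] assms
  by (simp add: lin2_image_minv)

text \<open>In coordinates, \<open>c\<close> divides the coefficient \<open>j\<close> because
  \<beta> lies in \<open>Ord c\<close>, and it divides \<open>g * i\<close> because of the second
  membership; so \<open>n\<close> divides \<open>i\<close>. In other words, the elements carrying
  \<open>Ord g\<close> into \<open>Ord (g * n)\<close> form \<open>n\<close> times
  \<open>Ord g\<close>.\<close>

lemma div_gcd_Ord:
  assumes "c = g * n" "g > 0" "n > 0" "\<beta> \<in> Ord c" "of_nat g * w * \<beta> \<in> Ord c"
  shows "\<beta> / of_nat n \<in> Ord g"
proof -
  obtain i j where b: "\<beta> = of_int i + of_int j * w" "int c dvd j" using assms(4) by (rule Ord_memE)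
  have "of_nat g * w * \<beta> = of_int (int g) * of_int i * w + of_int (int g) * of_int j * (w * w)"
    by (simp add: b algebra_simps)
  also have "\<dots> = of_int (- int g * j * nw) + of_int (int g * i + int g * j * tw) * w"
    unfolding w_sq by (simp add: algebra_simps)
  finally have "of_int (- int g * j * nw) + of_int (int g * i + int g * j * tw) * w \<in> Ord c"
    using assms(5) by metis
  then have "int c dvd int g * i + int g * j * tw" by (simp only: Ord_iff)
  moreover have "int c dvd int g * j * tw" using b(2) by simp
  ultimately have "int c dvd int g * i" using dvd_add_left_iff by blast
  then have "int n dvd i" using assms(1,2) by simp
  then obtain i' where i: "i = int n * i'" by (rule dvdE)
  obtain j' where j: "j = int c * j'" using b(2) by (rule dvdE)
  have "\<beta> / of_nat n = of_int i' + of_int (int g * j') * w"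
    using assms(3) by (simp add: b i j assms(1) field_simps)
  then show ?thesis by (rule Ord_memI') simp
qed

text \<open>For equal conductors the elements carrying \<open>linv B\<close> into \<open>A\<close>
  are the product of \<open>A\<close> and \<open>B\<close>. In general they are that product times
  \<open>lcm (cond A) (cond B) div cond B\<close>, the discrepancy between the order of
  \<open>A\<close> and the order of the product.\<close>

lemma colon_lattice:
  assumes "klat A" "klat B" "z \<in> K"
  shows "(\<forall>t\<in>linv B. z * of_nat (lcm (cond A) (cond B) div cond B) * t \<in> A) \<longleftrightarrow> z \<in> lprod A B"
proof
  define g where "g = gcd (cond A) (cond B)"
  define n where "n = lcm (cond A) (cond B) div cond B"
  have pos: "cond A > 0" "cond B > 0" using assms cond_pos by auto
  then have g0: "g > 0" by (simp add: g_def)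
  have nB: "n * cond B = lcm (cond A) (cond B)" by (simp add: n_def)
  have "g * (n * cond B) = cond A * cond B" unfolding nB g_def by (simp add: mult.commute)
  then have nA: "cond A = g * n" using pos by simp
  then have n0: "n > 0" using pos by (cases n) auto
  {
    assume "z \<in> lprod A B"
    show "\<forall>t\<in>linv B. z * of_nat n * t \<in> A"
    proof
      fix t assume t: "t \<in> linv B"
      have "lprod A B \<subseteq> {x. x * (of_nat n * t) \<in> A}"
      proof (intro lprod_least sgrp_mult_vimage klat_sgrp assms CollectI)
        fix a b assume a: "a \<in> A" and b: "b \<in> B"
        have "b * t \<in> Ord (cond B)" unfolding lprod_linv[OF assms(2), symmetric] using b t by (rule lprod_memI)
        then have "of_nat n * (b * t) \<in> Ord (lcm (cond A) (cond B))" using of_nat_mult_Ord nB by metis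
        then have "of_nat n * (b * t) * a \<in> A" using a by (intro mult_mem_lat'[OF assms(1)]) auto
        then show "a * b * (of_nat n * t) \<in> A" by (simp add: mult_ac)
      qed
      then show "z * of_nat n * t \<in> A" using \<open>z \<in> lprod A B\<close> by (auto simp: mult.assoc)
    qed
  }
  assume h: "\<forall>t\<in>linv B. z * of_nat n * t \<in> A"
  \<comment> \<open>Multiplying the condition by \<open>linv A\<close> moves it into
    \<open>Ord (cond A)\<close>. Since \<open>?X\<close> is stable under \<open>Ord g\<close>, the
    factor \<open>n\<close> can be cancelled by \<open>div_gcd_Ord\<close>, and \<open>?X\<close> is
    inverse to the product of \<open>A\<close> and \<open>B\<close>.\<close>
  let ?X = "lprod (linv A) (linv B)"
  have X: "klat ?X" "cond ?X = g" using assms by (simp_all add: klat_lprod klat_linv cond_lprod cond_linv g_def)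
  have 1: "z * of_nat n * x \<in> Ord (cond A)" if "x \<in> ?X" for x
  proof -
    have "?X \<subseteq> {x. x * (z * of_nat n) \<in> Ord (cond A)}"
    proof (intro lprod_least sgrp_mult_vimage sgrp_Ord CollectI)
      fix s t assume "s \<in> linv A" "t \<in> linv B"
      then have "(z * of_nat n * t) * s \<in> lprod A (linv A)" using h by (intro lprod_memI) auto
      then show "s * t * (z * of_nat n) \<in> Ord (cond A)" by (simp add: lprod_linv assms mult_ac)
    qed
    then show ?thesis using that by (auto simp: mult.commute)
  qed
  have 2: "z * x \<in> Ord g" if "x \<in> ?X" for x
  proof -
    have "of_nat g * w * x \<in> ?X" using mult_mem_lat[OF X(1) _ that] X(2) Ord_of_nat_w[of g g] by simp
    from 1[OF this] have "of_nat g * w * (z * of_nat n * x) \<in> Ord (cond A)" by (simp add: mult_ac)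
    with 1[OF that] have "z * of_nat n * x / of_nat n \<in> Ord g" by (intro div_gcd_Ord[OF nA g0 n0])
    then show ?thesis using n0 by simp
  qed
  have P: "klat (lprod A B)" "cond (lprod A B) = g" using assms by (simp_all add: klat_lprod cond_lprod g_def)
  have "lprod ?X (lprod A B) = lprod (lprod A (linv A)) (lprod B (linv B))" by (simp only: lprod_ac)
  also have "\<dots> = Ord g" by (simp add: lprod_linv assms lprod_Ord g_def)
  finally have "1 \<in> lprod ?X (lprod A B)" by (simp add: Ord_1_mem)
  moreover have "lprod ?X (lprod A B) \<subseteq> {x. x * z \<in> lprod A B}"
  proof (intro lprod_least sgrp_mult_vimage sgrp_lprod CollectI)
    fix x p assume "x \<in> ?X" "p \<in> lprod A B"
    then have "(z * x) * p \<in> lprod A B" using 2 P by (intro mult_mem_lat[OF P(1)]) auto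
    then show "x * p * z \<in> lprod A B" by (simp add: mult_ac)
  qed
  ultimately show "z \<in> lprod A B" by auto
qed

lemma linv_mem_iff: "klat B \<Longrightarrow> t \<in> linv B \<longleftrightarrow> (\<exists>b\<in>B. t = cnj b / of_real (nrm B))"
  by (auto simp: linv_def smul_def)

text \<open>An element \<alpha> must preserve \<open>L1\<close> and \<open>L2\<close>, which gives
  \<open>l dvd j\<close>, and the failure to commute with conjugation must be harmless:
  \<open>(\<alpha> - cnj \<alpha>) * e / eps L2\<close> has to carry \<open>cnj b\<close> into
  \<open>L1\<close>. The factor \<open>w - cnj w\<close> cancels against \<open>eps L2\<close>, and
  \<open>colon_lattice\<close> absorbs the norm and the conductors.\<close>

lemma mult2_Mod_iff:
  assumes "klat L1" "klat L2" "e \<in> K"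
  defines "l \<equiv> lcm (cond L1) (cond L2)"
  shows "of_int i + of_int j * w \<in> mult2 (Mod L1 L2 e) \<longleftrightarrow> (\<exists>k. j = int l * k \<and> of_int k * e \<in> lprod L1 L2)"
proof -
  define \<alpha> where "\<alpha> = of_int i + of_int j * w"
  define y where "y = e / eps L2"
  have s: "sgrp L1" "sgrp L2" using assms klat_sgrp by auto
  have pos: "cond L1 > 0" "cond L2 > 0" using assms cond_pos by auto
  have aK: "\<alpha> \<in> K" by (simp add: \<alpha>_def K_closed)
  have N: "nrm L2 > 0" using nrm_pos assms by auto
  have ad: "\<alpha> - cnj \<alpha> = of_int j * (w - cnj w)" by (simp add: \<alpha>_def algebra_simps)
  have act: "(\<alpha> * (a + y * cnj b), \<alpha> * b) \<in> Mod L1 L2 e \<longleftrightarrow>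
      \<alpha> * b \<in> L2 \<and> \<alpha> * a + y * (\<alpha> - cnj \<alpha>) * cnj b \<in> L1" for a b
  proof -
    have "\<alpha> * (a + y * cnj b) - y * cnj (\<alpha> * b) = \<alpha> * a + y * (\<alpha> - cnj \<alpha>) * cnj b"
      by (simp add: algebra_simps)
    then show ?thesis unfolding Mod_iff y_def[symmetric] by simp
  qed
  have "\<alpha> \<in> mult2 (Mod L1 L2 e) \<longleftrightarrow> (\<forall>a\<in>L1. \<forall>b\<in>L2. (\<alpha> * (a + y * cnj b), \<alpha> * b) \<in> Mod L1 L2 e)"
    using aK unfolding mult2_def by (fastforce simp: Mod_def y_def)
  also have "\<dots> \<longleftrightarrow> (\<forall>b\<in>L2. \<alpha> * b \<in> L2) \<and> (\<forall>a\<in>L1. \<alpha> * a \<in> L1) \<and> (\<forall>b\<in>L2. y * (\<alpha> - cnj \<alpha>) * cnj b \<in> L1)"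
    unfolding act
    using sgrp_0[OF s(1)] sgrp_0[OF s(2)] sgrp_add[OF s(1)] by (auto 4 3 dest: bspec[where x = 0])
  also have "(\<forall>b\<in>L2. \<alpha> * b \<in> L2) \<longleftrightarrow> \<alpha> \<in> Ord (cond L2)"
    using aK by (metis mem_OrdI mult_mem_lat assms(2))
  also have "(\<forall>a\<in>L1. \<alpha> * a \<in> L1) \<longleftrightarrow> \<alpha> \<in> Ord (cond L1)"
    using aK by (metis mem_OrdI mult_mem_lat assms(1))
  finally have *: "\<alpha> \<in> mult2 (Mod L1 L2 e) \<longleftrightarrow> \<alpha> \<in> Ord l \<and> (\<forall>b\<in>L2. y * (\<alpha> - cnj \<alpha>) * cnj b \<in> L1)"
    by (auto simp: l_def Ord_Int[symmetric])
  have key: "(\<forall>b\<in>L2. y * (\<alpha> - cnj \<alpha>) * cnj b \<in> L1) \<longleftrightarrow> of_int k * e \<in> lprod L1 L2" if k: "j = int l * k" for k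
  proof -
    have "l = (l div cond L2) * cond L2" unfolding l_def by simp
    then have "(of_nat l :: complex) = of_nat (l div cond L2) * of_nat (cond L2)" by (metis of_nat_mult)
    then have "y * (\<alpha> - cnj \<alpha>) * cnj b = of_int k * e * of_nat (l div cond L2) * (cnj b / of_real (nrm L2))" for b
      unfolding ad y_def eps_def k using N pos w_diff_nz by (simp add: field_simps)
    then have "(\<forall>b\<in>L2. y * (\<alpha> - cnj \<alpha>) * cnj b \<in> L1) \<longleftrightarrow>
        (\<forall>t\<in>linv L2. of_int k * e * of_nat (l div cond L2) * t \<in> L1)"
      using linv_mem_iff[OF assms(2)] by metis
    also have "\<dots> \<longleftrightarrow> of_int k * e \<in> lprod L1 L2"
      unfolding l_def by (rule colon_lattice) (use assms in \<open>auto intro: K_closed\<close>)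
    finally show ?thesis .
  qed
  have "\<alpha> \<in> Ord l \<longleftrightarrow> (\<exists>k. j = int l * k)" unfolding \<alpha>_def Ord_iff by (auto simp: dvd_def)
  then show ?thesis using * key unfolding \<alpha>_def by blast
qed

lemma mult2_Mod:
  assumes "klat L1" "klat L2" "e \<in> K" "rel_order (lprod L1 L2) e n"
  shows "mult2 (Mod L1 L2 e) = Ord (lcm (cond L1) (cond L2) * n)"
proof (intro set_eqI iffI)
  let ?l = "lcm (cond L1) (cond L2)"
  fix x assume x: "x \<in> mult2 (Mod L1 L2 e)"
  have "x * a \<in> L1" if "a \<in> L1" for a
  proof -
    have "(a, 0) \<in> Mod L1 L2 e" using that assms klat_sgrp by (auto simp: Mod_iff sgrp_0)
    then have "(x * a, x * 0) \<in> Mod L1 L2 e" using x unfolding mult2_def by force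
    then show ?thesis by (simp add: Mod_iff)
  qed
  then have "x \<in> Ord (cond L1)" using x by (intro mem_OrdI[OF assms(1)]) (auto simp: mult2_def)
  then obtain i j where ij: "x = of_int i + of_int j * w" by (rule Ord_memE)
  then obtain k where k: "j = int ?l * k" "of_int k * e \<in> lprod L1 L2"
    using x mult2_Mod_iff[OF assms(1-3)] by blast
  then have "int n dvd k" using rel_order_int[OF sgrp_lprod assms(4)] by blast
  then show "x \<in> Ord (?l * n)" unfolding ij Ord_iff k(1) by simp
next
  let ?l = "lcm (cond L1) (cond L2)"
  fix x assume "x \<in> Ord (?l * n)"
  then obtain i j where ij: "x = of_int i + of_int j * w" "int (?l * n) dvd j" by (rule Ord_memE)
  obtain k where k: "j = int (?l * n) * k" using ij(2) by (rule dvdE)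
  have "of_int (int n * k) * e \<in> lprod L1 L2" using rel_order_int[OF sgrp_lprod assms(4), of "int n * k"] by simp
  moreover have "j = int ?l * (int n * k)" by (simp add: k)
  ultimately show "x \<in> mult2 (Mod L1 L2 e)" unfolding ij mult2_Mod_iff[OF assms(1-3)] by blast
qed

end

section \<open>Lattices of rank two and triangular isomorphisms\<close>

lemma zspan_memE: assumes "x \<in> zspan u v" obtains i j where "x = of_int i * u + of_int j * v"
  using assms unfolding zspan_def by blast

fun matK :: "complex set \<Rightarrow> mat2 \<Rightarrow> bool" where
  "matK F (a, b, c, d) \<longleftrightarrow> a \<in> F \<and> b \<in> F \<and> c \<in> F \<and> d \<in> F"

context imag_quad
begin

lemma matK_mm: "matK K g \<Longrightarrow> matK K h \<Longrightarrow> matK K (mm g h)"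
  by (cases g; cases h) (simp add: K_add K_mult)

lemma matK_minv: "matK K g \<Longrightarrow> matK K (minv g)"
  by (cases g) (simp add: Let_def K_divide K_diff K_mult K_uminus del: minus_divide_left)

text \<open>A lattice of full rank in the plane over \<open>K\<close>, again described by
  commensurability rather than by a basis.\<close>

definition kmod :: "(complex \<times> complex) set \<Rightarrow> bool" where
  "kmod M \<longleftrightarrow> sgrp M \<and> (\<exists>A. klat A \<and> A \<times> A \<subseteq> M) \<and> (\<exists>B. klat B \<and> M \<subseteq> B \<times> B)"

lemma kmod_K: "kmod M \<Longrightarrow> M \<subseteq> K \<times> K"
  unfolding kmod_def using klat_K by blast

lemma sgrp_Times: "sgrp A \<Longrightarrow> sgrp B \<Longrightarrow> sgrp (A \<times> B)" for A :: "'a::ab_group_add set" and B :: "'b::ab_group_add set"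
  by (auto simp: sgrp_def zero_prod_def)

lemma common_denom:
  assumes "x \<in> K" "y \<in> K" "n > 0"
  obtains m :: nat where "m > 0" "of_nat m * x \<in> Ord n" "of_nat m * y \<in> Ord n"
proof -
  obtain k where k: "k > 0" "of_nat k * x \<in> Ord n" using klat_denom[OF klat_Ord[OF assms(3)] assms(1)] .
  obtain l where l: "l > 0" "of_nat l * y \<in> Ord n" using klat_denom[OF klat_Ord[OF assms(3)] assms(2)] .
  show ?thesis
    using that[of "k * l"] k l sgrp_of_nat_mult[OF sgrp_Ord k(2), of l] sgrp_of_nat_mult[OF sgrp_Ord l(2), of k]
    by (simp add: mult_ac)
qed

lemma klat_sum: assumes "klat A" "klat B" obtains C where "klat C" "A \<subseteq> C" "B \<subseteq> C"
proof -
  obtain m where m: "m > 0" "\<And>x. x \<in> A \<Longrightarrow> of_nat m * x \<in> Ord 1" using assms(1) by (rule klatE) blast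
  obtain k where k: "k > 0" "\<And>x. x \<in> B \<Longrightarrow> of_nat k * x \<in> Ord 1" using assms(2) by (rule klatE) blast
  have mk: "(of_nat (m * k) :: complex) \<noteq> 0" using m k by simp
  show ?thesis
  proof (rule that[of "smul (1 / of_nat (m * k)) (Ord 1)"])
    show "klat (smul (1 / of_nat (m * k)) (Ord 1))" using mk by (intro klat_smul klat_Ord K_closed) auto
    show "A \<subseteq> smul (1 / of_nat (m * k)) (Ord 1)"
    proof
      fix x assume "x \<in> A"
      then have "of_nat k * (of_nat m * x) \<in> Ord 1" using m sgrp_of_nat_mult[OF sgrp_Ord] by blast
      then show "x \<in> smul (1 / of_nat (m * k)) (Ord 1)" using mk by (simp add: in_smul_iff mult_ac)
    qed
    show "B \<subseteq> smul (1 / of_nat (m * k)) (Ord 1)"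
    proof
      fix x assume "x \<in> B"
      then have "of_nat m * (of_nat k * x) \<in> Ord 1" using k sgrp_of_nat_mult[OF sgrp_Ord] by blast
      then show "x \<in> smul (1 / of_nat (m * k)) (Ord 1)" using mk by (simp add: in_smul_iff mult_ac)
    qed
  qed
qed

lemma kmod_Times: assumes "klat A" "klat B" shows "kmod (A \<times> B)"
proof -
  obtain C where C: "klat C" "A \<subseteq> C" "B \<subseteq> C" using klat_sum[OF assms] .
  have "klat (A \<inter> B)" "(A \<inter> B) \<times> (A \<inter> B) \<subseteq> A \<times> B" using assms klat_Int by blast+
  moreover have "A \<times> B \<subseteq> C \<times> C" using C by blast
  moreover have "sgrp (A \<times> B)" using assms by (intro sgrp_Times klat_sgrp)
  ultimately show ?thesis unfolding kmod_def using C(1) by metis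
qed

lemma lin2_square_subset:
  assumes "klat A" "matK K g" obtains C where "klat C" "lin2 g ` (C \<times> C) \<subseteq> A \<times> A"
proof -
  obtain a b c d where g: "g = (a, b, c, d)" by (cases g)
  have abcd: "a \<in> K" "b \<in> K" "c \<in> K" "d \<in> K" using assms(2) by (simp_all add: g)
  have cA: "cond A > 0" using assms cond_pos by blast
  obtain m where m: "m > 0" "of_nat m * a \<in> Ord (cond A)" "of_nat m * b \<in> Ord (cond A)"
    using common_denom[OF abcd(1,2) cA] .
  obtain k where k: "k > 0" "of_nat k * c \<in> Ord (cond A)" "of_nat k * d \<in> Ord (cond A)"
    using common_denom[OF abcd(3,4) cA] .
  have sA: "sgrp A" using assms klat_sgrp by blast
  show ?thesis
  proof (rule that[of "smul (of_nat (m * k)) A"])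
    show "klat (smul (of_nat (m * k)) A)" using m k assms by (intro klat_smul K_closed) auto
    have *: "of_nat m * x * y \<in> A" if "of_nat m * x \<in> Ord (cond A)" "y \<in> A" for x y m
      using mult_mem_lat[OF assms(1) that] .
    have 1: "a * (of_nat (m * k) * x) + b * (of_nat (m * k) * y) \<in> A" if "x \<in> A" "y \<in> A" for x y
    proof -
      have "of_nat k * (of_nat m * a * x) + of_nat k * (of_nat m * b * y) \<in> A"
        by (intro sgrp_add sgrp_of_nat_mult sA * m that)
      then show ?thesis by (simp add: mult_ac)
    qed
    have 2: "c * (of_nat (m * k) * x) + d * (of_nat (m * k) * y) \<in> A" if "x \<in> A" "y \<in> A" for x y
    proof -
      have "of_nat m * (of_nat k * c * x) + of_nat m * (of_nat k * d * y) \<in> A"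
        by (intro sgrp_add sgrp_of_nat_mult sA * k that)
      then show ?thesis by (simp add: mult_ac)
    qed
    show "lin2 g ` (smul (of_nat (m * k)) A \<times> smul (of_nat (m * k)) A) \<subseteq> A \<times> A"
      using 1 2 by (auto simp: g smul_def)
  qed
qed

lemma kmod_lin2: assumes "kmod M" "matK K g" "det2 g \<noteq> 0" shows "kmod (lin2 g ` M)"
proof -
  obtain A where A: "klat A" "A \<times> A \<subseteq> M" using assms(1) by (auto simp: kmod_def)
  obtain B where B: "klat B" "M \<subseteq> B \<times> B" using assms(1) by (auto simp: kmod_def)
  obtain C where C: "klat C" "lin2 (minv g) ` (C \<times> C) \<subseteq> A \<times> A"
    using lin2_square_subset[OF A(1) matK_minv[OF assms(2)]] .
  have "C \<times> C \<subseteq> lin2 g ` M"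
  proof
    fix x assume "x \<in> C \<times> C"
    then have "lin2 (minv g) x \<in> M" using C A by blast
    then show "x \<in> lin2 g ` M" using lin2_image_mem[OF assms(3)] by blast
  qed
  moreover obtain D where D: "klat D" "lin2 g ` (D \<times> D) \<subseteq> B \<times> B"
    using lin2_square_subset[OF B(1) assms(2)] .
  \<comment> \<open>The outer bound comes from an inner one: \<open>m * k\<close> shrinks
    \<open>B \<times> B\<close> into \<open>D \<times> D\<close>, whose image lies in
    \<open>B \<times> B\<close>.\<close>
  have "\<exists>E. klat E \<and> lin2 g ` (B \<times> B) \<subseteq> E \<times> E"
  proof -
    obtain m where m: "m > 0" "\<And>x. x \<in> Ord 1 \<Longrightarrow> of_nat m * x \<in> D" using D(1) by (rule klatE) blast
    obtain k where k: "k > 0" "\<And>x. x \<in> B \<Longrightarrow> of_nat k * x \<in> Ord 1" using B(1) by (rule klatE) blast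
    have mk: "(of_nat (m * k) :: complex) \<noteq> 0" using m k by simp
    have "lin2 g (s, t) \<in> smul (1 / of_nat (m * k)) B \<times> smul (1 / of_nat (m * k)) B" if "s \<in> B" "t \<in> B" for s t
    proof -
      have "(of_nat (m * k) * s, of_nat (m * k) * t) \<in> D \<times> D" using m(2)[OF k(2)[OF that(1)]] m(2)[OF k(2)[OF that(2)]]
        by (simp add: mult.assoc)
      then have "lin2 g (of_nat (m * k) * s, of_nat (m * k) * t) \<in> B \<times> B" using D(2) by blast
      then show ?thesis using mk lin2_scale[of g "of_nat (m * k)" "(s, t)"]
        by (simp add: in_smul_iff mem_Times_iff mult.commute)
    qed
    then have "lin2 g ` (B \<times> B) \<subseteq> smul (1 / of_nat (m * k)) B \<times> smul (1 / of_nat (m * k)) B" by blast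
    moreover have "klat (smul (1 / of_nat (m * k)) B)" using mk B by (intro klat_smul K_closed) auto
    ultimately show ?thesis by blast
  qed
  then obtain E where E: "klat E" "lin2 g ` (B \<times> B) \<subseteq> E \<times> E" by blast
  have "lin2 g ` M \<subseteq> E \<times> E" using B(2) E(2) by blast
  moreover have "sgrp (lin2 g ` M)" using assms(1) by (auto simp: kmod_def intro!: sgrp_image lin2_diff)
  ultimately show ?thesis unfolding kmod_def using C(1) E(1) by blast
qed

lemma klat_line:
  assumes "kmod M" "p \<in> K" "q \<in> K" "(p, q) \<noteq> (0, 0)"
  shows "klat {t. (t * p, t * q) \<in> M}"
proof -
  obtain A where A: "klat A" "A \<times> A \<subseteq> M" using assms(1) by (auto simp: kmod_def)
  obtain B where B: "klat B" "M \<subseteq> B \<times> B" using assms(1) by (auto simp: kmod_def)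
  have sM: "sgrp M" using assms(1) by (simp add: kmod_def)
  obtain m where m: "m > 0" "of_nat m * p \<in> Ord (cond A)" "of_nat m * q \<in> Ord (cond A)"
    using common_denom[OF assms(2,3) cond_pos[OF A(1)]] .
  obtain r where r: "r \<in> K" "r \<noteq> 0" "\<And>t. (t * p, t * q) \<in> M \<Longrightarrow> t * r \<in> B"
    using assms B(2) by (cases "p = 0") blast+
  show ?thesis
  proof (rule klat_between)
    show "sgrp {t. (t * p, t * q) \<in> M}" by (rule sgrp_vimage[OF sM]) (simp add: algebra_simps)
    show "klat (smul (of_nat m) A)" using m A by (intro klat_smul K_closed) auto
    show "klat (smul (1 / r) B)" using r B by (intro klat_smul K_closed) auto
    show "smul (of_nat m) A \<subseteq> {t. (t * p, t * q) \<in> M}"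
    proof
      fix t assume "t \<in> smul (of_nat m) A"
      then obtain a where a: "a \<in> A" "t = of_nat m * a" by (auto simp: smul_def)
      have "t * p = of_nat m * p * a" "t * q = of_nat m * q * a" by (simp_all add: a(2) mult_ac)
      then have "t * p \<in> A" "t * q \<in> A" using mult_mem_lat[OF A(1) m(2) a(1)] mult_mem_lat[OF A(1) m(3) a(1)] by metis+
      then show "t \<in> {t. (t * p, t * q) \<in> M}" using A(2) by blast
    qed
    show "{t. (t * p, t * q) \<in> M} \<subseteq> smul (1 / r) B" using r by (auto simp: in_smul_iff)
  qed
qed

text \<open>Cramer's rule for the additive map \<open>z * cnj b + x * b\<close> with prescribed
  values \<open>p\<close> at \<open>u\<close> and \<open>q\<close> at \<open>v\<close>; the
  determinant of the system is \<open>E\<close>.\<close>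

lemma wedge_solve:
  assumes "cnj u * v - u * cnj v = E" "E \<noteq> 0" "u \<noteq> 0" "z = (p * v - q * u) / E" "x = (p - z * cnj u) / u"
  shows "z * cnj u + x * u = p" "z * cnj v + x * v = q"
proof -
  show 1: "z * cnj u + x * u = p" using assms(3) by (simp add: assms(5))
  have "u * (z * cnj v + x * v) = z * (u * cnj v) + (x * u) * v" by (simp add: algebra_simps)
  also have "x * u = p - z * cnj u" using 1 by (simp add: algebra_simps)
  also have "z * (u * cnj v) + (p - z * cnj u) * v = p * v - z * (cnj u * v - u * cnj v)"
    by (simp add: algebra_simps)
  also have "\<dots> = u * q" using assms(2) by (simp add: assms(1,4))
  finally show "z * cnj v + x * v = q" using assms(3) by simp
qed

text \<open>Lifting a basis of the second projection to \<open>M\<close> gives an additive section.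
  It is a sum of a linear and a conjugate-linear map, and the shear by \<open>x\<close> removes the
  linear part.\<close>

lemma normal_form:
  assumes "kmod M"
  obtains x L1 L2 e where "x \<in> K" "klat L1" "klat L2" "e \<in> K" "L1 = {a. (a, 0) \<in> M}"
    "lin2 (1, x, 0, 1) ` M = Mod L1 L2 e"
proof -
  define L1 where "L1 = {a. (a, 0) \<in> M}"
  define L2 where "L2 = snd ` M"
  obtain A where A: "klat A" "A \<times> A \<subseteq> M" using assms(1) by (auto simp: kmod_def)
  obtain B where B: "klat B" "M \<subseteq> B \<times> B" using assms(1) by (auto simp: kmod_def)
  have sM: "sgrp M" using assms(1) by (simp add: kmod_def)
  have L1: "klat L1" using klat_line[OF assms K_1 K_0] by (simp add: L1_def)
  have L2: "klat L2"
  proof (rule klat_between[OF _ A(1) B(1)])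
    show "sgrp L2" unfolding L2_def by (rule sgrp_image[OF sM]) simp
    show "A \<subseteq> L2" "L2 \<subseteq> B" using A B by (force simp: L2_def)+
  qed
  obtain u v where uv: "L2 = zspan u v" "u \<in> K" "v \<in> K" "u \<noteq> 0" "cnj u * v - u * cnj v = eps L2"
    using eps_basis[OF L2] .
  have "u \<in> L2" "v \<in> L2" using uv zspan_basis by auto
  then obtain p q where pq: "(p, u) \<in> M" "(q, v) \<in> M" by (auto simp: L2_def)
  have pqK: "p \<in> K" "q \<in> K" using pq kmod_K[OF assms] by auto
  \<comment> \<open>This is the determinant of the two lifted basis vectors \<open>(p, u)\<close>
    and \<open>(q, v)\<close>.\<close>
  define e where "e = p * v - q * u"
  define z where "z = (p * v - q * u) / eps L2"
  define x where "x = - ((p - z * cnj u) / u)"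
  have eK: "e \<in> K" "x \<in> K" unfolding e_def x_def z_def by (intro K_closed pqK uv eps_K L2)+
  have pz: "p + x * u = z * cnj u" "q + x * v = z * cnj v"
    using wedge_solve[OF uv(5) eps_nz[OF L2] uv(4) z_def refl] by (simp_all add: x_def algebra_simps)
  have z: "z = e / eps L2" by (simp add: z_def e_def)
  have key: "(s, b) \<in> M \<longleftrightarrow> s + x * b - z * cnj b \<in> L1" if "b \<in> L2" for s b
  proof -
    obtain i j where b: "b = of_int i * u + of_int j * v" using \<open>b \<in> L2\<close> unfolding uv(1) by (rule zspan_memE)
    have m0: "(of_int i * p + of_int j * q, b) \<in> M"
    proof -
      have "sgrp {t. (t * p, t * u) \<in> M}" "sgrp {t. (t * q, t * v) \<in> M}"
        by (rule sgrp_vimage[OF sM], simp add: algebra_simps)+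
      then have "(of_int i * p, of_int i * u) \<in> M" "(of_int j * q, of_int j * v) \<in> M"
        using sgrp_of_int_mult[of "{t. (t * p, t * u) \<in> M}" 1 i] sgrp_of_int_mult[of "{t. (t * q, t * v) \<in> M}" 1 j] pq
        by simp_all
      from sgrp_add[OF sM this] show ?thesis by (simp add: b)
    qed
    have "s + x * b - z * cnj b = s - (of_int i * p + of_int j * q) + of_int i * (p + x * u) + of_int j * (q + x * v) - z * cnj b"
      by (simp add: b algebra_simps)
    also have "\<dots> = s - (of_int i * p + of_int j * q)" unfolding pz by (simp add: b algebra_simps)
    finally have e: "s + x * b - z * cnj b = s - (of_int i * p + of_int j * q)" .
    have "(s, b) \<in> M \<longleftrightarrow> (of_int i * p + of_int j * q, b) + (s - (of_int i * p + of_int j * q), 0) \<in> M" by simp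
    also have "\<dots> \<longleftrightarrow> (s - (of_int i * p + of_int j * q), 0) \<in> M" by (rule sgrp_add_iff[OF sM m0])
    finally show ?thesis by (simp add: e L1_def)
  qed
  have "lin2 (1, x, 0, 1) ` M = Mod L1 L2 e"
  proof (intro set_eqI iffI)
    fix y assume "y \<in> lin2 (1, x, 0, 1) ` M"
    then obtain s b where sb: "(s, b) \<in> M" "y = (s + x * b, b)" by auto
    moreover have "b \<in> L2" using sb by (force simp: L2_def)
    ultimately show "y \<in> Mod L1 L2 e" using key by (simp add: Mod_iff z)
  next
    fix y assume "y \<in> Mod L1 L2 e"
    then obtain s b where sb: "y = (s, b)" "b \<in> L2" "s - z * cnj b \<in> L1" by (cases y) (auto simp: Mod_iff z)
    then have "(s - x * b, b) \<in> M" using key[OF sb(2), of "s - x * b"] by simp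
    then have "lin2 (1, x, 0, 1) (s - x * b, b) \<in> lin2 (1, x, 0, 1) ` M" by blast
    then show "y \<in> lin2 (1, x, 0, 1) ` M" by (simp add: sb)
  qed
  then show ?thesis using that eK L1 L2 L1_def by blast
qed

text \<open>The diagonal entries act on the sublattice and on the quotient. The unknown shear
  \<open>x\<close> is tied down only by the requirement that lifted vectors have their error term in
  the new sublattice, and it disappears when that term is wedged with a basis of
  \<open>L2\<close>.\<close>

lemma flag_iso:
  assumes "klat L1" "klat L2" "klat L1'" "klat L2'" "a \<noteq> 0" "d \<noteq> 0"
    and "lin2 (a, x, 0, d) ` Mod L1 L2 e = Mod L1' L2' e'"
  shows "L1' = smul a L1" "L2' = smul d L2" "e' - a * d * e \<in> lprod L1' L2'"
proof -
  have s: "sgrp L1" "sgrp L2" "sgrp L1'" "sgrp L2'" using assms klat_sgrp by auto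
  have fw: "(a * s + x * b, d * b) \<in> Mod L1' L2' e'" if "(s, b) \<in> Mod L1 L2 e" for s b
  proof -
    have "lin2 (a, x, 0, d) (s, b) \<in> Mod L1' L2' e'" unfolding assms(7)[symmetric] using that by blast
    then show ?thesis by simp
  qed
  have bw: "\<exists>s b. (s, b) \<in> Mod L1 L2 e \<and> s' = a * s + x * b \<and> b' = d * b" if "(s', b') \<in> Mod L1' L2' e'" for s' b'
  proof -
    have "(s', b') \<in> lin2 (a, x, 0, d) ` Mod L1 L2 e" using that assms(7) by simp
    then obtain s b where "(s, b) \<in> Mod L1 L2 e" "(s', b') = lin2 (a, x, 0, d) (s, b)" by auto
    then show ?thesis by auto
  qed
  show L1': "L1' = smul a L1"
  proof (intro equalityI subsetI)
    fix t assume "t \<in> L1'"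
    then have "(t, 0) \<in> Mod L1' L2' e'" using s by (simp add: Mod_iff sgrp_0)
    then obtain s b where *: "(s, b) \<in> Mod L1 L2 e" "t = a * s + x * b" "0 = d * b" using bw by blast
    then have "b = 0" using assms by simp
    then show "t \<in> smul a L1" using * by (auto simp: Mod_iff intro: smul_memI)
  next
    fix t assume "t \<in> smul a L1"
    then obtain r where r: "r \<in> L1" "t = a * r" by (auto simp: smul_def)
    then have "(r, 0) \<in> Mod L1 L2 e" using s by (simp add: Mod_iff sgrp_0)
    from fw[OF this] show "t \<in> L1'" by (simp add: Mod_iff r)
  qed
  show L2': "L2' = smul d L2"
  proof (intro equalityI subsetI)
    fix t assume "t \<in> L2'"
    then have "(e' / eps L2' * cnj t, t) \<in> Mod L1' L2' e'" using s by (simp add: Mod_iff sgrp_0)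
    then obtain s b where *: "(s, b) \<in> Mod L1 L2 e" "t = d * b" using bw by blast
    then show "t \<in> smul d L2" by (auto simp: Mod_iff intro: smul_memI)
  next
    fix t assume "t \<in> smul d L2"
    then obtain r where r: "r \<in> L2" "t = d * r" by (auto simp: smul_def)
    then have "(e / eps L2 * cnj r, r) \<in> Mod L1 L2 e" using s by (simp add: Mod_iff sgrp_0)
    from fw[OF this] show "t \<in> L2'" by (simp add: Mod_iff r)
  qed
  obtain u v where uv: "L2 = zspan u v" "u \<in> K" "v \<in> K" "u \<noteq> 0" "cnj u * v - u * cnj v = eps L2"
    using eps_basis[OF assms(2)] .
  have uvL: "u \<in> L2" "v \<in> L2" using uv zspan_basis by auto
  have dK: "d \<in> K"
  proof -
    have "d * u \<in> L2'" unfolding L2' using uvL by (intro smul_memI)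
    then have "d * u / u \<in> K" using klat_K assms(4) uv by (intro K_divide) auto
    then show ?thesis using uv(4) by simp
  qed
  define z where "z = a * (e / eps L2) - e' / (d * eps L2)"
  have E0: "eps L2 \<noteq> 0" using eps_nz assms by blast
  have E': "e' / eps L2' * cnj (d * b) = e' / (d * eps L2) * cnj b" for b
    unfolding L2' eps_smul[OF assms(2) dK assms(6)] using assms(6) E0 by (simp add: field_simps)
  have zb: "z * cnj b + x * b \<in> L1'" if "b \<in> L2" for b
  proof -
    have "(e / eps L2 * cnj b, b) \<in> Mod L1 L2 e" using s that by (simp add: Mod_iff sgrp_0)
    from fw[OF this] have "a * (e / eps L2 * cnj b) + x * b - e' / (d * eps L2) * cnj b \<in> L1'"
      unfolding Mod_iff E' by simp
    then show ?thesis by (simp add: z_def algebra_simps)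
  qed
  \<comment> \<open>The two contributions of \<open>x\<close> cancel in this combination, leaving
    \<open>z * eps L2\<close>.\<close>
  have "(z * cnj u + x * u) * v - (z * cnj v + x * v) * u \<in> lprod L1' L2"
    by (intro sgrp_diff[OF sgrp_lprod] lprod_memI zb uvL)
  also have "(z * cnj u + x * u) * v - (z * cnj v + x * v) * u = z * (cnj u * v - u * cnj v)"
    by (simp add: algebra_simps)
  also have "\<dots> = a * e - e' / d" unfolding uv(5) z_def using E0 assms(6) by (simp add: field_simps)
  finally have "d * (a * e - e' / d) \<in> smul d (lprod L1' L2)" by (rule smul_memI)
  then have "a * d * e - e' \<in> lprod L1' L2'"
    using assms(6) by (simp add: L2' lprod_smul_right algebra_simps)
  then show "e' - a * d * e \<in> lprod L1' L2'" using sgrp_uminus[OF sgrp_lprod] by fastforce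
qed

text \<open>Only the two basis vectors of \<open>L\<close> are needed as second factors; the sign
  matches the determinant in \<open>wedge_solve\<close>.\<close>

lemma lprod_wedge:
  assumes "sgrp A" "L = zspan u v" "t \<in> lprod A L" obtains a b where "a \<in> A" "b \<in> A" "t = a * v - b * u"
proof -
  let ?H = "{a * v - b * u | a b. a \<in> A \<and> b \<in> A}"
  have "sgrp ?H" unfolding sgrp_def
  proof (intro conjI ballI)
    show "0 \<in> ?H" using sgrp_0[OF assms(1)] by (force intro: exI[of _ 0])
    fix x y assume "x \<in> ?H" "y \<in> ?H"
    then obtain a b a' b' where *: "a \<in> A" "b \<in> A" "a' \<in> A" "b' \<in> A" "x = a * v - b * u" "y = a' * v - b' * u" by blast
    then have "x - y = (a - a') * v - (b - b') * u" by (simp only: left_diff_distrib) simp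
    then show "x - y \<in> ?H" using * sgrp_diff[OF assms(1)] by blast
  qed
  moreover have "a * l \<in> ?H" if "a \<in> A" "l \<in> L" for a l
  proof -
    obtain i j where l: "l = of_int i * u + of_int j * v" using \<open>l \<in> L\<close> unfolding assms(2) by (rule zspan_memE)
    have "a * l = of_int j * a * v - of_int (- i) * a * u" by (simp add: l algebra_simps)
    then show ?thesis using sgrp_of_int_mult[OF assms(1) that(1)] by blast
  qed
  ultimately have "lprod A L \<subseteq> ?H" by (rule lprod_least)
  then show ?thesis using assms(3) that by blast
qed

text \<open>Written as \<open>p * v - q * u\<close> with \<open>p, q\<close> in the new sublattice,
  the difference of classes determines a shear by \<open>wedge_solve\<close>. The error term then
  takes the values \<open>p, q\<close> on the basis, hence values in the sublattice on all of
  \<open>L2\<close>.\<close>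

lemma flag_isoI:
  assumes "klat L1" "klat L2" "e \<in> K" "e' \<in> K" "a \<in> K" "a \<noteq> 0" "d \<in> K" "d \<noteq> 0"
    and "e' - a * d * e \<in> lprod (smul a L1) (smul d L2)"
  obtains x where "x \<in> K" "lin2 (a, x, 0, d) ` Mod L1 L2 e = Mod (smul a L1) (smul d L2) e'"
proof -
  have s: "sgrp L1" "sgrp L2" using assms klat_sgrp by auto
  obtain u v where uv: "L2 = zspan u v" "u \<in> K" "v \<in> K" "u \<noteq> 0" "cnj u * v - u * cnj v = eps L2"
    using eps_basis[OF assms(2)] .
  have E0: "eps L2 \<noteq> 0" using eps_nz assms by blast
  have "a * d * e - e' \<in> lprod (smul a L1) (smul d L2)" using sgrp_uminus[OF sgrp_lprod assms(9)] by simp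
  then have "(a * d * e - e') / d \<in> lprod (smul a L1) L2" using assms(8) by (simp add: lprod_smul_right in_smul_iff)
  then have "a * e - e' / d \<in> lprod (smul a L1) L2" using assms(8) by (simp add: diff_divide_distrib)
  then obtain p q where pq: "p \<in> smul a L1" "q \<in> smul a L1" "a * e - e' / d = p * v - q * u"
    using lprod_wedge[OF sgrp_smul[OF s(1)] uv(1)] by blast
  define z where "z = a * (e / eps L2) - e' / (d * eps L2)"
  have z: "z = (p * v - q * u) / eps L2" unfolding pq(3)[symmetric] z_def using E0 assms(8) by (simp add: field_simps)
  define x where "x = (p - z * cnj u) / u"
  have pz: "z * cnj u + x * u = p" "z * cnj v + x * v = q"
    using wedge_solve[OF uv(5) E0 uv(4) z x_def] by simp_all
  have "p \<in> K" using pq(1) klat_K[OF klat_smul[OF assms(1,5,6)]] by blast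
  then have xK: "x \<in> K" unfolding x_def z_def by (intro K_closed assms uv eps_K)
  have zb: "z * cnj b + x * b \<in> smul a L1" if "b \<in> L2" for b
  proof -
    obtain i j where b: "b = of_int i * u + of_int j * v" using \<open>b \<in> L2\<close> unfolding uv(1) by (rule zspan_memE)
    have "z * cnj b + x * b = of_int i * (z * cnj u + x * u) + of_int j * (z * cnj v + x * v)"
      by (simp add: b algebra_simps)
    then show ?thesis unfolding pz using pq by (auto intro!: sgrp_add sgrp_of_int_mult sgrp_smul s)
  qed
  have E': "e' / eps (smul d L2) * cnj (d * b) = e' / (d * eps L2) * cnj b" for b
    unfolding eps_smul[OF assms(2,7,8)] using assms(8) E0 by (simp add: field_simps)
  have key: "(a * t + x * b, d * b) \<in> Mod (smul a L1) (smul d L2) e' \<longleftrightarrow> (t, b) \<in> Mod L1 L2 e" for t b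
  proof -
    have b: "d * b \<in> smul d L2 \<longleftrightarrow> b \<in> L2" using assms(8) by (simp add: in_smul_iff)
    show ?thesis
    proof (cases "b \<in> L2")
      case True
      have "a * t + x * b - e' / (d * eps L2) * cnj b = (z * cnj b + x * b) + a * (t - e / eps L2 * cnj b)"
        by (simp add: z_def algebra_simps)
      then have "a * t + x * b - e' / (d * eps L2) * cnj b \<in> smul a L1 \<longleftrightarrow> a * (t - e / eps L2 * cnj b) \<in> smul a L1"
        by (simp only: sgrp_add_iff[OF sgrp_smul[OF s(1)] zb[OF True]])
      also have "\<dots> \<longleftrightarrow> t - e / eps L2 * cnj b \<in> L1" using assms(6) by (simp add: in_smul_iff)
      finally show ?thesis unfolding Mod_iff E' b using True by simp
    qed (simp add: Mod_iff b)
  qed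
  have "lin2 (a, x, 0, d) ` Mod L1 L2 e = Mod (smul a L1) (smul d L2) e'"
  proof (intro set_eqI iffI)
    fix y assume "y \<in> lin2 (a, x, 0, d) ` Mod L1 L2 e"
    then obtain t b where tb: "(t, b) \<in> Mod L1 L2 e" "y = lin2 (a, x, 0, d) (t, b)" by auto
    then show "y \<in> Mod (smul a L1) (smul d L2) e'" using key by simp
  next
    fix y assume y: "y \<in> Mod (smul a L1) (smul d L2) e'"
    obtain s' b' where y': "y = (s', b')" by (cases y)
    define b where "b = b' / d"
    define t where "t = (s' - x * b) / a"
    have e: "s' = a * t + x * b" "b' = d * b" using assms(6,8) by (simp_all add: t_def b_def)
    then have "(t, b) \<in> Mod L1 L2 e" using key y y' by simp
    then have "lin2 (a, x, 0, d) (t, b) \<in> lin2 (a, x, 0, d) ` Mod L1 L2 e" by blast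
    then show "y \<in> lin2 (a, x, 0, d) ` Mod L1 L2 e" by (simp add: y' e)
  qed
  then show ?thesis using that xK by blast
qed

section \<open>Splitting off lines and the Steinitz theorem\<close>

lemma move_to_axis:
  assumes "p \<in> K" "q \<in> K" "(p, q) \<noteq> (0, 0)"
  obtains h where "matK K h" "det2 h \<noteq> 0" "lin2 h (p, q) = (1, 0)"
proof (cases "p = 0")
  case False
  show ?thesis by (rule that[of "(1 / p, 0, - q / p, 1)"])
    (use False assms in \<open>simp_all add: K_closed del: minus_divide_left\<close>)
next
  case True
  then show ?thesis using assms by (intro that[of "(0, 1 / q, 1, 0)"]) (simp_all add: K_closed)
qed

text \<open>If the line already has the full conductor \<open>f\<close>, the relation
  \<open>lcm f (cond L2) * n = f\<close> leaves only \<open>n = 1\<close> and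
  \<open>cond L2 dvd f\<close>. The class of the extension is then trivial, and a shear splits
  it.\<close>

lemma split_line:
  assumes "kmod M" "mult2 M = Ord f" "p \<in> K" "q \<in> K" "(p, q) \<noteq> (0, 0)"
    "cond {t. (t * p, t * q) \<in> M} = f"
  obtains g L2 where "matK K g" "det2 g \<noteq> 0" "klat L2" "cond L2 dvd f"
    "lin2 g ` M = {t. (t * p, t * q) \<in> M} \<times> L2"
proof -
  obtain h where h: "matK K h" "det2 h \<noteq> 0" "lin2 h (p, q) = (1, 0)" using move_to_axis[OF assms(3-5)] .
  have k1: "kmod (lin2 h ` M)" using kmod_lin2 assms(1) h by blast
  obtain x L1 L2 e where NF: "x \<in> K" "klat L1" "klat L2" "e \<in> K" "L1 = {a. (a, 0) \<in> lin2 h ` M}"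
    "lin2 (1, x, 0, 1) ` lin2 h ` M = Mod L1 L2 e" using normal_form[OF k1] .
  have L1: "L1 = {t. (t * p, t * q) \<in> M}"
  proof -
    have "(t, 0) \<in> lin2 h ` M \<longleftrightarrow> (t * p, t * q) \<in> M" for t
    proof -
      have "(t, 0) = lin2 h (t * p, t * q)" using lin2_scale[of h t "(p, q)"] h(3) by simp
      then have "lin2 (minv h) (t, 0) = (t * p, t * q)" using lin2_minv[OF h(2)] by metis
      then show ?thesis using lin2_image_mem[OF h(2)] by metis
    qed
    then show ?thesis using NF(5) by simp
  qed
  obtain n where n: "n > 0" "rel_order (lprod L1 L2) e n"
    using rel_order_exists[OF klat_lprod[OF NF(2,3)] NF(4)] .
  have "mult2 (Mod L1 L2 e) = Ord f"
    unfolding NF(6)[symmetric] using mult2_lin2 h(2) assms(2) by simp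
  then have "Ord (lcm (cond L1) (cond L2) * n) = Ord f" using mult2_Mod[OF NF(2-4) n(2)] by simp
  then have fn: "lcm f (cond L2) * n = f" using assms(6) L1 by (simp add: Ord_eq_iff)
  have f0: "f > 0" using cond_pos[OF NF(2)] assms(6) L1 by simp
  have "f dvd lcm f (cond L2)" by simp
  then obtain m where m: "lcm f (cond L2) = f * m" by (rule dvdE)
  then have "f * (m * n) = f * 1" using fn by (simp add: mult.assoc)
  then have "m * n = 1" using f0 by simp
  then have "n = 1" "m = 1" by simp_all
  then have L2f: "cond L2 dvd f" using m by (metis dvd_lcm2 mult_1_right)
  have "e \<in> lprod L1 L2" using n \<open>n = 1\<close> rel_order_1_iff[OF sgrp_lprod] by simp
  then have "0 - 1 * 1 * e \<in> lprod (smul 1 L1) (smul 1 L2)" using sgrp_uminus[OF sgrp_lprod] by simp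
  then obtain y where y: "y \<in> K" "lin2 (1, y, 0, 1) ` Mod L1 L2 e = Mod (smul 1 L1) (smul 1 L2) 0"
    using flag_isoI[OF NF(2-4) K_0 K_1 one_neq_zero K_1 one_neq_zero] by metis
  then have "lin2 (mm (1, y, 0, 1) (mm (1, x, 0, 1) h)) ` M = L1 \<times> L2"
    by (simp only: lin2_image_mm NF(6) smul_1 Mod_0)
  moreover have "matK K (mm (1, y, 0, 1) (mm (1, x, 0, 1) h))"
    by (intro matK_mm h) (simp_all add: K_closed y NF)
  moreover have "det2 (mm (1, y, 0, 1) (mm (1, x, 0, 1) h)) \<noteq> 0" unfolding det2_mm using h(2) by simp
  ultimately show ?thesis using that NF(3) L2f L1 by blast
qed

text \<open>The line through \<open>m\<close> has conductor \<open>f\<close> as soon as \<open>(f / r) w m\<close> lies outside \<open>M\<close> for every prime \<open>r\<close>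
  dividing \<open>f\<close>. This condition only depends on \<open>m\<close> modulo \<open>r\<close>, so the Chinese remainder theorem applies.\<close>
lemma multiplier_line:
  assumes "kmod M" "mult2 M = Ord f" "f > 0"
  obtains p q where "p \<in> K" "q \<in> K" "(p, q) \<noteq> (0, 0)" "cond {t. (t * p, t * q) \<in> M} = f"
proof -
  have sM: "sgrp M" using assms(1) by (simp add: kmod_def)
  define sc where "sc = (\<lambda>(c::complex) (m::complex \<times> complex). (c * fst m, c * snd m))"
  have sc_of_int: "sc (of_int k) m \<in> M" if "m \<in> M" for k m
  proof -
    have "sgrp {t. sc t m \<in> M}" by (rule sgrp_vimage[OF sM]) (simp add: sc_def algebra_simps)
    from sgrp_of_int_mult[OF this, of 1 k] show ?thesis using that by (simp add: sc_def)
  qed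
  have sc_sc: "sc a (sc b m) = sc (a * b) m" for a b m by (simp add: sc_def mult.assoc)
  have fw: "sc (of_nat f * w) m \<in> M" if "m \<in> M" for m
    using that assms(2) Ord_of_nat_w[of f f] unfolding mult2_def sc_def by auto
  define S where "S = prime_factors f"
  have "\<forall>r\<in>S. \<exists>m\<in>M. sc (of_nat (f div r) * w) m \<notin> M"
  proof
    fix r assume r: "r \<in> S"
    then have r': "prime r" "r dvd f" by (auto simp: S_def)
    have "\<not> f dvd f div r" using r' assms(3) prime_gt_1_nat[of r]
      by (metis dvd_div_eq_0_iff div_less_dividend nat_dvd_not_less neq0_conv)
    then have "of_nat (f div r) * w \<notin> mult2 M" unfolding assms(2) Ord_of_nat_w .
    moreover have "of_nat (f div r) * w \<in> K" by (intro K_closed)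
    ultimately show "\<exists>m\<in>M. sc (of_nat (f div r) * w) m \<notin> M" unfolding mult2_def sc_def by blast
  qed
  then obtain mp where mp: "\<And>r. r \<in> S \<Longrightarrow> mp r \<in> M" "\<And>r. r \<in> S \<Longrightarrow> sc (of_nat (f div r) * w) (mp r) \<notin> M" by metis
  \<comment> \<open>Prime to \<open>r\<close> and divisible by all other primes of \<open>f\<close>,
    so modulo \<open>r\<close> the sum \<open>m\<close> only sees its term at
    \<open>r\<close>.\<close>
  define cf where "cf = (\<lambda>r. \<Prod>(S - {r}))"
  define m where "m = (\<Sum>r\<in>S. sc (of_nat (cf r)) (mp r))"
  have fS: "finite S" by (simp add: S_def)
  have mM: "m \<in> M" unfolding m_def
    by (rule sgrp_sum[OF sM]) (use sc_of_int[of _ "int (cf _)"] mp(1) in auto)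
  have nm: "sc (of_nat (f div r) * w) m \<notin> M" if r: "r \<in> S" for r
  proof
    assume a: "sc (of_nat (f div r) * w) m \<in> M"
    have rr: "prime r" "r dvd f" using r by (auto simp: S_def)
    have lin: "sc c (sum F T) = (\<Sum>t\<in>T. sc c (F t))" for c F and T :: "nat set"
    proof (induction T rule: infinite_finite_induct)
      case (insert x T)
      have "sc c (a + b) = sc c a + sc c b" for a b by (simp add: sc_def algebra_simps)
      then show ?case using insert by simp
    qed (simp_all add: sc_def zero_prod_def)
    have eq: "sc (of_nat (f div r) * w) m = sc (of_nat (f div r) * w) (sc (of_nat (cf r)) (mp r))
       + (\<Sum>t\<in>S-{r}. sc (of_nat (f div r) * w) (sc (of_nat (cf t)) (mp t)))"
      unfolding m_def lin using r fS by (simp add: sum.remove)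
    have rest: "(\<Sum>t\<in>S-{r}. sc (of_nat (f div r) * w) (sc (of_nat (cf t)) (mp t))) \<in> M"
    proof (rule sgrp_sum[OF sM])
      fix t assume t: "t \<in> S - {r}"
      then have "r dvd cf t" unfolding cf_def using r fS by (intro dvd_prodI) auto
      then obtain k where k: "cf t = r * k" by (rule dvdE)
      have "(of_nat (f div r) :: complex) * of_nat r = of_nat f" using rr by (metis dvd_div_mult_self of_nat_mult)
      then have "of_nat (f div r) * w * of_nat (cf t) = of_int (int k) * (of_nat f * w)"
        unfolding k by (simp add: mult_ac)
      then have "sc (of_nat (f div r) * w) (sc (of_nat (cf t)) (mp t)) = sc (of_int (int k)) (sc (of_nat f * w) (mp t))"
        by (simp only: sc_sc)
      then show "sc (of_nat (f div r) * w) (sc (of_nat (cf t)) (mp t)) \<in> M"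
        using sc_of_int fw mp t by (metis DiffD1)
    qed
    have "sc (of_nat (f div r) * w) (sc (of_nat (cf r)) (mp r)) \<in> M"
      using sgrp_diff[OF sM a rest] unfolding eq by (simp only: add_diff_cancel_right')
    then have 1: "sc (of_nat (cf r) * (of_nat (f div r) * w)) (mp r) \<in> M" by (simp add: sc_sc mult.commute)
    have "(of_nat r :: complex) * of_nat (f div r) = of_nat f" using rr by (metis dvd_mult_div_cancel of_nat_mult)
    then have 2: "sc (of_nat r * (of_nat (f div r) * w)) (mp r) \<in> M" using fw mp r by (simp add: mult.assoc[symmetric])
    have c: "coprime (cf r) r" unfolding cf_def
      by (rule prod_coprime_left) (use rr in \<open>auto simp: S_def intro!: primes_coprime in_prime_factors_imp_prime\<close>)
    have V: "sgrp {t. sc t (mp r) \<in> M}" by (rule sgrp_vimage[OF sM]) (simp add: sc_def algebra_simps)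
    have "of_nat (f div r) * w \<in> {t. sc t (mp r) \<in> M}"
      by (rule sgrp_coprime_combine[OF V c]) (simp_all only: mem_Collect_eq 1 2)
    then show False using mp(2)[OF r] by simp
  qed
  \<comment> \<open>The sum can vanish only if \<open>f\<close> has no prime factor; the condition
    is then empty and any nonzero vector will do.\<close>
  have "\<exists>m\<in>M. m \<noteq> (0, 0) \<and> (\<forall>r\<in>S. sc (of_nat (f div r) * w) m \<notin> M)"
  proof (cases "m = (0, 0)")
    case False
    then show ?thesis using mM nm by blast
  next
    case True
    then have "S = {}" using nm sgrp_0[OF sM] by (auto simp: sc_def zero_prod_def)
    obtain A where A: "klat A" "A \<times> A \<subseteq> M" using assms(1) by (auto simp: kmod_def)
    obtain a where "a \<in> A" "a \<noteq> 0" using klat_nonzero[OF A(1)] .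
    then show ?thesis using A \<open>S = {}\<close> by (intro bexI[of _ "(a, a)"]) auto
  qed
  then obtain p q where pq: "(p, q) \<in> M" "(p, q) \<noteq> (0, 0)" "\<forall>r\<in>S. sc (of_nat (f div r) * w) (p, q) \<notin> M" by auto
  have pqK: "p \<in> K" "q \<in> K" using pq kmod_K[OF assms(1)] by auto
  define L where "L = {t. (t * p, t * q) \<in> M}"
  have L: "klat L" unfolding L_def using klat_line assms pqK pq by blast
  have 1: "1 \<in> L" using pq by (simp add: L_def)
  have "cond L dvd f"
  proof (rule cond_dvdI[OF L])
    fix r x assume r: "r \<in> Ord f" and x: "x \<in> L"
    have "r \<in> mult2 M" using r assms by simp
    moreover have "(x * p, x * q) \<in> M" using x by (simp add: L_def)
    ultimately show "r * x \<in> L" unfolding mult2_def L_def by (force simp: mult.assoc)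
  qed
  moreover have "cond L = f"
  proof (rule ccontr)
    assume ne: "cond L \<noteq> f"
    \<comment> \<open>A proper divisor of \<open>f\<close> divides \<open>f div r\<close> for some
      prime \<open>r\<close>, against the choice of the vector, which corresponds to 1 in
      \<open>L\<close>.\<close>
    obtain k where k: "f = cond L * k" using \<open>cond L dvd f\<close> by (rule dvdE)
    then have "k \<noteq> 1" using ne by auto
    then obtain r where r: "prime r" "r dvd k" using prime_factor_nat by blast
    then have "r \<in> S" using k assms(3) by (auto simp: S_def prime_factors_dvd)
    have "cond L dvd f div r" using k r by (metis div_mult_swap dvd_triv_left)
    then have "of_nat (f div r) * w \<in> Ord (cond L)" by (simp only: Ord_of_nat_w)
    then have "of_nat (f div r) * w * 1 \<in> L" using 1 by (rule mult_mem_lat[OF L])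
    then show False using pq(3) \<open>r \<in> S\<close> by (simp add: L_def sc_def)
  qed
  ultimately show ?thesis using that pqK pq(2) by (simp add: L_def)
qed

text \<open>Two coordinates leave room to separate the bad primes: \<alpha> makes \<open>A\<close>
  equal to its order away from \<open>k\<close>, and \<beta> makes \<open>B\<close> equal to its
  order away from \<open>j\<close>, with \<open>j\<close> prime to \<open>k\<close>. An element of
  both lies first in \<open>Ord (cond B)\<close>; then its multiples by \<open>k\<close> and by
  \<open>f\<close> lie in \<open>Ord f\<close>, and these are coprime.\<close>

lemma principal_line:
  assumes "klat A" "klat B" "cond B dvd cond A"
  obtains p q where "p \<in> K" "q \<in> K" "(p, q) \<noteq> (0, 0)" "{t. (t * p, t * q) \<in> A \<times> B} = Ord (cond A)"
proof -
  define f where "f = cond A"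
  have f: "f > 0" using cond_pos assms f_def by simp
  obtain \<alpha> k where \<alpha>: "\<alpha> \<in> A" "\<alpha> \<noteq> 0" "k > 0" "coprime k f"
    "Ord f \<subseteq> smul (1 / \<alpha>) A" "\<And>x. x \<in> smul (1 / \<alpha>) A \<Longrightarrow> of_nat k * x \<in> Ord f"
    using coprime_generator[OF assms(1) f] unfolding f_def by metis
  obtain \<beta> j where \<beta>: "\<beta> \<in> B" "\<beta> \<noteq> 0" "j > 0" "coprime j k"
    "Ord (cond B) \<subseteq> smul (1 / \<beta>) B" "\<And>x. x \<in> smul (1 / \<beta>) B \<Longrightarrow> of_nat j * x \<in> Ord (cond B)"
    using coprime_generator[OF assms(2) \<alpha>(3)] by metis
  have m: "t * \<alpha> \<in> A \<longleftrightarrow> t \<in> smul (1 / \<alpha>) A" "t * \<beta> \<in> B \<longleftrightarrow> t \<in> smul (1 / \<beta>) B" for t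
    using \<alpha> \<beta> by (simp_all add: in_smul_iff)
  have "{t. (t * \<alpha>, t * \<beta>) \<in> A \<times> B} = Ord f"
  proof (intro set_eqI iffI)
    fix t assume "t \<in> Ord f"
    moreover have "Ord f \<subseteq> Ord (cond B)" using assms(3) by (intro Ord_mono) (simp add: f_def)
    ultimately show "t \<in> {t. (t * \<alpha>, t * \<beta>) \<in> A \<times> B}" using \<alpha>(5) \<beta>(5) m by auto
  next
    fix t assume "t \<in> {t. (t * \<alpha>, t * \<beta>) \<in> A \<times> B}"
    then have t: "t \<in> smul (1 / \<alpha>) A" "t \<in> smul (1 / \<beta>) B" using m by auto
    have 1: "of_nat k * t \<in> Ord f" using \<alpha>(6)[OF t(1)] .
    then have kt: "of_nat k * t \<in> Ord (cond B)" using Ord_mono[OF assms(3)] by (auto simp: f_def)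
    have "t \<in> Ord (cond B)" by (rule sgrp_coprime_combine[OF sgrp_Ord \<beta>(4) \<beta>(6)[OF t(2)] kt])
    then have "of_nat f * t \<in> Ord (f * cond B)" by (rule of_nat_mult_Ord)
    then have "of_nat f * t \<in> Ord f" using Ord_mono[of f "f * cond B"] by auto
    then show "t \<in> Ord f" by (rule sgrp_coprime_combine[OF sgrp_Ord \<alpha>(4) 1])
  qed
  moreover have "\<alpha> \<in> K" "\<beta> \<in> K" using \<alpha>(1) \<beta>(1) klat_K[OF assms(1)] klat_K[OF assms(2)] by blast+
  ultimately show ?thesis using that[of \<alpha> \<beta>] \<alpha> unfolding f_def by simp
qed

lemma mult2_Times:
  assumes "klat A" "klat B" shows "mult2 (A \<times> B) = Ord (lcm (cond A) (cond B))"
proof -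
  have "rel_order (lprod A B) 0 1" using sgrp_0[OF sgrp_lprod] rel_order_1_iff[OF sgrp_lprod] by blast
  from mult2_Mod[OF assms K_0 this] show ?thesis by (simp add: Mod_0)
qed

lemma ddet_Times: "klat A \<Longrightarrow> klat B \<Longrightarrow> ddet (A \<times> B) = lprod A B"
  using ddet_Mod[of A B 0] by (simp add: Mod_0 adj_0 sgrp_lprod)

text \<open>Splitting along a line of conductor \<open>f\<close> gives a product, and a second line
  in this product meets it in \<open>Ord f\<close> itself. After splitting again the complement is
  absorbed by \<open>Ord f\<close>, so it equals the lattice of determinants up to a scalar.\<close>

lemma steinitz:
  assumes "kmod M" "mult2 M = Ord f" "f > 0"
  shows "iso2 M (Ord f \<times> ddet M)"
proof -
  obtain p q where pq: "p \<in> K" "q \<in> K" "(p, q) \<noteq> (0, 0)" "cond {t. (t * p, t * q) \<in> M} = f"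
    using multiplier_line[OF assms] .
  obtain g B where g: "matK K g" "det2 g \<noteq> 0" "klat B" "cond B dvd f"
    "lin2 g ` M = {t. (t * p, t * q) \<in> M} \<times> B"
    using split_line[OF assms(1,2) pq] .
  define A where "A = {t. (t * p, t * q) \<in> M}"
  have A: "klat A" "cond A = f" using klat_line[OF assms(1) pq(1-3)] pq(4) by (simp_all add: A_def)
  have gM: "lin2 g ` M = A \<times> B" using g(5) by (simp add: A_def)
  have "cond B dvd cond A" using g(4) A(2) by simp
  then obtain r s where rs: "r \<in> K" "s \<in> K" "(r, s) \<noteq> (0, 0)" "{t. (t * r, t * s) \<in> A \<times> B} = Ord f"
    using principal_line[OF A(1) g(3)] unfolding A(2) by blast
  have "mult2 (A \<times> B) = Ord f" unfolding gM[symmetric] mult2_lin2[OF g(2)] by (rule assms(2))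
  moreover have "cond {t. (t * r, t * s) \<in> A \<times> B} = f" using rs(4) cond_Ord assms(3) by simp
  ultimately obtain h C where h: "matK K h" "det2 h \<noteq> 0" "klat C" "cond C dvd f" "lin2 h ` (A \<times> B) = Ord f \<times> C"
    using split_line[OF kmod_Times[OF A(1) g(3)] _ rs(1-3)] rs(4) by metis
  define G where "G = mm h g"
  have G: "det2 G \<noteq> 0" "lin2 G ` M = Ord f \<times> C" using g h gM by (simp_all add: G_def det2_mm lin2_image_mm)
  have "smul (det2 G) (ddet M) = lprod (Ord f) C"
    unfolding ddet_lin2[OF G(1), symmetric] G(2) by (rule ddet_Times[OF klat_Ord[OF assms(3)] h(3)])
  also have "\<dots> = C" using h by (simp add: lprod_Ord_absorb)
  finally have C: "C = smul (det2 G) (ddet M)" by simp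
  have "lin2 (1, 0, 0, 1 / det2 G) ` (Ord f \<times> C) = Ord f \<times> ddet M"
  proof -
    have "lin2 (1, 0, 0, 1 / det2 G) ` (Ord f \<times> C) = Ord f \<times> smul (1 / det2 G) C"
      by (auto simp: smul_def image_iff)
    then show ?thesis using G(1) by (simp add: C)
  qed
  then have "lin2 (mm (1, 0, 0, 1 / det2 G) G) ` M = Ord f \<times> ddet M" using G by (simp only: lin2_image_mm)
  moreover have "det2 (mm (1, 0, 0, 1 / det2 G) G) \<noteq> 0" using G(1) by (simp add: det2_mm)
  ultimately show ?thesis by (intro iso2_I)
qed

lemma steinitz_iso:
  assumes "kmod M" "kmod M'" "mult2 M = Ord f" "mult2 M' = Ord f" "f > 0" "ddet M = ddet M'"
  shows "iso2 M M'"
  using steinitz[OF assms(1,3,5)] steinitz[OF assms(2,4,5)] assms(6) iso2_sym iso2_trans by metis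

lemma kmod_Mod:
  assumes "klat L1" "klat L2" "e \<in> K" shows "kmod (Mod L1 L2 e)"
proof (cases "e = 0")
  case True
  then show ?thesis using kmod_Times assms by (simp add: Mod_0)
next
  case False
  define y where "y = e / eps L2"
  have y: "y \<in> K" "y \<noteq> 0" using False eps_nz[OF assms(2)] by (auto simp: y_def intro!: K_divide assms eps_K)
  have s: "sgrp L1" "sgrp L2" using assms klat_sgrp by auto
  have yb: "klat (smul y (cnj ` L2))" using y assms by (intro klat_smul klat_cnj)
  obtain B where B: "klat B" "L1 \<subseteq> B" "L2 \<subseteq> B" using klat_sum[OF assms(1,2)] .
  obtain C where C: "klat C" "B \<subseteq> C" "smul y (cnj ` L2) \<subseteq> C" using klat_sum[OF B(1) yb] .
  \<comment> \<open>The last factor ensures that the conjugate-linear term maps \<open>A\<close>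
    into \<open>L1\<close>.\<close>
  define A where "A = (L1 \<inter> L2) \<inter> smul (1 / cnj y) (cnj ` L1)"
  have A: "klat A" unfolding A_def using y assms by (intro klat_Int klat_smul klat_cnj K_closed) auto
  have "A \<times> A \<subseteq> Mod L1 L2 e"
  proof (clarify)
    fix a b assume "a \<in> A" "b \<in> A"
    then have *: "a \<in> L1" "b \<in> L2" "b * cnj y \<in> cnj ` L1" using y by (auto simp: A_def in_smul_iff)
    then have "cnj (b * cnj y) \<in> L1" by (metis (no_types, lifting) complex_cnj_cnj imageE)
    then show "(a, b) \<in> Mod L1 L2 e" using * sgrp_diff[OF s(1)] by (simp add: Mod_iff y_def[symmetric] mult.commute)
  qed
  moreover have "Mod L1 L2 e \<subseteq> C \<times> C"
    unfolding Mod_def y_def[symmetric] using B C klat_sgrp[OF C(1)]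
    by (auto intro!: sgrp_add smul_memI[THEN subsetD[OF C(3)]])
  moreover have "sgrp (Mod L1 L2 e)"
    unfolding sgrp_def
  proof (intro conjI ballI)
    show "0 \<in> Mod L1 L2 e" using s by (simp add: zero_prod_def Mod_iff sgrp_0)
    fix p q assume pq: "p \<in> Mod L1 L2 e" "q \<in> Mod L1 L2 e"
    obtain a b a' b' where [simp]: "p = (a, b)" "q = (a', b')" by (cases p; cases q)
    have "(a - y * cnj b) - (a' - y * cnj b') \<in> L1" "b - b' \<in> L2"
      using pq s by (auto simp: Mod_iff y_def[symmetric] intro!: sgrp_diff)
    moreover have "(a - y * cnj b) - (a' - y * cnj b') = (a - a') - y * cnj (b - b')" by (simp add: algebra_simps)
    ultimately show "p - q \<in> Mod L1 L2 e" by (simp add: Mod_iff y_def[symmetric])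
  qed
  ultimately show ?thesis unfolding kmod_def using A C(1) by blast
qed

end

section \<open>Counting\<close>

text \<open>A bijection in relational form suits orbits and classes whose data exist only after
  choices of representatives.\<close>

lemma card_eq_if_rel:
  assumes "\<And>a. a \<in> A \<Longrightarrow> \<exists>b\<in>B. R a b" "\<And>b. b \<in> B \<Longrightarrow> \<exists>a\<in>A. R a b"
    and "\<And>a b b'. a \<in> A \<Longrightarrow> b \<in> B \<Longrightarrow> b' \<in> B \<Longrightarrow> R a b \<Longrightarrow> R a b' \<Longrightarrow> b = b'"
    and "\<And>a a' b. a \<in> A \<Longrightarrow> a' \<in> A \<Longrightarrow> b \<in> B \<Longrightarrow> R a b \<Longrightarrow> R a' b \<Longrightarrow> a = a'"
  shows "card A = card B"
proof -
  obtain f where f: "\<And>a. a \<in> A \<Longrightarrow> f a \<in> B \<and> R a (f a)" using assms(1) by metis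
  have "inj_on f A" using f assms(4) by (metis inj_onI)
  moreover have "f ` A = B"
  proof (intro equalityI subsetI)
    fix b assume "b \<in> B"
    then obtain a where "a \<in> A" "R a b" using assms(2) by blast
    then have "f a = b" using f assms(3) \<open>b \<in> B\<close> by blast
    then show "b \<in> f ` A" using \<open>a \<in> A\<close> by blast
  qed (use f in auto)
  ultimately show ?thesis using card_image[of f A] by simp
qed

text \<open>Each prime power of \<open>m\<close> goes entirely to \<open>x\<close> or entirely to
  \<open>y\<close>, so the set of primes of \<open>x\<close> is arbitrary and determines the
  factorization.\<close>

lemma card_coprime_factorizations:
  assumes "m > 0"
  shows "card {(x, y). coprime x y \<and> x * y = m} = 2 ^ omega (m::nat)"
proof -
  let ?A = "{(x, y). coprime x y \<and> x * y = m}"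
  have "card ?A = card (Pow (prime_factors m))"
  proof (rule card_eq_if_rel[where R = "\<lambda>a S. S = prime_factors (fst a)"])
    fix a assume "a \<in> ?A"
    then show "\<exists>S\<in>Pow (prime_factors m). S = prime_factors (fst a)"
      using assms by (auto simp: prime_factors_dvd)
  next
    fix S assume S: "S \<in> Pow (prime_factors m)"
    define x where "x = (\<Prod>p\<in>S. p ^ multiplicity p m)"
    define y where "y = (\<Prod>p\<in>prime_factors m - S. p ^ multiplicity p m)"
    have fin: "finite S" using S finite_subset by auto
    have pr: "prime p" if "p \<in> prime_factors m" for p using that by auto
    have "m = (\<Prod>p\<in>prime_factors m. p ^ multiplicity p m)"
      using assms by (intro prime_factorization_nat) simp
    also have "\<dots> = x * y" unfolding x_def y_def using S by (subst prod.subset_diff[of S]) (auto simp: mult.commute)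
    finally have xy: "x * y = m" by simp
    have cop: "coprime x y" unfolding x_def y_def
    proof (intro prod_coprime_left prod_coprime_right)
      fix p q assume "p \<in> S" "q \<in> prime_factors m - S"
      then have "coprime p q" using S by (intro primes_coprime pr) auto
      then show "coprime (p ^ multiplicity p m) (q ^ multiplicity q m)" by simp
    qed
    have "prime_factors x = S"
    proof (intro equalityI subsetI)
      fix p assume p: "p \<in> prime_factors x"
      then have "prime p" "p dvd x" by auto
      then have "\<exists>q\<in>S. p dvd q ^ multiplicity q m"
        unfolding x_def using prime_dvd_prod_iff[OF fin, of p "\<lambda>q. q ^ multiplicity q m"] by simp
      then obtain q where q: "q \<in> S" "p dvd q ^ multiplicity q m" by blast
      then have "p dvd q" using \<open>prime p\<close> prime_dvd_power by blast
      then have "p = q" using \<open>prime p\<close> pr q S by (meson Pow_iff primes_dvd_imp_eq subset_iff)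
      then show "p \<in> S" using q by simp
    next
      fix p assume p: "p \<in> S"
      then have p': "prime p" "p dvd m" using S by auto
      have "multiplicity p m > 0" using p' assms by (simp add: prime_multiplicity_gt_zero_iff)
      then have "p dvd p ^ multiplicity p m" by (simp add: dvd_power)
      then have "p dvd x" unfolding x_def using p fin by (meson dvd_prodI dvd_trans)
      moreover have "x \<noteq> 0" using xy assms by auto
      ultimately show "p \<in> prime_factors x" using p' by (simp add: prime_factors_dvd)
    qed
    then show "\<exists>a\<in>?A. S = prime_factors (fst a)" using xy cop by (intro bexI[of _ "(x, y)"]) auto
  next
    fix a a' S assume a: "a \<in> ?A" "a' \<in> ?A" "S = prime_factors (fst a)" "S = prime_factors (fst a')"
    have mult: "multiplicity p x = (if p \<in> prime_factors x then multiplicity p m else 0)"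
      if "coprime x y" "x * y = m" "prime p" for x y p :: nat
    proof (cases "p \<in> prime_factors x")
      case True
      then have "p dvd x" by auto
      then have "\<not> p dvd y" using that by (metis coprime_common_divisor not_prime_unit)
      then have "multiplicity p y = 0" by (rule not_dvd_imp_multiplicity_0)
      moreover have "x \<noteq> 0" "y \<noteq> 0" using that assms by auto
      ultimately have "multiplicity p m = multiplicity p x"
        using that prime_elem_multiplicity_mult_distrib[of p x y] by auto
      then show ?thesis using True by simp
    next
      case False
      moreover have "x \<noteq> 0" using that assms by auto
      ultimately have "\<not> p dvd x" using that by (simp add: prime_factors_dvd)
      then show ?thesis using False not_dvd_imp_multiplicity_0 by auto
    qed
    obtain x y x' y' where [simp]: "a = (x, y)" "a' = (x', y')" by (cases a; cases a')
    have "x > 0" "x' > 0" using a assms by (auto intro!: Nat.gr0I)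
    have pf: "prime_factors x = prime_factors x'" using a(3,4) by simp
    have c: "coprime x y" "x * y = m" "coprime x' y'" "x' * y' = m" using a(1,2) by simp_all
    have xx: "x = x'"
    proof (rule multiplicity_eq_nat)
      fix p :: nat assume "prime p"
      from mult[OF c(1,2) this] mult[OF c(3,4) this] show "multiplicity p x = multiplicity p x'"
        unfolding pf by (rule trans[OF _ sym])
    qed fact+
    then have "y = y'" using a \<open>x > 0\<close> by auto
    then show "a = a'" using xx by simp
  qed auto
  also have "\<dots> = 2 ^ omega m" by (simp add: card_Pow omega_def)
  finally show ?thesis .
qed

lemma card_lcm_gcd_pairs:
  assumes "g dvd l" "l > (0::nat)"
  shows "card {(a, b). lcm a b = l \<and> gcd a b = g} = 2 ^ omega (l div g)"
proof -
  obtain m where m: "l = g * m" using assms(1) by (rule dvdE)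
  have pos: "g > 0" "m > 0" using assms m by auto
  have "{(a, b). lcm a b = l \<and> gcd a b = g} = (\<lambda>(x, y). (g * x, g * y)) ` {(x, y). coprime x y \<and> x * y = m}"
  proof (intro equalityI subsetI)
    fix p assume "p \<in> {(a, b). lcm a b = l \<and> gcd a b = g}"
    then obtain a b where p: "p = (a, b)" "lcm a b = l" "gcd a b = g" by auto
    have "gcd a b \<noteq> 0" using p pos by simp
    then obtain x y where "a = x * gcd a b" "b = y * gcd a b" "coprime x y"
      using gcd_coprime_exists by blast
    then have xy: "a = g * x" "b = g * y" "coprime x y" using p(3) by (simp_all add: mult.commute)
    have "l * g = a * b" unfolding p(2,3)[symmetric] by simp
    then have "g * g * (x * y) = g * g * m" unfolding xy m by (simp only: mult_ac)
    then have "x * y = m" using pos by simp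
    then show "p \<in> (\<lambda>(x, y). (g * x, g * y)) ` {(x, y). coprime x y \<and> x * y = m}"
      using xy p by (auto intro!: image_eqI[of _ _ "(x, y)"])
  next
    fix p assume "p \<in> (\<lambda>(x, y). (g * x, g * y)) ` {(x, y). coprime x y \<and> x * y = m}"
    then obtain x y where xy: "p = (g * x, g * y)" "coprime x y" "x * y = m" by auto
    have "gcd (g * x) (g * y) = g" using xy by (simp add: gcd_mult_left)
    moreover have "lcm (g * x) (g * y) = l" using xy m by (simp add: lcm_mult_left lcm_coprime)
    ultimately show "p \<in> {(a, b). lcm a b = l \<and> gcd a b = g}" using xy by simp
  qed
  moreover have "inj_on (\<lambda>(x, y). (g * x, g * y)) {(x, y). coprime x y \<and> x * y = m}"
    using pos by (auto simp: inj_on_def)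
  ultimately have "card {(a, b). lcm a b = l \<and> gcd a b = g} = card {(x, y). coprime x y \<and> x * y = m}"
    by (simp add: card_image)
  also have "\<dots> = 2 ^ omega m" using pos by (intro card_coprime_factorizations)
  finally show ?thesis using m pos by simp
qed

text \<open>The union of the cosets of \<open>e\<close> and of \<open>- e\<close>, a canonical
  object for a class up to sign.\<close>

definition pm_coset :: "complex set \<Rightarrow> complex \<Rightarrow> complex set" where
  "pm_coset P e = {x. x - e \<in> P \<or> x + e \<in> P}"

lemma pm_coset_eq_iff:
  assumes "sgrp P" shows "pm_coset P e = pm_coset P e' \<longleftrightarrow> e - e' \<in> P \<or> e + e' \<in> P"
proof
  assume "pm_coset P e = pm_coset P e'"
  moreover have "e \<in> pm_coset P e" using sgrp_0[OF assms] by (simp add: pm_coset_def)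
  ultimately show "e - e' \<in> P \<or> e + e' \<in> P" by (auto simp: pm_coset_def)
next
  assume *: "e - e' \<in> P \<or> e + e' \<in> P"
  have sym: "x - e' \<in> P \<or> x + e' \<in> P" if x: "x - e \<in> P \<or> x + e \<in> P" and *: "e - e' \<in> P \<or> e + e' \<in> P" for x e e'
    using x *
  proof (elim disjE)
    assume "x - e \<in> P" "e - e' \<in> P"
    from sgrp_add[OF assms this] show ?thesis by simp
  next
    assume "x - e \<in> P" "e + e' \<in> P"
    from sgrp_add[OF assms this] show ?thesis by simp
  next
    assume "x + e \<in> P" "e - e' \<in> P"
    from sgrp_diff[OF assms this] show ?thesis by simp
  next
    assume "x + e \<in> P" "e + e' \<in> P"
    from sgrp_diff[OF assms this] show ?thesis by simp
  qed
  have "e' - e \<in> P \<or> e' + e \<in> P" using * sgrp_uminus[OF assms, of "e - e'"] by (auto simp: add.commute)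
  then show "pm_coset P e = pm_coset P e'" using * sym[of _ e e'] sym[of _ e' e] unfolding pm_coset_def by blast
qed

lemma card_eq_mult_fibres:
  assumes "finite A" "\<And>x. x \<in> A \<Longrightarrow> card {y \<in> A. f y = f x} = c"
  shows "card A = c * card (f ` A)"
proof -
  have "card A = (\<Sum>y\<in>f ` A. card {x \<in> A. f x = y})"
    using sum.image_gen[OF assms(1), of "\<lambda>_. 1 :: nat" f] by (simp only: card_eq_sum)
  also have "\<dots> = (\<Sum>y\<in>f ` A. c)" by (rule sum.cong) (use assms(2) in auto)
  finally show ?thesis by simp
qed

text \<open>The generators of the cyclic quotient are the multiples \<open>j * e0\<close> with
  \<open>j\<close> prime to \<open>n\<close>. For \<open>n > 2\<close> the classes of
  \<open>j\<close> and \<open>n - j\<close> are distinct and give the same value, so the fibres have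
  two elements; for \<open>n \<le> 2\<close> there is a single class.\<close>

lemma card_generator_classes:
  assumes P: "sgrp P" and n: "n > 0" and b: "b = adj P e0" and r: "rel_order P e0 n"
  shows "card {pm_coset P e | e. adj P e = b \<and> rel_order P e n} = phi_u n"
proof -
  define F where "F = (\<lambda>j::nat. pm_coset P (of_nat j * e0))"
  have ri: "of_int k * e0 \<in> P \<longleftrightarrow> int n dvd k" for k using rel_order_int[OF P r] .
  have Feq: "F i = F j \<longleftrightarrow> int n dvd int i - int j \<or> int n dvd int i + int j" for i j
  proof -
    have "of_nat i * e0 - of_nat j * e0 = of_int (int i - int j) * e0"
      "of_nat i * e0 + of_nat j * e0 = of_int (int i + int j) * e0" by (simp_all add: algebra_simps)
    then show ?thesis unfolding F_def pm_coset_eq_iff[OF P] by (simp only: ri)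
  qed
  have gen: "adj P e = b \<and> rel_order P e n" if j: "coprime j n" and e: "e - of_nat j * e0 \<in> P" for j e
  proof
    obtain a c :: int where ac: "a * int j + c * int n = 1" using coprime_bezout[OF j] .
    have ne: "of_int (c * int n) * e0 \<in> P" by (simp only: ri) simp
    show "adj P e = b" unfolding b
    proof (intro equalityI adj_least sgrp_adj P adj_subset)
      show "e \<in> adj P e0" using e by (intro adj_memI[of _ "e - of_nat j * e0" "int j"]) simp_all
      have "e0 = of_int (a * int j + c * int n) * e0" unfolding ac by simp
      then have "e0 = (of_int (c * int n) * e0 - of_int a * (e - of_nat j * e0)) + of_int a * e"
        by (simp add: algebra_simps)
      then show "e0 \<in> adj P e" by (rule adj_memI) (intro sgrp_diff P ne sgrp_of_int_mult e)
    qed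
    show "rel_order P e n" unfolding rel_order_def
    proof
      fix k
      have "of_nat k * e = of_nat k * (e - of_nat j * e0) + of_int (int (k * j)) * e0" by (simp add: algebra_simps)
      then have "of_nat k * e \<in> P \<longleftrightarrow> of_int (int (k * j)) * e0 \<in> P"
        using sgrp_add_iff[OF P sgrp_of_nat_mult[OF P e]] by metis
      also have "\<dots> \<longleftrightarrow> n dvd k * j" by (simp only: ri int_dvd_int_iff)
      also have "\<dots> \<longleftrightarrow> n dvd k" using j by (simp add: coprime_dvd_mult_left_iff coprime_commute)
      finally show "of_nat k * e \<in> P \<longleftrightarrow> n dvd k" .
    qed
  qed
  have "{pm_coset P e | e. adj P e = b \<and> rel_order P e n} = F ` totatives n"
  proof (intro equalityI subsetI)
    fix Q assume "Q \<in> {pm_coset P e | e. adj P e = b \<and> rel_order P e n}"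
    then obtain e where e: "Q = pm_coset P e" "adj P e = b" "rel_order P e n" by blast
    have "e \<in> b" using adj_self[OF P] e(2) by blast
    then obtain x k where xk: "e = x + of_int k * e0" "x \<in> P" unfolding b by (rule adj_memE)
    \<comment> \<open>Totatives are taken in the range from 1 to \<open>n\<close>, so for
      \<open>n = 1\<close> the residue 0 is replaced by 1.\<close>
    define j where "j = (if n = 1 then 1 else nat (k mod int n))"
    have kj: "int n dvd k - int j"
    proof (cases "n = 1")
      case False
      then have "int j = k mod int n" using n by (simp add: j_def)
      then show ?thesis by (simp add: dvd_minus_mod)
    qed simp
    have ej: "e - of_nat j * e0 \<in> P"
    proof -
      have "e - of_nat j * e0 = x + of_int (k - int j) * e0" by (simp add: xk algebra_simps)
      moreover have "of_int (k - int j) * e0 \<in> P" by (simp only: ri kj)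
      ultimately show ?thesis using xk(2) sgrp_add[OF P] by simp
    qed
    have cop: "coprime j n"
    proof -
      define d where "d = gcd j n"
      have d: "d dvd j" "d dvd n" "d > 0" using n by (simp_all add: d_def)
      have "n dvd (n div d) * j" using d by (metis div_mult_swap dvd_triv_left mult.commute)
      then have "of_int (int ((n div d) * j)) * e0 \<in> P" by (simp only: ri int_dvd_int_iff)
      moreover have "of_nat (n div d) * e = of_nat (n div d) * (e - of_nat j * e0) + of_int (int ((n div d) * j)) * e0"
        by (simp add: algebra_simps)
      ultimately have "of_nat (n div d) * e \<in> P" using sgrp_add[OF P sgrp_of_nat_mult[OF P ej]] by metis
      then have "n dvd n div d" using e(3) by (simp add: rel_order_def)
      moreover have "n div d > 0" using d n by (simp add: div_greater_zero_iff dvd_imp_le)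
      ultimately have "n \<le> n div d" by (rule dvd_imp_le)
      then have "\<not> 1 < d" using n div_less_dividend[of d n] by linarith
      then have "d = 1" using d(3) by simp
      then show ?thesis by (simp add: d_def coprime_iff_gcd_eq_1)
    qed
    have "j > 0 \<and> j \<le> n"
    proof (cases "n = 1")
      case False
      then have "j \<noteq> 0" using cop by (metis coprime_0_left_iff nat_dvd_1_iff_1)
      moreover have "j < n" using False n by (simp add: j_def nat_less_iff)
      ultimately show ?thesis by simp
    qed (simp add: j_def)
    then have "j \<in> totatives n" using cop by (simp add: totatives_def)
    moreover have "Q = F j" unfolding F_def e(1) using pm_coset_eq_iff[OF P] ej by blast
    ultimately show "Q \<in> F ` totatives n" by blast
  next
    fix Q assume "Q \<in> F ` totatives n"
    then obtain j where j: "j \<in> totatives n" "Q = F j" by blast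
    have "of_nat j * e0 - of_nat j * e0 \<in> P" using sgrp_0[OF P] by simp
    then have "adj P (of_nat j * e0) = b \<and> rel_order P (of_nat j * e0) n"
      using gen[of j] j by (simp add: totatives_def)
    then show "Q \<in> {pm_coset P e | e. adj P e = b \<and> rel_order P e n}" unfolding j(2) F_def by blast
  qed
  moreover have "card (F ` totatives n) = phi_u n"
  proof (cases "n \<le> 2")
    case True
    then have "n = 1 \<or> n = 2" using n by auto
    then have "totatives n = {1}"
    proof
      assume "n = 2"
      then have "x \<in> totatives n \<longleftrightarrow> x = 1" for x
        by (cases "x = 0"; cases "x = 1"; cases "x = 2") (auto simp: totatives_def)
      then show ?thesis by auto
    qed (simp add: totatives_1)
    then show ?thesis using True by (simp add: phi_u_def)
  next
    case False
    have "card (totatives n) = 2 * card (F ` totatives n)"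
    proof (rule card_eq_mult_fibres)
      fix x assume x: "x \<in> totatives n"
      then have x': "0 < x" "x \<le> n" "coprime x n" by (auto simp: totatives_def)
      have xn: "x \<noteq> n" using x' False by auto
      have "{y \<in> totatives n. F y = F x} = {x, n - x}"
      proof (intro equalityI subsetI)
        fix y assume "y \<in> {y \<in> totatives n. F y = F x}"
        then have y: "0 < y" "y \<le> n" "coprime y n" "int n dvd int y - int x \<or> int n dvd int y + int x"
          by (auto simp: totatives_def Feq)
        have yn: "y \<noteq> n" using y False by auto
        from y(4) show "y \<in> {x, n - x}"
        proof
          assume d: "int n dvd int y - int x"
          have "\<bar>int y - int x\<bar> < int n" using x' y by auto
          then have "int y - int x = 0" using d by (metis abs_of_nat dvd_imp_le_int leD)
          then show ?thesis by simp
        next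
          assume "int n dvd int y + int x"
          then have "n dvd y + x" by (simp flip: of_nat_add)
          then obtain k where k: "y + x = n * k" by (rule dvdE)
          have "y < n" "x < n" using x' y(1,2) xn yn by auto
          then have "n * k < n * 2" using k by linarith
          then have "k < 2" by simp
          moreover have "k \<noteq> 0" using k x' by (auto intro!: Nat.gr0I)
          ultimately have "k = 1" by simp
          then show ?thesis using k x' by auto
        qed
      next
        fix y assume "y \<in> {x, n - x}"
        then consider "y = x" | "y = n - x" by blast
        then show "y \<in> {y \<in> totatives n. F y = F x}"
        proof cases
          case 2
          have "coprime (n - x) n" using x' by (metis coprime_commute coprime_diff_one_left_nat diff_diff_cancel gcd_diff2_nat coprime_iff_gcd_eq_1 gcd.commute)
          then show ?thesis using 2 x' xn by (auto simp: totatives_def Feq of_nat_diff)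
        qed (use x in auto)
      qed
      moreover have "x \<noteq> n - x"
      proof
        assume "x = n - x"
        then have "n = 2 * x" using x' by simp
        then have "x dvd 1" using x'(3) by (metis coprime_common_divisor dvd_refl dvd_triv_right)
        then show False using \<open>n = 2 * x\<close> False by simp
      qed
      ultimately show "card {y \<in> totatives n. F y = F x} = 2" by simp
    qed simp
    then show ?thesis using False by (simp add: phi_u_def totient_def)
  qed
  ultimately show ?thesis by simp
qed

lemma zspan_coeff_unique:
  assumes "Im (cnj u * v) \<noteq> 0" "of_int a * u + of_int b * v = of_int a' * u + of_int b' * v"
  shows "a = a' \<and> b = b'"
proof -
  have e: "of_int (a - a') * u + of_int (b - b') * v = 0" using assms(2) by (simp add: algebra_simps)
  have "R_indep u v" using assms(1) by (simp add: R_indep_complex)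
  moreover have "(of_int (a - a') :: real) *\<^sub>R u + (of_int (b - b') :: real) *\<^sub>R v = 0"
    using e by (simp add: scaleR_conv_of_real)
  ultimately have "(of_int (a - a') :: real) = 0 \<and> (of_int (b - b') :: real) = 0"
    unfolding R_indep_def by blast
  then show ?thesis by simp
qed

text \<open>Such a subgroup is determined by the coefficient pairs modulo \<open>m\<close> that it
  contains.\<close>

lemma finite_intermediate_groups:
  assumes "m > 0" shows "finite {H. sgrp H \<and> smul (of_nat m) (zspan u v) \<subseteq> H \<and> H \<subseteq> zspan u v}"
    (is "finite ?S")
proof -
  define f where "f = (\<lambda>H. {(i, j). i \<in> {0..<int m} \<and> j \<in> {0..<int m} \<and> of_int i * u + of_int j * v \<in> H})"
  have m0: "int m \<noteq> 0" using assms by simp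
  have sub: "H \<subseteq> H'" if H: "H \<in> ?S" and H': "H' \<in> ?S" and f: "f H = f H'" for H H'
  proof
    fix x assume x: "x \<in> H"
    then have "x \<in> zspan u v" using H by auto
    then obtain i j where ij: "x = of_int i * u + of_int j * v" by (rule zspan_memE)
    define y where "y = of_int (i mod int m) * u + of_int (j mod int m) * v"
    define d where "d = of_nat m * (of_int (i div int m) * u + of_int (j div int m) * v)"
    have "of_int i = (of_int (i mod int m) + of_nat m * of_int (i div int m) :: complex)"
      "of_int j = (of_int (j mod int m) + of_nat m * of_int (j div int m) :: complex)"
      by (metis mod_mult_div_eq of_int_add of_int_mult of_int_of_nat_eq)+
    then have xy: "x = y + d" unfolding ij y_def d_def by (simp add: algebra_simps)
    have d: "d \<in> smul (of_nat m) (zspan u v)" unfolding d_def by (intro smul_memI zspan_memI)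
    then have "d \<in> H" "d \<in> H'" using H H' by auto
    then have "y \<in> H" using x xy H sgrp_diff[of H x d] by auto
    then have "(i mod int m, j mod int m) \<in> f H" using assms by (simp add: f_def y_def)
    then have "y \<in> H'" unfolding f by (simp add: f_def y_def)
    then show "x \<in> H'" using xy \<open>d \<in> H'\<close> H' sgrp_add[of H' y d] by auto
  qed
  have "inj_on f ?S"
  proof (rule inj_onI)
    fix H H' assume "H \<in> ?S" "H' \<in> ?S" "f H = f H'"
    then show "H = H'" using sub[of H H'] sub[of H' H] by blast
  qed
  moreover have "f ` ?S \<subseteq> Pow ({0..<int m} \<times> {0..<int m})" by (auto simp: f_def)
  then have "finite (f ` ?S)" by (rule finite_subset) simp
  ultimately show ?thesis by (rule finite_imageD[rotated])
qed

section \<open>Cyclic sublattices and overlattices\<close>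

context imag_quad
begin

text \<open>The products of the two graded pieces arise as sublattices of \<open>b\<close> in this
  sense, while the overlattices in \<open>super_lats\<close> are what \<open>r_K\<close>
  counts.\<close>

definition sub_lats :: "complex set \<Rightarrow> nat \<Rightarrow> nat \<Rightarrow> complex set set" where
  "sub_lats b n g = {P. klat P \<and> cond P = g \<and> (\<exists>e. b = adj P e \<and> rel_order P e n)}"

definition super_lats :: "complex set \<Rightarrow> nat \<Rightarrow> nat \<Rightarrow> complex set set" where
  "super_lats b n g = {L. klat L \<and> cond L = g \<and> (\<exists>z. L = adj b z \<and> rel_order b z n)}"

text \<open>If \<open>n z = i p + j q\<close> in a basis of \<open>H\<close> and \<open>x i + y j\<close> is \<open>1\<close> modulo \<open>n\<close>, then \<open>z' = x q - y p\<close> works.\<close>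
lemma cyclic_flip:
  assumes "klat H" "rel_order H z n" "n > 0"
  obtains z' where "H = adj (smul (of_nat n) (adj H z)) z'" "rel_order (smul (of_nat n) (adj H z)) z' n"
proof -
  have sH: "sgrp H" using assms(1) by (rule klat_sgrp)
  obtain p q where pq: "H = zspan p q" "Im (cnj p * q) / Im w > 0" using klat_basis[OF assms(1)] by metis
  then have ind: "Im (cnj p * q) \<noteq> 0" by auto
  have pqH: "p \<in> H" "q \<in> H" using zspan_basis pq by auto
  have nz: "of_nat n * z \<in> H" using assms(2) by (simp add: rel_order_def)
  obtain i j where ij: "of_nat n * z = of_int i * p + of_int j * q" using nz unfolding pq(1) by (rule zspan_memE)
  define d where "d = gcd (gcd i j) (int n)"
  \<comment> \<open>A common factor of \<open>i\<close>, \<open>j\<close> and \<open>n\<close> could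
    be cancelled, and a smaller multiple of \<open>z\<close> would lie in \<open>H\<close>.\<close>
  have "d = 1"
  proof -
    have d0: "d > 0" using assms(3) by (simp add: d_def)
    have dv: "d dvd i" "d dvd j" "d dvd int n" by (auto simp: d_def intro: dvd_trans[OF gcd_dvd1])
    obtain i' where i': "i = d * i'" using dv(1) by (rule dvdE)
    obtain j' where j': "j = d * j'" using dv(2) by (rule dvdE)
    obtain n' where n': "int n = d * n'" using dv(3) by (rule dvdE)
    have "(of_int d :: complex) * (of_int n' * z) = of_int (int n) * z" unfolding n' by simp
    also have "\<dots> = of_int d * (of_int i' * p + of_int j' * q)" using ij by (simp add: i' j' algebra_simps)
    finally have "of_int n' * z = of_int i' * p + of_int j' * q" using d0 by simp
    then have "of_int n' * z \<in> H" using zspan_memI pq(1) by simp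
    then have "int n dvd n'" using rel_order_int[OF sH assms(2)] by simp
    then have "d * n' dvd 1 * n'" using n' by simp
    moreover have "n' \<noteq> 0" using n' assms(3) by auto
    ultimately have "d dvd 1" using dvd_mult_cancel_right[of d n' 1] by simp
    then show ?thesis using d0 by simp
  qed
  obtain x' c where 1: "x' * gcd i j + c * int n = 1" using bezout_int[of "gcd i j" "int n"] \<open>d = 1\<close> d_def by auto
  obtain x'' y'' where 2: "x'' * i + y'' * j = gcd i j" using bezout_int by blast
  define x where "x = x' * x''"
  define y where "y = x' * y''"
  have xy: "x * i + y * j + c * int n = 1" unfolding x_def y_def using 1 unfolding 2[symmetric] by (simp add: algebra_simps)
  have xyc: "(of_int x * of_int i + of_int y * of_int j + of_int c * of_nat n :: complex) = 1"
    using arg_cong[OF xy, of "of_int :: int \<Rightarrow> complex"] by simp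
  define z' where "z' = of_int x * q - of_int y * p"
  define G where "G = smul (of_nat n) (adj H z)"
  have sG: "sgrp G" unfolding G_def by (intro sgrp_smul sgrp_adj sH)
  have HG: "of_nat n * h \<in> G" if "h \<in> H" for h
    unfolding G_def using adj_subset that by (blast intro: smul_memI)
  have zG: "of_nat n * z \<in> G" unfolding G_def using adj_self[OF sH] by (intro smul_memI)
  have z'H: "z' \<in> H" unfolding z'_def by (intro sgrp_diff sgrp_of_int_mult sH pqH)
  have G_rep: "\<exists>a b r. g = of_int (int n * a + r * i) * p + of_int (int n * b + r * j) * q" if g: "g \<in> G" for g
  proof -
    obtain h r where "h \<in> H" "g = of_nat n * (h + of_int r * z)" using g by (auto simp: G_def smul_def elim!: adj_memE)
    moreover obtain a b where "h = of_int a * p + of_int b * q" using \<open>h \<in> H\<close> unfolding pq(1) by (rule zspan_memE)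
    ultimately have "g = of_nat n * (of_int a * p + of_int b * q) + of_int r * (of_nat n * z)" by (simp add: algebra_simps)
    then have "g = of_int (int n * a + r * i) * p + of_int (int n * b + r * j) * q"
      unfolding ij by (simp add: algebra_simps)
    then show ?thesis by blast
  qed
  have "H = adj G z'"
  proof
    show "adj G z' \<subseteq> H"
    proof (rule adj_least[OF sH _ z'H])
      show "G \<subseteq> H" using G_rep zspan_memI pq(1) by blast
    qed
    have mem: "a + of_int k * z' \<in> adj G z'" if "a \<in> G" for a k using that by (blast intro: adj_memI)
    have "p = (of_int x * of_int i + of_int y * of_int j + of_int c * of_nat n) * p" unfolding xyc by simp
    also have "\<dots> = (of_int x * (of_nat n * z) + of_int c * (of_nat n * p)) + of_int (- j) * z'"
      unfolding ij z'_def by (simp add: algebra_simps)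
    finally have "p = (of_int x * (of_nat n * z) + of_int c * (of_nat n * p)) + of_int (- j) * z'" .
    moreover have "of_int x * (of_nat n * z) + of_int c * (of_nat n * p) \<in> G"
      by (intro sgrp_add sgrp_of_int_mult sG zG HG pqH)
    ultimately have p: "p \<in> adj G z'" by (rule adj_memI)
    have "q = (of_int x * of_int i + of_int y * of_int j + of_int c * of_nat n) * q" unfolding xyc by simp
    also have "\<dots> = (of_int y * (of_nat n * z) + of_int c * (of_nat n * q)) + of_int i * z'"
      unfolding ij z'_def by (simp add: algebra_simps)
    finally have "q = (of_int y * (of_nat n * z) + of_int c * (of_nat n * q)) + of_int i * z'" .
    moreover have "of_int y * (of_nat n * z) + of_int c * (of_nat n * q) \<in> G"
      by (intro sgrp_add sgrp_of_int_mult sG zG HG pqH)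
    ultimately have q: "q \<in> adj G z'" by (rule adj_memI)
    show "H \<subseteq> adj G z'" unfolding pq(1) by (rule zspan_least[OF sgrp_adj[OF sG] p q])
  qed
  moreover have "rel_order G z' n" unfolding rel_order_def
  proof (intro allI iffI)
    fix k assume "of_nat k * z' \<in> G"
    then obtain a b r where "of_nat k * z' = of_int (int n * a + r * i) * p + of_int (int n * b + r * j) * q"
      using G_rep by blast
    moreover have "of_nat k * z' = of_int (- int k * y) * p + of_int (int k * x) * q" by (simp add: z'_def algebra_simps)
    ultimately have "of_int (- int k * y) * p + of_int (int k * x) * q
      = of_int (int n * a + r * i) * p + of_int (int n * b + r * j) * q" by simp
    from zspan_coeff_unique[OF ind this] have e: "- int k * y = int n * a + r * i" "int k * x = int n * b + r * j" by auto
    \<comment> \<open>In this Bezout combination the terms with \<open>r\<close> cancel, leaving a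
      multiple of \<open>n\<close>.\<close>
    have "int k = int k * (x * i + y * j + c * int n)" unfolding xy by simp
    also have "\<dots> = (int k * x) * i - (- int k * y) * j + int k * c * int n" by (simp add: algebra_simps)
    also have "\<dots> = int n * (b * i - a * j + int k * c)" unfolding e by (simp add: algebra_simps)
    finally have "int n dvd int k" by (metis dvd_triv_left)
    then show "n dvd k" by simp
  next
    fix k assume "n dvd k"
    then obtain m where "k = n * m" by (rule dvdE)
    then have "of_nat k * z' = of_nat m * (of_nat n * z')" by simp
    then show "of_nat k * z' \<in> G" using sgrp_of_nat_mult[OF sG HG[OF z'H], of m] by (simp only:)
  qed
  ultimately show ?thesis using that unfolding G_def by blast
qed

lemma rel_order_imp_K:
  assumes "klat H" "rel_order H z n" "n > 0" shows "z \<in> K"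
proof -
  have "of_nat n * z \<in> H" using assms(2) by (simp add: rel_order_def)
  then have "of_nat n * z \<in> K" using klat_K[OF assms(1)] by blast
  then have "of_nat n * z / of_nat n \<in> K" by (intro K_divide K_of_nat)
  then show ?thesis using assms(3) by simp
qed

text \<open>If \<open>b / P\<close> is cyclic of order \<open>n\<close>, then so is the quotient of
  \<open>P\<close> by \<open>n b\<close>, by \<open>cyclic_flip\<close>; dividing by
  \<open>n\<close> gives an overlattice of \<open>b\<close>. The converse uses the same duality, and
  multiplication by \<open>n\<close> preserves conductors.\<close>

lemma card_sub_super:
  assumes "klat b" "n > 0" shows "card (sub_lats b n g) = card (super_lats b n g)"
proof (rule card_eq_if_rel[where R = "\<lambda>P L. P = smul (of_nat n) L"])
  have n0: "(of_nat n :: complex) \<noteq> 0" using assms(2) by simp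
  fix P assume "P \<in> sub_lats b n g"
  then obtain e where P: "klat P" "cond P = g" and e: "b = adj P e" "rel_order P e n" by (auto simp: sub_lats_def)
  obtain z where z: "P = adj (smul (of_nat n) b) z" "rel_order (smul (of_nat n) b) z n"
    using cyclic_flip[OF P(1) e(2) assms(2)] e(1) by metis
  define L where "L = smul (1 / of_nat n) P"
  have "L = adj (smul (1 / of_nat n) (smul (of_nat n) b)) (1 / of_nat n * z)"
    unfolding L_def by (subst z(1)) (rule smul_adj)
  then have "L = adj b (1 / of_nat n * z)" using n0 by simp
  moreover have "rel_order (smul (1 / of_nat n) (smul (of_nat n) b)) (1 / of_nat n * z) n"
    using z(2) n0 by (subst rel_order_smul) auto
  then have "rel_order b (1 / of_nat n * z) n" using n0 by simp
  moreover have "klat L" "cond L = g" using P n0 by (auto simp: L_def intro!: klat_smul cond_smul K_closed)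
  ultimately have "L \<in> super_lats b n g" by (auto simp: super_lats_def)
  moreover have "P = smul (of_nat n) L" using n0 by (simp add: L_def)
  ultimately show "\<exists>L\<in>super_lats b n g. P = smul (of_nat n) L" by blast
next
  have n0: "(of_nat n :: complex) \<noteq> 0" using assms(2) by simp
  fix L assume "L \<in> super_lats b n g"
  then obtain z where L: "klat L" "cond L = g" and z: "L = adj b z" "rel_order b z n" by (auto simp: super_lats_def)
  obtain e where "b = adj (smul (of_nat n) L) e" "rel_order (smul (of_nat n) L) e n"
    using cyclic_flip[OF assms(1) z(2) assms(2)] z(1) by metis
  moreover have "klat (smul (of_nat n) L)" "cond (smul (of_nat n) L) = g"
    using L n0 by (auto intro!: klat_smul cond_smul K_closed)
  ultimately show "\<exists>P\<in>sub_lats b n g. P = smul (of_nat n) L" by (auto simp: sub_lats_def)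
next
  fix P L L' assume "P = smul (of_nat n) L" "P = smul (of_nat n) L'"
  then show "L = L'" using assms(2) smul_inj[of "of_nat n" L L'] by simp
qed auto

lemma super_lats_smul:
  assumes "klat b" "c \<in> K" "c \<noteq> 0" shows "card (super_lats (smul c b) n g) = card (super_lats b n g)"
proof (rule card_eq_if_rel[where R = "\<lambda>L L'. L = smul c L'"])
  fix L assume "L \<in> super_lats (smul c b) n g"
  then obtain z where L: "klat L" "cond L = g" and z: "L = adj (smul c b) z" "rel_order (smul c b) z n" by (auto simp: super_lats_def)
  have "smul (1 / c) L = adj (smul (1 / c) (smul c b)) (1 / c * z)" unfolding z(1) by (rule smul_adj)
  moreover have "rel_order (smul (1 / c) (smul c b)) (1 / c * z) n" using z(2) assms(3) by (subst rel_order_smul) auto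
  moreover have "klat (smul (1 / c) L)" "cond (smul (1 / c) L) = g"
    using L assms by (auto intro!: klat_smul cond_smul K_closed)
  ultimately have "smul (1 / c) L \<in> super_lats b n g" using assms(3) by (auto simp: super_lats_def)
  then show "\<exists>L'\<in>super_lats b n g. L = smul c L'" using assms(3) by (intro bexI[of _ "smul (1 / c) L"]) simp_all
next
  fix L assume "L \<in> super_lats b n g"
  then obtain z where L: "klat L" "cond L = g" and z: "L = adj b z" "rel_order b z n" by (auto simp: super_lats_def)
  have "smul c L = adj (smul c b) (c * z)" unfolding z(1) by (rule smul_adj)
  moreover have "rel_order (smul c b) (c * z) n" using z(2) assms(3) by (simp add: rel_order_smul)
  moreover have "klat (smul c L)" "cond (smul c L) = g" using L assms by (auto intro!: klat_smul cond_smul K_closed)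
  ultimately show "\<exists>L'\<in>super_lats (smul c b) n g. L' = smul c L" by (auto simp: super_lats_def)
next
  fix P L L' assume "P = smul c L" "P = smul c L'"
  then show "L = L'" using assms(3) smul_inj[of c L L'] by simp
qed auto

text \<open>Passing from \<open>B\<close> to its order changes \<open>L\<close> only at primes of
  \<open>k\<close>, where \<open>L\<close> agrees with \<open>B\<close>; at primes of
  \<open>n\<close> nothing changes. In both places the multipliers stay the same, and the two kinds
  of primes are separated by \<open>sgrp_coprime_combine\<close>.\<close>

lemma coprime_index_cond:
  fixes k n :: nat
  assumes B: "klat B" "Ord (cond B) \<subseteq> B" "\<And>x. x \<in> B \<Longrightarrow> of_nat k * x \<in> Ord (cond B)"
    and cop: "coprime k n" and L: "klat L" "B \<subseteq> L" "\<And>x. x \<in> L \<Longrightarrow> of_nat n * x \<in> B"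
    and L': "klat L'" "L' = {x \<in> L. of_nat n * x \<in> Ord (cond B)}"
  shows "cond L' = cond L"
proof -
  define f where "f = cond B"
  note B = B[folded f_def] and L' = L'[folded f_def]
  have s: "sgrp B" "sgrp L" "sgrp L'" using B L L' klat_sgrp by auto
  have OL': "Ord f \<subseteq> L'" using B(2) L(2) sgrp_of_nat_mult[OF sgrp_Ord] by (auto simp: L'(2))
  have kL: "of_nat k * x \<in> L'" if "x \<in> L" for x
  proof -
    have "of_nat n * (of_nat k * x) = of_nat k * (of_nat n * x)" by simp
    then have "of_nat n * (of_nat k * x) \<in> Ord f" using B(3)[OF L(3)[OF that]] by (simp only:)
    then show ?thesis using sgrp_of_nat_mult[OF s(2) that] by (simp add: L'(2))
  qed
  have L'L: "x \<in> L" if "x \<in> L'" for x using that by (simp add: L'(2))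
  have "(\<forall>x\<in>L'. \<alpha> * x \<in> L') \<longleftrightarrow> (\<forall>x\<in>L. \<alpha> * x \<in> L)" if aK: "\<alpha> \<in> K" for \<alpha>
  proof
    assume a: "\<forall>x\<in>L. \<alpha> * x \<in> L"
    have na: "of_nat n * \<alpha> \<in> Ord f" unfolding f_def
    proof (rule mem_OrdI[OF B(1)])
      fix x assume "x \<in> B"
      then have "of_nat n * (\<alpha> * x) \<in> B" using L a by blast
      then show "of_nat n * \<alpha> * x \<in> B" by (simp add: mult.assoc)
    qed (intro K_closed aK)
    show "\<forall>x\<in>L'. \<alpha> * x \<in> L'"
    proof
      fix x assume x: "x \<in> L'"
      then have ax: "\<alpha> * x \<in> L" using a L'L by blast
      have 1: "of_nat k * (of_nat n * (\<alpha> * x)) \<in> Ord f" using B(3) L(3) ax by blast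
      have "of_nat n * x \<in> Ord f" using x by (simp add: L'(2))
      with na have "(of_nat n * \<alpha>) * (of_nat n * x) \<in> Ord f" by (rule Ord_mult)
      then have 2: "of_nat n * (of_nat n * (\<alpha> * x)) \<in> Ord f" by (simp add: mult_ac)
      have "of_nat n * (\<alpha> * x) \<in> Ord f" by (rule sgrp_coprime_combine[OF sgrp_Ord cop 1 2])
      then show "\<alpha> * x \<in> L'" using ax by (simp add: L'(2))
    qed
  next
    assume a: "\<forall>x\<in>L'. \<alpha> * x \<in> L'"
    have "\<alpha> * 1 \<in> L'" using a OL' Ord_1_mem by blast
    then have na: "of_nat n * \<alpha> \<in> Ord f" by (simp add: L'(2))
    have aB: "\<alpha> * y \<in> L" if "y \<in> B" for y
    proof (rule sgrp_coprime_combine[OF s(2) cop])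
      have "\<alpha> * (of_nat k * y) \<in> L'" using a OL' B(3)[OF that] by blast
      then show "of_nat k * (\<alpha> * y) \<in> L" using L'L by (simp add: mult.left_commute)
      have "of_nat n * \<alpha> * y \<in> B" using mult_mem_lat[OF B(1) _ that] na by (simp add: f_def)
      then show "of_nat n * (\<alpha> * y) \<in> L" using L(2) by (auto simp: mult.assoc)
    qed
    show "\<forall>x\<in>L. \<alpha> * x \<in> L"
    proof
      fix x assume x: "x \<in> L"
      show "\<alpha> * x \<in> L"
      proof (rule sgrp_coprime_combine[OF s(2) cop])
        have "\<alpha> * (of_nat k * x) \<in> L" using a kL[OF x] L'L by blast
        then show "of_nat k * (\<alpha> * x) \<in> L" by (simp add: mult.left_commute)
        have "\<alpha> * (of_nat n * x) \<in> L" using aB L(3) x by blast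
        then show "of_nat n * (\<alpha> * x) \<in> L" by (simp add: mult.left_commute)
      qed
    qed
  qed
  then have "multipliers K L' = multipliers K L" by (auto simp: multipliers_def)
  then show ?thesis by (simp add: lattice_conductor_def)
qed

text \<open>Overlattices with quotient of order \<open>n\<close> differ from \<open>B\<close> only
  at primes of \<open>n\<close>, where \<open>B\<close> coincides with its order. So
  \<open>R\<close> matches the overlattices of both, with \<open>k * z\<close> as a generator over
  the order; this expresses the independence of \<open>r_K\<close> from the chosen curve.\<close>

lemma super_lats_principal:
  assumes "klat B" "Ord (cond B) \<subseteq> B" "\<And>x. x \<in> B \<Longrightarrow> of_nat k * x \<in> Ord (cond B)" "coprime k n" "k > 0" "n > 0"
  shows "card (super_lats B n g) = card (super_lats (Ord (cond B)) n g)"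
proof -
  define O' where "O' = Ord (cond B)"
  have O': "klat O'" "sgrp O'" using klat_Ord cond_pos assms(1) sgrp_Ord by (auto simp: O'_def)
  have sB: "sgrp B" using assms(1) klat_sgrp by blast
  have OB: "O' \<subseteq> B" and kB: "\<And>x. x \<in> B \<Longrightarrow> of_nat k * x \<in> O'" using assms by (auto simp: O'_def)
  define R where "R = (\<lambda>L L'. L' = {x \<in> L. of_nat n * x \<in> O'})"
  have cop': "coprime n k" using assms(4) by (simp add: coprime_commute)
  have cond_eq: "cond L' = cond L" if "klat L" "klat L'" "L = adj B z" "of_nat n * z \<in> B" "R L L'" for L L' z
  proof (rule coprime_index_cond[OF assms(1-4) that(1)])
    show "B \<subseteq> L" unfolding that(3) by (rule adj_subset)
    fix x assume "x \<in> L"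
    then obtain y i where "y \<in> B" "x = y + of_int i * z" unfolding \<open>L = adj B z\<close> by (rule adj_memE)
    moreover have "of_nat n * (y + of_int i * z) = of_nat n * y + of_int i * (of_nat n * z)" by (simp add: algebra_simps)
    ultimately show "of_nat n * x \<in> B" using sgrp_add[OF sB sgrp_of_nat_mult[OF sB] sgrp_of_int_mult[OF sB \<open>of_nat n * z \<in> B\<close>]] by simp
  qed (use that in \<open>auto simp: R_def O'_def\<close>)
  have "card (super_lats B n g) = card (super_lats O' n g)"
  proof (rule card_eq_if_rel[where R = R])
    fix L assume "L \<in> super_lats B n g"
    then obtain z where L: "klat L" "cond L = g" and z: "L = adj B z" "rel_order B z n" by (auto simp: super_lats_def)
    have nz: "of_nat n * z \<in> B" using z(2) by (simp add: rel_order_def)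
    define z' where "z' = of_nat k * z"
    have nz': "of_nat n * z' \<in> O'" using kB[OF nz] by (simp add: z'_def mult.left_commute)
    define L' where "L' = {x \<in> L. of_nat n * x \<in> O'}"
    have sL: "sgrp L" using L klat_sgrp by blast
    have "L' = adj O' z'"
    proof
      have "sgrp {x. of_nat n * x \<in> O'}" by (rule sgrp_vimage[OF O'(2)]) (simp add: algebra_simps)
      then have sL': "sgrp L'" unfolding L'_def using sgrp_Int[OF sL, of "{x. of_nat n * x \<in> O'}"] by (simp add: Int_def)
      show "adj O' z' \<subseteq> L'"
      proof (rule adj_least[OF sL'])
        show "O' \<subseteq> L'" using OB adj_subset[of B z] z(1) sgrp_of_nat_mult[OF O'(2)] by (auto simp: L'_def)
        have "z' \<in> L" unfolding z'_def z(1) by (intro sgrp_of_nat_mult sgrp_adj sB adj_self)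
        then show "z' \<in> L'" using nz' by (simp add: L'_def)
      qed
      show "L' \<subseteq> adj O' z'"
      proof
        fix x assume x: "x \<in> L'"
        then have "x \<in> adj B z" by (simp add: L'_def z(1))
        then obtain y i where y: "x = y + of_int i * z" "y \<in> B" by (rule adj_memE)
        have "of_nat k * x = of_nat k * y + of_int i * z'" by (simp add: y z'_def algebra_simps)
        then have 1: "of_nat k * x \<in> adj O' z'" by (rule adj_memI) (rule kB[OF y(2)])
        have 2: "of_nat n * x \<in> adj O' z'" using x adj_subset by (auto simp: L'_def)
        show "x \<in> adj O' z'" by (rule sgrp_coprime_combine[OF sgrp_adj[OF O'(2)] assms(4) 1 2])
      qed
    qed
    moreover have "rel_order O' z' n" unfolding rel_order_def
    proof (intro allI iffI)
      fix j assume "of_nat j * z' \<in> O'"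
      then have "of_nat (j * k) * z \<in> B" using OB by (auto simp: z'_def mult.assoc)
      then have "n dvd j * k" using z(2) unfolding rel_order_def by blast
      then show "n dvd j" using cop' by (simp add: coprime_dvd_mult_left_iff)
    next
      fix j assume "n dvd j"
      then obtain m where "j = n * m" by (rule dvdE)
      then have "of_nat j * z' = of_nat m * (of_nat n * z')" by simp
      then show "of_nat j * z' \<in> O'" using sgrp_of_nat_mult[OF O'(2) nz', of m] by (simp only:)
    qed
    moreover have zK: "z \<in> K" using rel_order_imp_K[OF assms(1) z(2) assms(6)] .
    then have "klat L'" unfolding \<open>L' = adj O' z'\<close> z'_def by (intro klat_adj O' K_closed)
    moreover have "cond L' = g" using cond_eq[OF L(1) \<open>klat L'\<close> z(1) nz] L(2) by (simp add: R_def L'_def)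
    ultimately show "\<exists>L'\<in>super_lats O' n g. R L L'" by (auto simp: super_lats_def R_def L'_def)
  next
    fix L' assume "L' \<in> super_lats O' n g"
    then obtain z where L': "klat L'" "cond L' = g" and z: "L' = adj O' z" "rel_order O' z n" by (auto simp: super_lats_def)
    have nz: "of_nat n * z \<in> O'" using z(2) by (simp add: rel_order_def)
    define L where "L = adj B z"
    have zK: "z \<in> K" using rel_order_imp_K[OF O'(1) z(2) assms(6)] .
    have L: "klat L" unfolding L_def by (intro klat_adj assms zK)
    have rB: "rel_order B z n" unfolding rel_order_def
    proof (intro allI iffI)
      fix j assume "of_nat j * z \<in> B"
      then have "of_nat (k * j) * z \<in> O'" using kB by (simp add: mult.assoc)
      then have "n dvd k * j" using z(2) unfolding rel_order_def by blast
      then show "n dvd j" using cop' by (simp add: coprime_dvd_mult_right_iff)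
    next
      fix j assume "n dvd j"
      then have "of_nat j * z \<in> O'" using z(2) by (simp add: rel_order_def)
      then show "of_nat j * z \<in> B" using OB by blast
    qed
    have "R L L'" unfolding R_def
    proof (intro equalityI subsetI)
      fix x assume "x \<in> L'"
      then obtain y i where y: "x = y + of_int i * z" "y \<in> O'" unfolding z(1) by (rule adj_memE)
      have "of_nat n * x = of_nat n * y + of_int i * (of_nat n * z)" by (simp add: y algebra_simps)
      then have "of_nat n * x \<in> O'" using sgrp_add[OF O'(2) sgrp_of_nat_mult[OF O'(2) y(2)] sgrp_of_int_mult[OF O'(2) nz]] by simp
      moreover have "x \<in> L" unfolding L_def using y OB by (blast intro: adj_memI)
      ultimately show "x \<in> {x \<in> L. of_nat n * x \<in> O'}" by simp
    next
      fix x assume x: "x \<in> {x \<in> L. of_nat n * x \<in> O'}"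
      then have "x \<in> adj B z" by (simp add: L_def)
      then obtain y i where y: "x = y + of_int i * z" "y \<in> B" by (rule adj_memE)
      have 1: "of_nat k * y \<in> O'" by (rule kB[OF y(2)])
      have "of_nat n * y = of_nat n * x - of_int i * (of_nat n * z)" by (simp add: y algebra_simps)
      then have 2: "of_nat n * y \<in> O'" using x sgrp_diff[OF O'(2) _ sgrp_of_int_mult[OF O'(2) nz]] by simp
      have "y \<in> O'" by (rule sgrp_coprime_combine[OF O'(2) assms(4) 1 2])
      then show "x \<in> L'" unfolding z(1) using y(1) by (blast intro: adj_memI)
    qed
    moreover have "cond L' = cond L" using cond_eq[OF L L'(1) L_def _ \<open>R L L'\<close>] nz OB by blast
    ultimately show "\<exists>L\<in>super_lats B n g. R L L'" using L L'(2) rB by (auto simp: super_lats_def L_def)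
  next
    have le: "L1 \<subseteq> L2" if L: "L1 \<in> super_lats B n g" "L2 \<in> super_lats B n g" "R L1 L'" "R L2 L'" for L1 L2 L'
    proof -
      obtain z where z: "L1 = adj B z" "rel_order B z n" using L(1) by (auto simp: super_lats_def)
      have L2: "sgrp L2" "B \<subseteq> L2" using L(2) adj_subset by (auto simp: super_lats_def klat_sgrp)
      have nz: "of_nat n * z \<in> B" using z(2) by (simp add: rel_order_def)
      have "of_nat k * z \<in> L1" unfolding z(1) by (intro sgrp_of_nat_mult sgrp_adj sB adj_self)
      moreover have "of_nat n * (of_nat k * z) \<in> O'" using kB[OF nz] by (simp add: mult.left_commute)
      ultimately have "of_nat k * z \<in> L'" using L(3) by (simp add: R_def)
      then have 1: "of_nat k * z \<in> L2" using L(4) by (simp add: R_def)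
      have 2: "of_nat n * z \<in> L2" using nz L2 by blast
      have "z \<in> L2" by (rule sgrp_coprime_combine[OF L2(1) assms(4) 1 2])
      then show ?thesis unfolding z(1) using L2 by (intro adj_least)
    qed
    fix L1 L2 L' assume "L1 \<in> super_lats B n g" "L2 \<in> super_lats B n g" "R L1 L'" "R L2 L'"
    then show "L1 = L2" using le[of L1 L2] le[of L2 L1] by blast
  qed (auto simp: R_def)
  then show ?thesis by (simp add: O'_def)
qed

lemma card_sub_lats:
  assumes "klat b" "n > 0" shows "card (sub_lats b n g) = r_K K (cond b) g n"
proof -
  obtain \<alpha> k where \<alpha>: "\<alpha> \<in> b" "\<alpha> \<noteq> 0" and k: "k > 0" "coprime k n"
    and B1: "Ord (cond b) \<subseteq> smul (1 / \<alpha>) b" and B2: "\<And>x. x \<in> smul (1 / \<alpha>) b \<Longrightarrow> of_nat k * x \<in> Ord (cond b)"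
    using coprime_generator[OF assms] by metis
  have aK: "1 / \<alpha> \<in> K" "1 / \<alpha> \<noteq> 0" using \<alpha> klat_K[OF assms(1)] by (auto intro!: K_closed)
  define B where "B = smul (1 / \<alpha>) b"
  have B: "klat B" "cond B = cond b" using klat_smul[OF assms(1) aK] cond_smul[OF assms(1) aK] by (simp_all add: B_def)
  have "card (sub_lats b n g) = card (super_lats b n g)" by (rule card_sub_super[OF assms])
  also have "\<dots> = card (super_lats B n g)" unfolding B_def by (rule super_lats_smul[OF assms(1) aK, symmetric])
  also have "\<dots> = card (super_lats (Ord (cond B)) n g)"
    by (rule super_lats_principal[OF B(1) _ _ k(2,1) assms(2)]) (use B1 B2 B in \<open>auto simp: B_def\<close>)
  also have "super_lats (Ord (cond B)) n g = {L. \<exists>z. L = {x + of_int k * z | x k. x \<in> order_cond K (cond b)}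
       \<and> (\<forall>k::nat. of_nat k * z \<in> order_cond K (cond b) \<longleftrightarrow> n dvd k) \<and> cond L = g}"
  proof -
    have O: "klat (Ord (cond b))" using klat_Ord cond_pos assms(1) by blast
    have "klat (adj (Ord (cond b)) z)" if "rel_order (Ord (cond b)) z n" for z
      using klat_adj[OF O rel_order_imp_K[OF O that assms(2)]] .
    then show ?thesis unfolding super_lats_def B(2) order_cond_eq adj_def[symmetric] rel_order_def[symmetric] by blast
  qed
  also have "card \<dots> = r_K K (cond b) g n" by (simp add: r_K_def)
  finally show ?thesis .
qed

lemma finite_sub_lats:
  assumes "klat b" "n > 0" shows "finite (sub_lats b n g)"
proof -
  obtain p q where pq: "b = zspan p q" using klat_basis[OF assms(1)] by metis
  have "sub_lats b n g \<subseteq> {H. sgrp H \<and> smul (of_nat n) b \<subseteq> H \<and> H \<subseteq> b}"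
  proof
    fix P assume "P \<in> sub_lats b n g"
    then obtain e where P: "klat P" and e: "b = adj P e" "rel_order P e n" by (auto simp: sub_lats_def)
    have s: "sgrp P" using P klat_sgrp by blast
    have "of_nat n * e \<in> P" using e(2) by (simp add: rel_order_def)
    then have "smul (of_nat n) b \<subseteq> P" unfolding e(1) smul_adj
      using s by (intro adj_least) (auto simp: smul_def sgrp_of_nat_mult)
    then show "P \<in> {H. sgrp H \<and> smul (of_nat n) b \<subseteq> H \<and> H \<subseteq> b}" using s e(1) adj_subset by auto
  qed
  then show ?thesis using finite_intermediate_groups[OF assms(2)] unfolding pq by (rule finite_subset)
qed

section \<open>Finiteness of the class set\<close>

definition pic :: "nat \<Rightarrow> complex set set set" where
  "pic l = {homothety_class K a | a. klat a \<and> cond a = l}"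

lemma card_pic: "card (pic l) = pic_number K l"
  by (simp add: pic_def pic_number_def klat_iff)

lemma homothety_class_eq: "homothety_class K a = {smul c a | c. c \<in> K \<and> c \<noteq> 0}"
  by (simp add: homothety_class_def smul_def)

lemma homothety_class_eq_iff:
  "homothety_class K a = homothety_class K b \<longleftrightarrow> (\<exists>c\<in>K. c \<noteq> 0 \<and> b = smul c a)"
proof
  assume "homothety_class K a = homothety_class K b"
  moreover have "b \<in> homothety_class K b"
    unfolding homothety_class_eq using K_1 by (auto intro!: exI[of _ 1])
  ultimately have "b \<in> homothety_class K a" by simp
  then show "\<exists>c\<in>K. c \<noteq> 0 \<and> b = smul c a" unfolding homothety_class_eq by auto
next
  assume "\<exists>c\<in>K. c \<noteq> 0 \<and> b = smul c a"
  then obtain c where c: "c \<in> K" "c \<noteq> 0" "b = smul c a" by blast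
  show "homothety_class K a = homothety_class K b"
  proof (intro equalityI subsetI)
    fix x assume "x \<in> homothety_class K a"
    then obtain r where "r \<in> K" "r \<noteq> 0" "x = smul r a" unfolding homothety_class_eq by blast
    then show "x \<in> homothety_class K b" unfolding homothety_class_eq using c
      by (intro CollectI exI[of _ "r / c"]) (auto intro!: K_divide)
  next
    fix x assume "x \<in> homothety_class K b"
    then obtain r where "r \<in> K" "r \<noteq> 0" "x = smul r b" unfolding homothety_class_eq by blast
    then show "x \<in> homothety_class K a" unfolding homothety_class_eq using c
      by (intro CollectI exI[of _ "r * c"]) (auto intro!: K_mult)
  qed
qed

lemma norm_multiple:
  assumes "klat L" "x \<in> L" obtains k :: nat where "x * cnj x = of_real (nrm L) * of_nat k"
proof -
  have N: "nrm L > 0" using nrm_pos assms by blast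
  have "x * cnj x \<in> lprod L (cnj ` L)" using assms by (intro lprod_memI) auto
  then have "x * cnj x / of_real (nrm L) \<in> Ord (cond L)" using N by (simp add: lprod_cnj assms in_smul_iff)
  then obtain i j where ij: "x * cnj x / of_real (nrm L) = of_int i + of_int j * w" by (rule Ord_memE)
  have e: "x * cnj x / of_real (nrm L) = of_real ((cmod x)\<^sup>2 / nrm L)" by (simp add: complex_norm_square[symmetric] del: of_real_power)
  then have "Im (of_int i + of_int j * w) = 0" using ij by (metis Im_complex_of_real)
  then have "j = 0" using Im_w by simp
  then have "complex_of_real ((cmod x)\<^sup>2 / nrm L) = of_real (of_int i)" using ij e by simp
  then have i: "(cmod x)\<^sup>2 / nrm L = of_int i" by (simp only: of_real_eq_iff)
  then have "i \<ge> 0" using N by (metis divide_nonneg_pos of_int_0_le_iff zero_le_power2)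
  then have "x * cnj x = of_real (nrm L) * of_nat (nat i)" using ij \<open>j = 0\<close> N by (simp add: field_simps)
  then show ?thesis by (rule that)
qed

text \<open>Gauss reduction among the bases of fixed orientation, which give the value \<open>eps L\<close> itself
  rather than a multiple of it.\<close>
lemma short_vector:
  assumes "klat L"
  obtains u and k :: nat where "u \<in> L" "u \<noteq> 0" "u * cnj u = of_real (nrm L) * of_nat k" "k > 0"
    "3 * (real k)\<^sup>2 \<le> (real (cond L))\<^sup>2 * (cmod (w - cnj w))\<^sup>2"
proof -
  define good where "good = (\<lambda>u v. L = zspan u v \<and> cnj u * v - u * cnj v = eps L)"
  have N: "nrm L > 0" using nrm_pos assms by blast
  have E: "eps L \<noteq> 0" using eps_nz assms by blast
  have ex: "\<exists>k u v. good u v \<and> u * cnj u = of_real (nrm L) * of_nat k"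
  proof -
    obtain u v where uv: "L = zspan u v" "cnj u * v - u * cnj v = eps L" using eps_basis[OF assms] by metis
    obtain k where "u * cnj u = of_real (nrm L) * of_nat k"
      using norm_multiple[OF assms, of u] uv zspan_basis by auto
    then show ?thesis using uv by (auto simp: good_def)
  qed
  define k where "k = (LEAST k. \<exists>u v. good u v \<and> u * cnj u = of_real (nrm L) * of_nat k)"
  obtain u v where uv: "good u v" "u * cnj u = of_real (nrm L) * of_nat k"
    using LeastI_ex[OF ex] unfolding k_def by blast
  have uv0: "cnj u * v - u * cnj v = eps L" "L = zspan u v" using uv(1) by (auto simp: good_def)
  have u0: "u \<noteq> 0" using uv0(1) E by auto
  have uL: "u \<in> L" "v \<in> L" using uv0 zspan_basis by auto
  \<comment> \<open>Subtracting the nearest integer multiple of \<open>u\<close> bounds the real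
    part of \<open>cnj u * v'\<close> by half the squared length of \<open>u\<close>.\<close>
  define t where "t = round (Re (cnj u * v) / (cmod u)\<^sup>2)"
  define v' where "v' = v - of_int t * u"
  have cu: "(cmod u)\<^sup>2 > 0" using u0 by simp
  have uu: "cnj u * u = of_real ((cmod u)\<^sup>2)" by (metis complex_norm_square mult.commute)
  have "cnj u * v' = cnj u * v - of_int t * (cnj u * u)" by (simp add: v'_def algebra_simps)
  then have re: "Re (cnj u * v') = Re (cnj u * v) - of_int t * (cmod u)\<^sup>2" unfolding uu by simp
  have "\<bar>of_int t - Re (cnj u * v) / (cmod u)\<^sup>2\<bar> \<le> 1 / 2" unfolding t_def by (rule of_int_round_abs_le)
  then have "\<bar>of_int t - Re (cnj u * v) / (cmod u)\<^sup>2\<bar> * (cmod u)\<^sup>2 \<le> 1 / 2 * (cmod u)\<^sup>2" using cu by (intro mult_right_mono) auto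
  also have "\<bar>of_int t - Re (cnj u * v) / (cmod u)\<^sup>2\<bar> * (cmod u)\<^sup>2 = \<bar>(of_int t - Re (cnj u * v) / (cmod u)\<^sup>2) * (cmod u)\<^sup>2\<bar>"
    by (simp add: abs_mult)
  also have "(of_int t - Re (cnj u * v) / (cmod u)\<^sup>2) * (cmod u)\<^sup>2 = - Re (cnj u * v')"
    unfolding re using cu by (simp add: field_simps)
  finally have re2: "\<bar>Re (cnj u * v')\<bar> \<le> (cmod u)\<^sup>2 / 2" by (simp only: abs_minus_cancel)
  have v'L: "v' \<in> L" unfolding v'_def by (intro sgrp_diff sgrp_of_int_mult klat_sgrp assms uL)
  have e': "cnj u * v' - u * cnj v' = eps L" unfolding uv0(1)[symmetric] v'_def by (simp add: algebra_simps)
  \<comment> \<open>The sign of \<open>u\<close> preserves the orientation, so \<open>v'\<close>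
    competes with \<open>u\<close> in the minimality of \<open>k\<close>.\<close>
  have good': "good v' (- u)"
  proof -
    have "zspan v' (- u) = L"
    proof
      show "zspan v' (- u) \<subseteq> L" by (intro zspan_least klat_sgrp assms v'L sgrp_uminus uL)
      have "u \<in> zspan v' (- u)" using sgrp_uminus[OF sgrp_zspan zspan_basis(2)[where u = v' and v = "- u"]] by simp
      moreover have "v \<in> zspan v' (- u)" by (rule zspan_memI'[of _ 1 _ "- t"]) (simp add: v'_def)
      ultimately show "L \<subseteq> zspan v' (- u)" unfolding uv0(2) by (intro zspan_least sgrp_zspan)
    qed
    then show ?thesis using e' by (simp add: good_def algebra_simps)
  qed
  obtain k' where k': "v' * cnj v' = of_real (nrm L) * of_nat k'" using norm_multiple[OF assms v'L] .
  have kk': "k \<le> k'" unfolding k_def by (rule Least_le) (use good' k' in blast)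
  have ck: "(cmod u)\<^sup>2 = nrm L * real k"
  proof -
    have "complex_of_real ((cmod u)\<^sup>2) = of_real (nrm L * real k)" using uv(2) by (simp add: complex_norm_square del: of_real_power)
    then show ?thesis by (simp only: of_real_eq_iff)
  qed
  have ck': "(cmod v')\<^sup>2 = nrm L * real k'"
  proof -
    have "complex_of_real ((cmod v')\<^sup>2) = of_real (nrm L * real k')" using k' by (simp add: complex_norm_square del: of_real_power)
    then show ?thesis by (simp only: of_real_eq_iff)
  qed
  have k0: "k > 0" using ck cu by (cases k) auto
  have im: "cmod (eps L) = 2 * \<bar>Im (cnj u * v')\<bar>"
  proof -
    have "cnj u * v' - cnj (cnj u * v') = eps L" using e' by simp
    moreover have "z - cnj z = of_real (2 * Im z) * \<i>" for z by (simp add: complex_eq_iff)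
    ultimately have "eps L = of_real (2 * Im (cnj u * v')) * \<i>" by metis
    then show ?thesis by (simp only: norm_mult norm_of_real norm_ii abs_mult)
  qed
  have "(cmod u)\<^sup>2 * (cmod v')\<^sup>2 = (cmod (cnj u * v'))\<^sup>2" by (simp add: norm_mult power_mult_distrib)
  also have "\<dots> = (Re (cnj u * v'))\<^sup>2 + (Im (cnj u * v'))\<^sup>2" by (rule cmod_power2)
  \<comment> \<open>The real part contributes at most a quarter of the square of
    \<open>nrm L * k\<close>, and \<open>k \<le> k'\<close>. Hence three quarters of that square are
    bounded by the imaginary part, which is half of the absolute value of
    \<open>eps L\<close>.\<close>
  finally have split: "(nrm L)\<^sup>2 * (real k * real k') = (Re (cnj u * v'))\<^sup>2 + (Im (cnj u * v'))\<^sup>2"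
    unfolding ck ck' by (simp only: power2_eq_square[of "nrm L"] mult_ac)
  have "(Re (cnj u * v'))\<^sup>2 \<le> ((cmod u)\<^sup>2 / 2)\<^sup>2" using re2 by (metis abs_le_square_iff abs_of_nonneg cu half_gt_zero less_imp_le)
  then have r4: "4 * (Re (cnj u * v'))\<^sup>2 \<le> (nrm L)\<^sup>2 * (real k)\<^sup>2" by (simp add: ck power_divide power_mult_distrib)
  have "real k * real k \<le> real k * real k'" using kk' by (intro mult_left_mono) auto
  then have "(nrm L)\<^sup>2 * (real k)\<^sup>2 \<le> (nrm L)\<^sup>2 * (real k * real k')" by (intro mult_left_mono) (auto simp: power2_eq_square)
  then have "3 * ((nrm L)\<^sup>2 * (real k)\<^sup>2) \<le> 4 * (Im (cnj u * v'))\<^sup>2" using split r4 by linarith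
  also have "\<dots> = (cmod (eps L))\<^sup>2" unfolding im by (simp add: power_mult_distrib)
  also have "\<dots> = (nrm L)\<^sup>2 * ((real (cond L))\<^sup>2 * (cmod (w - cnj w))\<^sup>2)"
    unfolding eps_def by (simp add: norm_mult power_mult_distrib)
  finally have "(nrm L)\<^sup>2 * (3 * (real k)\<^sup>2) \<le> (nrm L)\<^sup>2 * ((real (cond L))\<^sup>2 * (cmod (w - cnj w))\<^sup>2)" by simp
  then have "3 * (real k)\<^sup>2 \<le> (real (cond L))\<^sup>2 * (cmod (w - cnj w))\<^sup>2" using N by simp
  then show ?thesis using that[of u k] uL u0 uv(2) k0 by blast
qed

text \<open>Dividing by a short vector of norm \<open>k * nrm a\<close> places a representative of
  the class between \<open>Ord l\<close> and \<open>Ord l\<close> divided by \<open>k\<close>, with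
  \<open>k\<close> bounded in terms of \<open>l\<close>. Finiteness is what allows the index set to
  be counted as a product.\<close>

lemma finite_pic: "finite (pic l)"
proof (cases "l > 0")
  case False
  then have "pic l = {}" using cond_pos by (auto simp: pic_def)
  then show ?thesis by simp
next
  case l: True
  \<comment> \<open>By \<open>k \<le> 3 * k^2\<close> this bounds every \<open>k\<close> given by
    \<open>short_vector\<close>, so the factorial of \<open>M\<close> is a common multiple of all of
    them.\<close>
  define M where "M = nat \<lceil>(real l)\<^sup>2 * (cmod (w - cnj w))\<^sup>2\<rceil>"
  define F where "F = (fact M :: nat)"
  have F0: "F > 0" by (simp add: F_def)
  define G where "G = smul (1 / of_nat F) (Ord l)"
  have G: "klat G" unfolding G_def using F0 l by (intro klat_smul klat_Ord K_closed) auto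
  obtain p q where pq: "G = zspan p q" using klat_basis[OF G] by metis
  have FG: "smul (of_nat F) G = Ord l" using F0 by (simp add: G_def)
  have "pic l \<subseteq> homothety_class K ` {H. sgrp H \<and> smul (of_nat F) G \<subseteq> H \<and> H \<subseteq> G}"
  proof
    fix C assume "C \<in> pic l"
    then obtain a where a: "C = homothety_class K a" "klat a" "cond a = l" by (auto simp: pic_def)
    obtain u k where u: "u \<in> a" "u \<noteq> 0" "u * cnj u = of_real (nrm a) * of_nat k" "k > 0"
      "3 * (real k)\<^sup>2 \<le> (real (cond a))\<^sup>2 * (cmod (w - cnj w))\<^sup>2" using short_vector[OF a(2)] .
    have N: "nrm a > 0" using nrm_pos a by blast
    have "real k \<le> 3 * (real k)\<^sup>2" using u(4) by (simp add: power2_eq_square)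
    then have "real k \<le> (real l)\<^sup>2 * (cmod (w - cnj w))\<^sup>2" using u(5) a(3) by simp
    then have "k \<le> M" unfolding M_def by linarith
    then have kF: "k dvd F" unfolding F_def using u(4) by (simp add: dvd_fact)
    have uK: "1 / u \<in> K" "1 / u \<noteq> 0" using u klat_K a by (auto intro!: K_closed)
    define H where "H = smul (1 / u) a"
    have H: "klat H" unfolding H_def by (rule klat_smul[OF a(2) uK])
    have "Ord l \<subseteq> H" using mult_mem_lat[OF a(2) _ u(1)] u(2) a(3) by (auto simp: H_def in_smul_iff)
    moreover have "H \<subseteq> G"
    proof
      fix x assume "x \<in> H"
      then have xa: "x * u \<in> a" using u(2) by (simp add: H_def in_smul_iff)
      then have "(x * u) * cnj u \<in> lprod a (cnj ` a)" using u(1) by (intro lprod_memI) auto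
      then have "(x * u) * cnj u / of_real (nrm a) \<in> Ord l" using N by (simp add: lprod_cnj a in_smul_iff)
      also have "(x * u) * cnj u / of_real (nrm a) = of_nat k * x" using N u(3) by (simp add: mult.assoc)
      finally have kx: "of_nat k * x \<in> Ord l" .
      obtain r where "F = k * r" using kF by (rule dvdE)
      then have "of_nat F * x = of_nat r * (of_nat k * x)" by simp
      then have "of_nat F * x \<in> Ord l" using sgrp_of_nat_mult[OF sgrp_Ord kx, of r] by (simp only:)
      then show "x \<in> G" using F0 by (simp add: G_def in_smul_iff mult.commute)
    qed
    ultimately have "H \<in> {H. sgrp H \<and> smul (of_nat F) G \<subseteq> H \<and> H \<subseteq> G}" using H klat_sgrp by (simp add: FG)
    moreover have "C = homothety_class K H" unfolding a(1) homothety_class_eq_iff H_def using uK by blast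
    ultimately show "C \<in> homothety_class K ` {H. sgrp H \<and> smul (of_nat F) G \<subseteq> H \<and> H \<subseteq> G}" by blast
  qed
  then show ?thesis using finite_intermediate_groups[OF F0, of p q] unfolding pq by (meson finite_imageI finite_subset)
qed


lemma linv_smul: assumes "klat L" "c \<in> K" "c \<noteq> 0" shows "linv (smul c L) = smul (1 / c) (linv L)"
proof -
  have "1 / of_real ((cmod c)\<^sup>2 * nrm L) * cnj c = 1 / c * (1 / of_real (nrm L))"
    using assms(3) nrm_pos[OF assms(1)] by (simp add: complex_norm_square del: of_real_power)
  then show ?thesis unfolding linv_def nrm_smul[OF assms] cnj_image_smul smul_smul by simp
qed

lemma smul_factor_K: assumes "klat L" "klat (smul c L)" shows "c \<in> K" "c \<noteq> 0"
proof -
  obtain x where x: "x \<in> L" "x \<noteq> 0" using klat_nonzero[OF assms(1)] .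
  have "c * x \<in> K" using smul_memI[OF x(1)] klat_K[OF assms(2)] by blast
  then have "c * x / x \<in> K" using x klat_K[OF assms(1)] by (intro K_divide) auto
  then show "c \<in> K" using x by simp
  obtain y where "y \<in> smul c L" "y \<noteq> 0" using klat_nonzero[OF assms(2)] .
  then show "c \<noteq> 0" by (auto simp: smul_def)
qed

lemma det2_K: "matK K g \<Longrightarrow> det2 g \<in> K"
  by (cases g) (simp add: K_diff K_mult)

text \<open>Replacing \<open>L2\<close> by \<open>P' L2\<^sup>-\<^sup>1\<close> turns a pair with product \<open>P\<close> into two lattices that agree over the order
  of conductor \<open>gcd l1 l2\<close>. These glue to their intersection.\<close>
context
  fixes P P' l1 l2
  assumes P': "klat P'" "cond P' = lcm l1 l2" "lprod P' (Ord (gcd l1 l2)) = P"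
begin

lemma pair_of_lattice:
  assumes "klat L" "cond L = lcm l1 l2"
  defines "L1 \<equiv> lprod L (Ord l1)" and "L2 \<equiv> lprod (lprod P' (linv L)) (Ord l2)"
  shows "klat L1" "klat L2" "cond L1 = l1" "cond L2 = l2" "lprod L1 L2 = P"
proof -
  have pos: "l1 > 0" "l2 > 0" using cond_pos[OF assms(1)] assms(2) by (auto simp: lcm_pos_nat intro!: Nat.gr0I)
  have O: "klat (Ord l1)" "klat (Ord l2)" "cond (Ord l1) = l1" "cond (Ord l2) = l2"
    using pos by (simp_all add: klat_Ord cond_Ord)
  show "klat L1" "klat L2" unfolding L1_def L2_def by (intro klat_lprod assms O P' klat_linv)+
  show "cond L1 = l1" unfolding L1_def by (simp add: cond_lprod assms O gcd.commute)
  show "cond L2 = l2" unfolding L2_def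
    by (simp add: cond_lprod klat_lprod klat_linv cond_linv assms(1,2) O P' gcd.commute)
  have "lprod L1 L2 = lprod (lprod (lprod (linv L) L) P') (lprod (Ord l1) (Ord l2))"
    unfolding L1_def L2_def by (simp only: lprod_ac)
  also have "\<dots> = lprod (lprod (Ord (cond P')) P') (Ord (gcd l1 l2))"
    by (simp only: lprod_linv'[OF assms(1)] lprod_Ord assms(2) P'(2))
  also have "\<dots> = P" by (simp add: lprod_Ord_absorb P')
  finally show "lprod L1 L2 = P" .
qed

lemma lattice_of_pair:
  assumes "klat L1" "klat L2" "cond L1 = l1" "cond L2 = l2" "lprod L1 L2 = P"
  obtains L where "klat L" "cond L = lcm l1 l2" "L1 = lprod L (Ord l1)" "L2 = lprod (lprod P' (linv L)) (Ord l2)"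
proof -
  define B where "B = lprod P' (linv L2)"
  define L where "L = L1 \<inter> B"
  have B: "klat B" "cond B = l2" unfolding B_def
    by (simp_all add: klat_lprod klat_linv cond_lprod cond_linv assms P' gcd.commute)
  \<comment> \<open>Over the smaller conductor \<open>P'\<close> becomes \<open>P\<close>, the
    product of \<open>L1\<close> and \<open>L2\<close>, and \<open>L2\<close> cancels against its
    inverse.\<close>
  have eq: "lprod L1 (Ord (gcd (cond L1) (cond B))) = lprod B (Ord (gcd (cond L1) (cond B)))"
  proof -
    have "lprod B (Ord (gcd l1 l2)) = lprod (lprod P' (Ord (gcd l1 l2))) (linv L2)"
      unfolding B_def by (simp only: lprod_ac)
    also have "\<dots> = lprod L1 (lprod L2 (linv L2))" by (simp only: P'(3) assms(5)[symmetric] lprod_assoc)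
    also have "\<dots> = lprod L1 (Ord l2)" by (simp add: lprod_linv assms)
    also have "\<dots> = lprod L1 (Ord (gcd l1 l2))" using lprod_Ord_cond_left[OF assms(1), of l2] by (simp add: assms)
    finally show ?thesis by (simp add: assms B)
  qed
  have L: "klat L" "cond L = lcm l1 l2" unfolding L_def using klat_Int[OF assms(1) B(1)] cond_Int[OF assms(1) B(1) eq]
    by (simp_all add: assms B)
  have 1: "lprod L (Ord l1) = L1" unfolding L_def using Int_lprod_Ord[OF assms(1) B(1) eq] by (simp add: assms)
  have "lprod (B \<inter> L1) (Ord (cond B)) = B"
    by (rule Int_lprod_Ord[OF B(1) assms(1)]) (use eq in \<open>simp add: gcd.commute\<close>)
  then have 2: "lprod L (Ord l2) = B" unfolding L_def by (simp add: B Int_commute)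
  have "lprod (lprod P' (linv L)) (Ord l2) = lprod (linv L) (lprod P' (lprod (linv L2) L2))"
    using lprod_linv'[OF assms(2)] by (simp only: assms(4) lprod_ac)
  also have "\<dots> = lprod L2 (lprod (linv L) B)" unfolding B_def by (simp only: lprod_ac)
  also have "\<dots> = lprod L2 (lprod (Ord l2) (lprod (linv L) L))" unfolding 2[symmetric] by (simp only: lprod_ac)
  also have "lprod (linv L) L = Ord (lcm l1 l2)" by (simp add: lprod_linv' L)
  also have "lprod L2 (lprod (Ord l2) (Ord (lcm l1 l2))) = lprod (Ord l2) L2" by (simp add: lprod_Ord lprod_commute)
  also have "\<dots> = L2" by (simp add: lprod_Ord_absorb assms)
  finally show ?thesis using that[OF L] 1 by simp
qed

text \<open>Inversion turns the factor \<open>1 / c\<close> of the second lattice back into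
  \<open>c\<close>: multiplying by the inverse of \<open>P'\<close> and by both \<open>L\<close> and
  \<open>M\<close> exchanges their extensions to \<open>Ord l2\<close>. So both extensions of
  \<open>M\<close> are \<open>c\<close> times those of \<open>L\<close>, and
  \<open>lprod_Ord_Int\<close> recovers the lattices.\<close>

lemma lattice_of_pair_unique:
  assumes "klat L" "cond L = lcm l1 l2" "klat M" "cond M = lcm l1 l2" "c \<in> K" "c \<noteq> 0"
    and "lprod M (Ord l1) = smul c (lprod L (Ord l1))"
    and "lprod (lprod P' (linv M)) (Ord l2) = smul (1 / c) (lprod (lprod P' (linv L)) (Ord l2))"
  shows "M = smul c L"
proof -
  let ?l = "lcm l1 l2"
  have absorb: "lprod (Ord ?l) X = X" if "klat X" "cond X = ?l" for X
    using lprod_Ord_absorb[OF that(1), of ?l] that(2) by simp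
  have gi: "gcd ?l ?l = ?l" by simp
  have "lprod (lprod (linv P') (lprod L M)) (lprod (lprod P' (linv M)) (Ord l2))
      = lprod (lprod P' (linv P')) (lprod (lprod M (linv M)) (lprod L (Ord l2)))" by (simp only: lprod_ac)
  also have "\<dots> = lprod (Ord ?l) (lprod (Ord ?l) (lprod L (Ord l2)))" by (simp add: lprod_linv P' assms)
  also have "\<dots> = lprod L (Ord l2)" by (simp only: lprod_assoc[symmetric] lprod_Ord gi absorb[OF assms(1,2)])
  finally have a: "lprod (lprod (linv P') (lprod L M)) (lprod (lprod P' (linv M)) (Ord l2)) = lprod L (Ord l2)" .
  have "lprod (lprod (linv P') (lprod L M)) (lprod (lprod P' (linv L)) (Ord l2))
      = lprod (lprod P' (linv P')) (lprod (lprod L (linv L)) (lprod M (Ord l2)))" by (simp only: lprod_ac)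
  also have "\<dots> = lprod (Ord ?l) (lprod (Ord ?l) (lprod M (Ord l2)))" by (simp add: lprod_linv P' assms)
  also have "\<dots> = lprod M (Ord l2)" by (simp only: lprod_assoc[symmetric] lprod_Ord gi absorb[OF assms(3,4)])
  finally have b: "lprod (lprod (linv P') (lprod L M)) (lprod (lprod P' (linv L)) (Ord l2)) = lprod M (Ord l2)" .
  have "lprod L (Ord l2) = smul (1 / c) (lprod M (Ord l2))"
    unfolding a[symmetric] assms(8) lprod_smul_right b ..
  then have 2: "lprod M (Ord l2) = smul c (lprod L (Ord l2))" using assms(6) by simp
  have cL: "klat (smul c L)" "cond (smul c L) = ?l" using klat_smul cond_smul assms by auto
  have "M = lprod M (Ord l1) \<inter> lprod M (Ord l2)" by (rule lprod_Ord_Int[OF assms(3,4), symmetric])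
  also have "\<dots> = lprod (smul c L) (Ord l1) \<inter> lprod (smul c L) (Ord l2)"
    by (simp only: assms(7) 2 lprod_smul_left)
  also have "\<dots> = smul c L" by (rule lprod_Ord_Int[OF cL])
  finally show ?thesis .
qed

end

end

section \<open>Orbits of lines on the product surface\<close>

lemma upper_triangular:
  assumes "det2 h \<noteq> 0" "lin2 h ` range (\<lambda>t::complex. (t, 0)) = range (\<lambda>t::complex. (t, 0))"
  obtains a x d where "h = (a, x, 0, d)" "a \<noteq> 0" "d \<noteq> 0"
proof -
  obtain a x c d where h: "h = (a, x, c, d)" by (cases h)
  have "lin2 h (1, 0) \<in> range (\<lambda>t::complex. (t, 0))" using assms(2) by blast
  then have "c = 0" by (auto simp: h)
  then show ?thesis using that h assms(1) by auto
qed

lemma upper_triangular_axis: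
  "a \<noteq> 0 \<Longrightarrow> lin2 (a, x, 0, d) ` range (\<lambda>t::complex. (t, 0)) = range (\<lambda>t::complex. (t, 0))"
proof (intro equalityI subsetI)
  fix y assume a: "a \<noteq> 0" and "y \<in> range (\<lambda>t::complex. (t, 0::complex))"
  then obtain t where "y = (t, 0)" by blast
  then have "y = lin2 (a, x, 0, d) (t / a, 0)" using a by simp
  then show "y \<in> lin2 (a, x, 0, d) ` range (\<lambda>t::complex. (t, 0))" by blast
qed auto

lemma orbit_eq_iff:
  "{lin2 M ` W | M. M \<in> torus_aut LA} = {lin2 M ` W' | M. M \<in> torus_aut LA} \<longleftrightarrow>
    (\<exists>M\<in>torus_aut LA. W' = lin2 M ` W)"
proof
  have id: "(1, 0, 0, 1) \<in> torus_aut LA" "lin2 (1, 0, 0, 1) ` X = X" for X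
  proof -
    have "lin2 (1, 0, 0, 1) = (\<lambda>x. x)" by auto
    then show "(1, 0, 0, 1) \<in> torus_aut LA" "lin2 (1, 0, 0, 1) ` X = X" for X by (simp_all add: torus_aut_def)
  qed
  assume "{lin2 M ` W | M. M \<in> torus_aut LA} = {lin2 M ` W' | M. M \<in> torus_aut LA}"
  moreover have "W' \<in> {lin2 M ` W' | M. M \<in> torus_aut LA}" using id by force
  ultimately have "W' \<in> {lin2 M ` W | M. M \<in> torus_aut LA}" by simp
  then show "\<exists>M\<in>torus_aut LA. W' = lin2 M ` W" by blast
next
  assume "\<exists>M\<in>torus_aut LA. W' = lin2 M ` W"
  then obtain M where M: "det2 M \<noteq> 0" "lin2 M ` LA = LA" "W' = lin2 M ` W" by (auto simp: torus_aut_def)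
  have Mi: "lin2 (minv M) ` LA = LA" "W = lin2 (minv M) ` W'"
    using lin2_image_minv[OF M(1)] M by metis+
  have comp: "mm g h \<in> torus_aut LA" if "g \<in> torus_aut LA" "det2 h \<noteq> 0" "lin2 h ` LA = LA" for g h
    using that by (simp add: torus_aut_def det2_mm lin2_image_mm)
  show "{lin2 M ` W | M. M \<in> torus_aut LA} = {lin2 M ` W' | M. M \<in> torus_aut LA}"
  proof (intro equalityI subsetI)
    fix x assume "x \<in> {lin2 M ` W | M. M \<in> torus_aut LA}"
    then obtain g where "g \<in> torus_aut LA" "x = lin2 g ` W" by blast
    then have "mm g (minv M) \<in> torus_aut LA" "x = lin2 (mm g (minv M)) ` W'"
      using comp det2_minv[OF M(1)] Mi by (simp_all add: lin2_image_mm)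
    then show "x \<in> {lin2 M ` W' | M. M \<in> torus_aut LA}" by blast
  next
    fix x assume "x \<in> {lin2 M ` W' | M. M \<in> torus_aut LA}"
    then obtain g where "g \<in> torus_aut LA" "x = lin2 g ` W'" by blast
    then have "mm g M \<in> torus_aut LA" "x = lin2 (mm g M) ` W"
      using comp M by (simp_all add: lin2_image_mm)
    then show "x \<in> {lin2 M ` W | M. M \<in> torus_aut LA}" by blast
  qed
qed

lemma phi_u_pos: "n > 0 \<Longrightarrow> phi_u n > 0"
proof (cases "n \<le> 2")
  case False
  then have "even (totient n)" "totient n > 0" by (auto intro: totient_even)
  then have "totient n div 2 > 0" by presburger
  then show ?thesis using False by (simp add: phi_u_def)
qed (simp add: phi_u_def)

locale product_surface = imag_quad +
  fixes s s' :: complex and a a' :: "complex set"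
  assumes s: "s \<noteq> 0" "s' \<noteq> 0" and a: "klat a" "klat a'"
    and units: "only_roots_of_unity_pm1 K"
begin

definition LA where "LA = smul s a \<times> smul s' a'"
definition f where "f = lcm (cond a) (cond a')"
definition b where "b = lprod a a'"
definition orbit where "orbit W = {lin2 M ` W | M. M \<in> torus_aut LA}"

abbreviation axis :: "(complex \<times> complex) set" where "axis \<equiv> range (\<lambda>t. (t, 0))"

text \<open>The matrix is complex because the scalars \<open>s\<close> and \<open>s'\<close> may lie
  outside \<open>K\<close>. The data are determined by \<open>W\<close> only up to diagonal
  scaling.\<close>

definition flag_type where
  "flag_type W L1 L2 e \<longleftrightarrow> (\<exists>g. det2 g \<noteq> 0 \<and> lin2 g ` LA = Mod L1 L2 e \<and> lin2 g ` W = axis)"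

text \<open>Besides the multiplier conductor, the lattice of determinants is prescribed exactly and
  not up to homothety. This normalisation is what later restricts the product of the two diagonal
  scalars.\<close>

definition admissible where
  "admissible L1 L2 e \<longleftrightarrow> klat L1 \<and> klat L2 \<and> e \<in> K \<and> adj (lprod L1 L2) e = b \<and>
     (\<exists>n. rel_order (lprod L1 L2) e n \<and> lcm (cond L1) (cond L2) * n = f)"

lemma f_pos: "f > 0" using a cond_pos by (auto simp: f_def lcm_pos_nat)

lemma klat_b: "klat b" by (simp add: b_def klat_lprod a)

lemma cond_b: "cond b = gcd (cond a) (cond a')" by (simp add: b_def cond_lprod a)

lemma rescale: "det2 (1 / s, 0, 0, 1 / s') \<noteq> 0" "lin2 (1 / s, 0, 0, 1 / s') ` LA = a \<times> a'"
proof -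
  show "det2 (1 / s, 0, 0, 1 / s') \<noteq> 0" using s by simp
  show "lin2 (1 / s, 0, 0, 1 / s') ` LA = a \<times> a'"
    unfolding LA_def
  proof (intro equalityI subsetI)
    fix x assume "x \<in> a \<times> a'"
    then obtain p q where x: "x = (p, q)" "p \<in> a" "q \<in> a'" by auto
    then have "x = lin2 (1 / s, 0, 0, 1 / s') (s * p, s' * q)" using s by simp
    then show "x \<in> lin2 (1 / s, 0, 0, 1 / s') ` (smul s a \<times> smul s' a')" using x smul_memI by blast
  qed (use s in \<open>auto simp: smul_def\<close>)
qed

lemma flag_type_exists:
  assumes "subtorus_line LA W" obtains L1 L2 e where "flag_type W L1 L2 e" "admissible L1 L2 e"
proof -
  obtain v where v: "v \<noteq> 0" "W = range (\<lambda>t. (t * fst v, t * snd v))"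
    and ex: "\<exists>u\<in>W \<inter> LA. \<exists>v\<in>W \<inter> LA. R_indep u v" using assms unfolding subtorus_line_def by blast
  obtain u u' where u: "u \<in> W" "u \<in> LA" "R_indep u u'" using ex by blast
  have u0: "u \<noteq> 0"
  proof
    assume "u = 0"
    then have "1 *\<^sub>R u + 0 *\<^sub>R u' = 0" by simp
    then show False using u(3) unfolding R_indep_def by (metis zero_neq_one)
  qed
  obtain t0 where t0: "u = (t0 * fst v, t0 * snd v)" using u(1) v(2) by blast
  then have t00: "t0 \<noteq> 0" using u0 by (auto simp: zero_prod_def)
  \<comment> \<open>The direction is replaced by a lattice vector, whose coordinates lie in
    \<open>K\<close> after rescaling.\<close>
  have W: "W = range (\<lambda>t. (t * fst u, t * snd u))"
  proof (intro equalityI subsetI)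
    fix x assume "x \<in> W"
    then obtain t where "x = (t * fst v, t * snd v)" using v(2) by blast
    then have "x = (t / t0 * fst u, t / t0 * snd u)" using t00 by (simp add: t0)
    then show "x \<in> range (\<lambda>t. (t * fst u, t * snd u))" by blast
  next
    fix x assume "x \<in> range (\<lambda>t. (t * fst u, t * snd u))"
    then obtain t where "x = (t * fst u, t * snd u)" by blast
    then have "x = ((t * t0) * fst v, (t * t0) * snd v)" by (simp add: t0 mult.assoc)
    then show "x \<in> W" unfolding v(2) by blast
  qed
  define D where "D = (1 / s, 0 :: complex, 0 :: complex, 1 / s')"
  have D: "det2 D \<noteq> 0" "lin2 D ` LA = a \<times> a'" using rescale by (simp_all add: D_def)
  obtain p q where pq: "lin2 D u = (p, q)" by (cases "lin2 D u")
  have "lin2 D u \<in> a \<times> a'" using D(2) u(2) by blast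
  then have pqK: "p \<in> K" "q \<in> K" using pq a klat_K by auto
  have pq0: "(p, q) \<noteq> (0, 0)"
  proof
    assume "(p, q) = (0, 0)"
    then have "lin2 D u = (0, 0)" using pq by simp
    then show False using u0 s by (cases u) (simp add: D_def zero_prod_def)
  qed
  obtain h where h: "matK K h" "det2 h \<noteq> 0" "lin2 h (p, q) = (1, 0)" using move_to_axis[OF pqK pq0] .
  have k1: "kmod (lin2 h ` (a \<times> a'))" by (intro kmod_lin2 kmod_Times a h)
  obtain x L1 L2 e where NF: "x \<in> K" "klat L1" "klat L2" "e \<in> K"
    "lin2 (1, x, 0, 1) ` lin2 h ` (a \<times> a') = Mod L1 L2 e" using normal_form[OF k1] by metis
  define g1 where "g1 = mm (1, x, 0, 1) h"
  \<comment> \<open>The change of coordinates has multiplied the determinants by \<delta>; dividing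
    the first coordinate by it restores \<open>b\<close>.\<close>
  define \<delta> where "\<delta> = det2 g1"
  have g1: "matK K g1" "\<delta> \<noteq> 0" "lin2 g1 ` (a \<times> a') = Mod L1 L2 e" "lin2 g1 (p, q) = (1, 0)"
    using h NF matK_mm[OF _ h(1), of "(1, x, 0, 1)"]
    by (simp_all only: g1_def \<delta>_def det2_mm lin2_image_mm lin2_mm) (simp_all add: K_closed)
  have dK: "\<delta> \<in> K" using det2_K[OF g1(1)] by (simp add: \<delta>_def)
  have dd: "adj (lprod L1 L2) e = smul \<delta> b"
    unfolding ddet_Mod[OF NF(2,3), symmetric] g1(3)[symmetric] \<delta>_def b_def
    using ddet_lin2[of g1 "a \<times> a'"] g1(2) by (simp add: \<delta>_def ddet_Times a)
  have z: "e / \<delta> - 1 / \<delta> * 1 * e \<in> lprod (smul (1 / \<delta>) L1) (smul 1 L2)" using sgrp_0[OF sgrp_lprod] by simp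
  have dK': "e / \<delta> \<in> K" "1 / \<delta> \<in> K" "1 / \<delta> \<noteq> 0" using NF(4) dK g1(2) by (auto intro!: K_closed)
  obtain y where y: "lin2 (1 / \<delta>, y, 0, 1) ` Mod L1 L2 e = Mod (smul (1 / \<delta>) L1) (smul 1 L2) (e / \<delta>)"
    using flag_isoI[OF NF(2-4) dK' K_1 one_neq_zero z] by blast
  define M1 where "M1 = smul (1 / \<delta>) L1"
  define g where "g = mm (1 / \<delta>, y, 0, 1) (mm g1 D)"
  have g: "det2 g \<noteq> 0" "lin2 g ` LA = Mod M1 L2 (e / \<delta>)"
    using g1(2,3) D y by (simp_all add: g_def det2_mm lin2_image_mm M1_def \<delta>_def)
  have "lin2 g u = (1 / \<delta>, 0)" using pq g1(4) by (simp add: g_def lin2_mm)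
  then have "lin2 g (t * fst u, t * snd u) = (t / \<delta>, 0)" for t using lin2_scale[of g t u] by simp
  then have "lin2 g ` W = range (\<lambda>t. (t / \<delta>, 0))" unfolding W by (simp add: image_image)
  also have "\<dots> = axis"
  proof (intro equalityI subsetI)
    fix z assume "z \<in> axis"
    then obtain t where "z = (t * \<delta> / \<delta>, 0)" using g1(2) by auto
    then show "z \<in> range (\<lambda>t. (t / \<delta>, 0))" by blast
  qed auto
  finally have ft: "flag_type W M1 L2 (e / \<delta>)" unfolding flag_type_def using g by blast
  have M1: "klat M1" unfolding M1_def using NF(2) dK g1(2) by (intro klat_smul K_closed) auto
  have eK: "e / \<delta> \<in> K" by (intro K_closed NF dK)
  have "adj (lprod M1 L2) (e / \<delta>) = smul (1 / \<delta>) (adj (lprod L1 L2) e)"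
    by (simp add: smul_adj M1_def lprod_smul_left)
  also have "\<dots> = b" using g1(2) by (simp add: dd)
  finally have adj: "adj (lprod M1 L2) (e / \<delta>) = b" .
  obtain n where n: "n > 0" "rel_order (lprod M1 L2) (e / \<delta>) n"
    using rel_order_exists[OF klat_lprod[OF M1 NF(3)] eK] .
  have "Ord (lcm (cond M1) (cond L2) * n) = mult2 (Mod M1 L2 (e / \<delta>))" by (rule mult2_Mod[OF M1 NF(3) eK n(2), symmetric])
  also have "\<dots> = mult2 (lin2 D ` LA)" unfolding g(2)[symmetric] by (simp only: mult2_lin2[OF g(1)] mult2_lin2[OF D(1)])
  also have "\<dots> = Ord f" unfolding D(2) f_def by (rule mult2_Times[OF a])
  finally have "lcm (cond M1) (cond L2) * n = f" by (simp add: Ord_eq_iff)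
  then have "admissible M1 L2 (e / \<delta>)" unfolding admissible_def using M1 NF(3) eK adj n(2) by blast
  with ft show ?thesis by (rule that)
qed

text \<open>Equal invariants give an isomorphism by \<open>steinitz_iso\<close>. The preimage of the
  first axis is a line meeting the lattice in a copy of \<open>L1\<close>, hence a subtorus.\<close>

lemma admissible_realized:
  assumes "admissible L1 L2 e" obtains W where "subtorus_line LA W" "flag_type W L1 L2 e"
proof -
  obtain n where L: "klat L1" "klat L2" "e \<in> K" "adj (lprod L1 L2) e = b"
    and n: "rel_order (lprod L1 L2) e n" "lcm (cond L1) (cond L2) * n = f"
    using assms unfolding admissible_def by blast
  have "mult2 (Mod L1 L2 e) = Ord f" using mult2_Mod[OF L(1-3) n(1)] n(2) by simp
  moreover have "ddet (Mod L1 L2 e) = ddet (a \<times> a')" using L(4) by (simp add: ddet_Mod L ddet_Times a b_def)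
  ultimately have "iso2 (a \<times> a') (Mod L1 L2 e)"
    using mult2_Times[OF a] f_pos by (intro steinitz_iso[of _ _ f] kmod_Times kmod_Mod a L) (simp_all add: f_def)
  moreover have "iso2 LA (a \<times> a')" using rescale by (rule iso2_I)
  ultimately obtain g where g: "det2 g \<noteq> 0" "lin2 g ` LA = Mod L1 L2 e"
    using iso2_trans unfolding iso2_def by metis
  define v where "v = lin2 (minv g) (1, 0)"
  define W where "W = range (\<lambda>t. (t * fst v, t * snd v))"
  have gv: "lin2 g v = (1, 0)" by (simp add: v_def lin2_minv' g)
  have v0: "v \<noteq> 0"
  proof
    assume "v = 0"
    then have "lin2 g v = 0" by (cases g) (simp add: zero_prod_def)
    then show False using gv by (simp add: zero_prod_def)
  qed
  have gt: "lin2 g (t * fst v, t * snd v) = (t, 0)" for t using lin2_scale[of g t v] gv by simp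
  have gW: "lin2 g ` W = axis" unfolding W_def by (simp add: image_image gt)
  obtain p q where pq: "R_indep p q" "L1 = Z_span2 p q" using L(1) unfolding klat_iff[symmetric] K_lattice_def C_lattice_def by blast
  have mem: "(t * fst v, t * snd v) \<in> W \<inter> LA" if "t \<in> L1" for t
  proof -
    have "lin2 g (t * fst v, t * snd v) \<in> lin2 g ` LA"
      unfolding g(2) gt using that L klat_sgrp by (simp add: Mod_iff sgrp_0)
    then have "(t * fst v, t * snd v) \<in> LA" by (simp only: lin2_image_mem[OF g(1)] lin2_minv[OF g(1)])
    then show ?thesis by (auto simp: W_def)
  qed
  have "p \<in> L1" "q \<in> L1" unfolding pq(2) Z_span2_eq_zspan by (rule zspan_basis)+
  moreover have "R_indep (p * fst v, p * snd v) (q * fst v, q * snd v)"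
    unfolding R_indep_def
  proof (intro allI impI)
    fix r t :: real assume "r *\<^sub>R (p * fst v, p * snd v) + t *\<^sub>R (q * fst v, q * snd v) = 0"
    then have "(r *\<^sub>R p + t *\<^sub>R q) * fst v = 0" "(r *\<^sub>R p + t *\<^sub>R q) * snd v = 0"
      by (auto simp: zero_prod_def algebra_simps)
    then have "r *\<^sub>R p + t *\<^sub>R q = 0" using v0 by (cases v) (auto simp: zero_prod_def)
    then show "r = 0 \<and> t = 0" using pq(1) unfolding R_indep_def by blast
  qed
  ultimately have "subtorus_line LA W" unfolding subtorus_line_def using v0 mem W_def by blast
  moreover have "flag_type W L1 L2 e" unfolding flag_type_def using g gW by blast
  ultimately show ?thesis by (rule that)
qed

text \<open>In the coordinates of the two flags an automorphism matching the lines preserves the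
  first axis, so it is upper triangular and \<open>flag_iso\<close> applies.\<close>

lemma orbit_eq_imp:
  assumes "orbit W = orbit W'" "flag_type W L1 L2 e" "flag_type W' L1' L2' e'"
    "admissible L1 L2 e" "admissible L1' L2' e'"
  obtains c d where "c \<in> K" "c \<noteq> 0" "d \<in> K" "d \<noteq> 0" "L1' = smul c L1" "L2' = smul d L2" "e' - c * d * e \<in> lprod L1' L2'"
proof -
  obtain M where M: "det2 M \<noteq> 0" "lin2 M ` LA = LA" "W' = lin2 M ` W"
    using assms(1) unfolding orbit_def orbit_eq_iff by (auto simp: torus_aut_def)
  obtain g where g: "det2 g \<noteq> 0" "lin2 g ` LA = Mod L1 L2 e" "lin2 g ` W = axis" using assms(2) by (auto simp: flag_type_def)
  obtain g' where g': "det2 g' \<noteq> 0" "lin2 g' ` LA = Mod L1' L2' e'" "lin2 g' ` W' = axis" using assms(3) by (auto simp: flag_type_def)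
  have L: "klat L1" "klat L2" "klat L1'" "klat L2'" using assms(4,5) by (auto simp: admissible_def)
  define h where "h = mm g' (mm M (minv g))"
  have h0: "det2 h \<noteq> 0" using g g' M det2_minv by (simp add: h_def det2_mm)
  have gi: "lin2 (minv g) ` Mod L1 L2 e = LA" "lin2 (minv g) ` axis = W"
    using g lin2_image_minv by metis+
  have h: "lin2 h ` Mod L1 L2 e = Mod L1' L2' e'" "lin2 h ` axis = axis"
    using g' M gi by (simp_all add: h_def lin2_image_mm)
  obtain c x d where h': "h = (c, x, 0, d)" "c \<noteq> 0" "d \<noteq> 0" using upper_triangular[OF h0 h(2)] .
  have fi: "L1' = smul c L1" "L2' = smul d L2" "e' - c * d * e \<in> lprod L1' L2'"
    using flag_iso[OF L h'(2,3) h(1)[unfolded h'(1)]] by blast+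
  then show ?thesis using that[of c d] h'(2,3) smul_factor_K L by metis
qed

lemma orbit_eqI:
  assumes "flag_type W L1 L2 e" "flag_type W' (smul c L1) (smul d L2) e'"
    "admissible L1 L2 e" "admissible (smul c L1) (smul d L2) e'"
    "c \<in> K" "c \<noteq> 0" "d \<in> K" "d \<noteq> 0" "e' - c * d * e \<in> lprod (smul c L1) (smul d L2)"
  shows "orbit W = orbit W'"
proof -
  have L: "klat L1" "klat L2" "e \<in> K" "e' \<in> K" using assms(3,4) by (auto simp: admissible_def)
  obtain x where x: "lin2 (c, x, 0, d) ` Mod L1 L2 e = Mod (smul c L1) (smul d L2) e'"
    using flag_isoI[OF L assms(5-9)] by blast
  obtain g where g: "det2 g \<noteq> 0" "lin2 g ` LA = Mod L1 L2 e" "lin2 g ` W = axis" using assms(1) by (auto simp: flag_type_def)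
  obtain g' where g': "det2 g' \<noteq> 0" "lin2 g' ` LA = Mod (smul c L1) (smul d L2) e'" "lin2 g' ` W' = axis"
    using assms(2) by (auto simp: flag_type_def)
  define M where "M = mm (minv g') (mm (c, x, 0, d) g)"
  have gi: "lin2 (minv g') ` Mod (smul c L1) (smul d L2) e' = LA" "lin2 (minv g') ` axis = W'"
    using g' lin2_image_minv by metis+
  have "det2 M \<noteq> 0" using g g' det2_minv assms by (simp add: M_def det2_mm)
  moreover have "lin2 M ` LA = LA" "lin2 M ` W = W'"
    by (simp_all only: M_def lin2_image_mm g x gi upper_triangular_axis[OF assms(6)])
  ultimately have "M \<in> torus_aut LA" "W' = lin2 M ` W" by (simp_all add: torus_aut_def)
  then show ?thesis unfolding orbit_def orbit_eq_iff by blast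
qed

text \<open>One fixed choice for each \<open>P\<close> and \<open>l\<close>, so that lines with the
  same \<open>P\<close> are measured against the same reference lattice.\<close>

definition lift where
  "lift P l = (SOME P'. klat P' \<and> cond P' = l \<and> lprod P' (Ord (cond P)) = P)"

lemma lift: assumes "klat P" "cond P dvd l" "l > 0"
  shows "klat (lift P l)" "cond (lift P l) = l" "lprod (lift P l) (Ord (cond P)) = P"
proof -
  have "\<exists>P'. klat P' \<and> cond P' = l \<and> lprod P' (Ord (cond P)) = P" using lift_conductor[OF assms] by metis
  from someI_ex[OF this] show "klat (lift P l)" "cond (lift P l) = l" "lprod (lift P l) (Ord (cond P)) = P"
    unfolding lift_def by blast+
qed

section \<open>Encoding of orbits by the index set\<close>

definition gens where
  "gens P n = {pm_coset P e | e. adj P e = b \<and> rel_order P e n}"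

definition index where
  "index = (SIGMA l:{l. l dvd f}. SIGMA g:{g. g dvd l}. {(l1, l2). lcm l1 l2 = l \<and> gcd l1 l2 = g} \<times>
     (SIGMA P:sub_lats b (f div l) g. gens P (f div l) \<times> pic l))"

text \<open>A relation, since an orbit determines its pair of lattices only up to scalars and the
  class only up to the matching sign; it asks for one compatible choice.\<close>

definition code where
  "code o' i \<longleftrightarrow> (case i of (l, g, (l1, l2), P, Q, C) \<Rightarrow>
     \<exists>W L1 L2 e L. o' = orbit W \<and> subtorus_line LA W \<and> flag_type W L1 L2 e \<and> admissible L1 L2 e \<and>
       cond L1 = l1 \<and> cond L2 = l2 \<and> lprod L1 L2 = P \<and> Q = pm_coset P e \<and>
       klat L \<and> cond L = l \<and> C = homothety_class K L \<and>
       L1 = lprod L (Ord l1) \<and> L2 = lprod (lprod (lift P l) (linv L)) (Ord l2))"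

lemma code_total:
  assumes "subtorus_line LA W" shows "\<exists>i\<in>index. code (orbit W) i"
proof -
  obtain L1 L2 e where t: "flag_type W L1 L2 e" "admissible L1 L2 e" using flag_type_exists[OF assms] .
  then obtain n where L: "klat L1" "klat L2" "e \<in> K" "adj (lprod L1 L2) e = b"
    and n: "rel_order (lprod L1 L2) e n" "lcm (cond L1) (cond L2) * n = f"
    unfolding admissible_def by blast
  define l where "l = lcm (cond L1) (cond L2)"
  define g where "g = gcd (cond L1) (cond L2)"
  define P where "P = lprod L1 L2"
  have l0: "l > 0" using n f_pos by (auto simp: l_def intro!: Nat.gr0I)
  have nf: "n = f div l" using l0 unfolding n(2)[folded l_def, symmetric] by simp
  have P: "klat P" "cond P = g" using L by (simp_all add: P_def g_def klat_lprod cond_lprod)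
  have gl: "g dvd l" by (simp add: g_def l_def dvd_lcmI1)
  obtain M where M: "klat M" "cond M = l" "L1 = lprod M (Ord (cond L1))" "L2 = lprod (lprod (lift P l) (linv M)) (Ord (cond L2))"
    using lattice_of_pair[of "lift P l" "cond L1" "cond L2" P L1 L2] lift[OF P(1), of l] P(2) gl l0 L
    unfolding l_def[symmetric] g_def[symmetric] P_def[symmetric] by metis
  define i where "i = (l, g, (cond L1, cond L2), P, pm_coset P e, homothety_class K M)"
  have "l dvd f" using n(2) by (metis l_def dvd_triv_left)
  then have "i \<in> index"
    unfolding index_def i_def
    using n L gl P M by (auto simp: l_def[symmetric] g_def[symmetric] P_def[symmetric] sub_lats_def gens_def pic_def nf[symmetric])
  moreover have "code (orbit W) i"
    unfolding code_def i_def prod.case using assms t M P_def by blast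
  ultimately show ?thesis by blast
qed

lemma code_onto:
  assumes "i \<in> index" shows "\<exists>W. subtorus_line LA W \<and> code (orbit W) i"
proof -
  obtain l g l1 l2 P Q C where i: "i = (l, g, (l1, l2), P, Q, C)" by (cases i) auto
  have *: "l dvd f" "g dvd l" "lcm l1 l2 = l" "gcd l1 l2 = g" "P \<in> sub_lats b (f div l) g"
    "Q \<in> gens P (f div l)" "C \<in> pic l" using assms by (auto simp: index_def i)
  have l0: "l > 0" using *(1) f_pos by (auto intro!: Nat.gr0I)
  have P: "klat P" "cond P = g" using *(5) by (auto simp: sub_lats_def)
  obtain e where e: "Q = pm_coset P e" "adj P e = b" "rel_order P e (f div l)" using *(6) by (auto simp: gens_def)
  obtain L where L: "C = homothety_class K L" "klat L" "cond L = l" using *(7) by (auto simp: pic_def)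
  have lf: "klat (lift P l)" "cond (lift P l) = lcm l1 l2" "lprod (lift P l) (Ord (gcd l1 l2)) = P"
    using lift[OF P(1), of l] P(2) *(2-4) l0 by simp_all
  have L': "cond L = lcm l1 l2" using L(3) *(3) by simp
  define L1 where "L1 = lprod L (Ord l1)"
  define L2 where "L2 = lprod (lprod (lift P l) (linv L)) (Ord l2)"
  have L12: "klat L1" "klat L2" "cond L1 = l1" "cond L2 = l2" "lprod L1 L2 = P"
    unfolding L1_def L2_def by (rule pair_of_lattice[OF lf L(2) L'])+
  have fl: "f div l > 0" using *(1) f_pos l0 by (simp add: div_greater_zero_iff dvd_imp_le)
  have "e \<in> K" using rel_order_imp_K[OF P(1) e(3) fl] .
  then have ad: "admissible L1 L2 e"
    unfolding admissible_def L12(3-5) *(3) using L12(1,2) e(2,3) *(1) by auto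
  obtain W where W: "subtorus_line LA W" "flag_type W L1 L2 e" using admissible_realized[OF ad] .
  have "code (orbit W) i" unfolding i code_def prod.case
    using W ad L12 e(1) L L1_def L2_def by blast
  then show ?thesis using W(1) by blast
qed

text \<open>Two choices for one orbit differ by scalars \<open>r\<close> and \<open>d\<close>. Their
  product preserves \<open>b\<close> and is therefore a sign, so \<open>P\<close> and the class up
  to sign agree, and the glued lattices differ by the homothety \<open>r\<close>.\<close>

lemma code_unique_right:
  assumes "i \<in> index" "i' \<in> index" "code x i" "code x i'" shows "i = i'"
proof -
  obtain l g l1 l2 P Q C where i: "i = (l, g, (l1, l2), P, Q, C)" by (cases i) auto
  obtain l' g' l1' l2' P' Q' C' where i': "i' = (l', g', (l1', l2'), P', Q', C')" by (cases i') auto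
  have lg: "lcm l1 l2 = l" "gcd l1 l2 = g" "lcm l1' l2' = l'" "gcd l1' l2' = g'" "l dvd f" "g dvd l"
    using assms(1,2) by (auto simp: index_def i i')
  have l0: "l > 0" using lg(5) f_pos by (auto intro!: Nat.gr0I)
  obtain W L1 L2 e L where c: "x = orbit W" "flag_type W L1 L2 e" "admissible L1 L2 e"
       "cond L1 = l1" "cond L2 = l2" "lprod L1 L2 = P" "Q = pm_coset P e"
       "klat L" "cond L = l" "C = homothety_class K L"
       "L1 = lprod L (Ord l1)" "L2 = lprod (lprod (lift P l) (linv L)) (Ord l2)"
    using assms(3) unfolding code_def i prod.case by blast
  obtain W' L1' L2' e' L' where c': "x = orbit W'" "flag_type W' L1' L2' e'" "admissible L1' L2' e'"
       "cond L1' = l1'" "cond L2' = l2'" "lprod L1' L2' = P'" "Q' = pm_coset P' e'"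
       "klat L'" "cond L' = l'" "C' = homothety_class K L'"
       "L1' = lprod L' (Ord l1')" "L2' = lprod (lprod (lift P' l') (linv L')) (Ord l2')"
    using assms(4) unfolding code_def i' prod.case by blast
  have kl: "klat L1" "klat L2" "adj P e = b" "adj P' e' = b" using c(3,6) c'(3,6) by (auto simp: admissible_def)
  have sP: "sgrp P" "klat P" using kl klat_lprod klat_sgrp c(6) by auto
  have "orbit W = orbit W'" using c(1) c'(1) by simp
  then obtain r d where rd: "r \<in> K" "r \<noteq> 0" "d \<in> K" "d \<noteq> 0" "L1' = smul r L1" "L2' = smul d L2" "e' - r * d * e \<in> P'"
    using orbit_eq_imp[OF _ c(2) c'(2) c(3) c'(3)] c'(6) by metis
  have conds: "l1' = l1" "l2' = l2" using rd kl cond_smul c(4,5) c'(4,5) by auto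
  then have lgs: "l' = l" "g' = g" using lg by auto
  have P'eq: "P' = smul (r * d) P" unfolding c'(6)[symmetric] c(6)[symmetric] rd(5,6) by (simp add: lprod_smul_left lprod_smul_right mult.commute)
  have "adj P' (r * d * e) = adj P' e'"
  proof -
    have sP': "sgrp P'" unfolding P'eq by (rule sgrp_smul[OF sP(1)])
    have "e' \<in> adj P' (r * d * e)" using rd(7) by (intro adj_memI[of _ "e' - r * d * e" 1]) auto
    moreover have "r * d * e \<in> adj P' e'" using sgrp_uminus[OF sP' rd(7)] by (intro adj_memI[of _ "r * d * e - e'" 1]) auto
    ultimately show ?thesis by (intro equalityI adj_least sgrp_adj sP' adj_subset)
  qed
  moreover have "adj P' (r * d * e) = smul (r * d) b" unfolding P'eq kl(3)[symmetric] by (rule smul_adj[symmetric])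
  ultimately have "smul (r * d) b = b" using kl(4) by simp
  \<comment> \<open>The hypothesis on roots of unity enters here, through a homothety of
    \<open>b\<close>.\<close>
  then have rd1: "r * d = 1 \<or> r * d = -1" using homothety_unit[OF klat_b _ units] by blast
  have m1: "smul (- 1) P = P" using smul_uminus[OF sP(1), of 1] by simp
  have "smul (r * d) P = P" using rd1 by (rule disjE) (simp_all only: m1 smul_1)
  then have PP: "P' = P" by (simp only: P'eq)
  have QQ: "Q' = Q" unfolding c'(7) c(7) PP
  proof (subst pm_coset_eq_iff[OF sP(1)])
    show "e' - e \<in> P \<or> e' + e \<in> P" using rd(7) rd1 unfolding PP by auto
  qed
  \<comment> \<open>A change of sign does not affect the lattice, so \<open>d\<close> may be read as
    the inverse of \<open>r\<close>.\<close>
  have L2d: "L2' = smul (1 / r) L2"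
  proof -
    have "d = 1 / r \<or> d = - (1 / r)" using rd1 rd(2) by (auto simp: field_simps eq_neg_iff_add_eq_0)
    then show ?thesis unfolding rd(6) by (rule disjE) (simp_all only: smul_uminus[OF klat_sgrp[OF kl(2)]])
  qed
  have P: "cond P = g" using cond_lprod[OF kl(1,2)] by (simp only: c(4-6) lg(2))
  have lf: "klat (lift P l)" "cond (lift P l) = lcm l1 l2" "lprod (lift P l) (Ord (gcd l1 l2)) = P"
    using lift[OF sP(2), of l] P lg(1,2,6) l0 by simp_all
  have "L' = smul r L"
  proof (rule lattice_of_pair_unique[OF lf])
    show "klat L" "klat L'" "cond L = lcm l1 l2" "cond L' = lcm l1 l2" using c c' lg lgs by auto
    show "lprod L' (Ord l1) = smul r (lprod L (Ord l1))" using c(11) c'(11) rd(5) conds by simp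
    show "lprod (lprod (lift P l) (linv L')) (Ord l2) = smul (1 / r) (lprod (lprod (lift P l) (linv L)) (Ord l2))"
      using c(12) c'(12) L2d conds PP lgs by simp
  qed (use rd in auto)
  then have "C' = C" unfolding c(10) c'(10) using homothety_class_eq_iff[of L L'] rd(1,2) by blast
  then show ?thesis unfolding i i' using lgs conds PP QQ by simp
qed

text \<open>A homothety \<open>r\<close> of the glued lattices scales the pair by \<open>r\<close>
  and \<open>1 / r\<close>. If the classes agree only up to sign, the sign is put into
  \<open>d\<close>, where it is invisible on \<open>L2\<close> but reverses the class.\<close>

lemma code_unique_left:
  assumes "i \<in> index" "code x i" "code x' i" shows "x = x'"
proof -
  obtain l g l1 l2 P Q C where i: "i = (l, g, (l1, l2), P, Q, C)" by (cases i) auto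
  obtain W L1 L2 e L where c: "x = orbit W" "flag_type W L1 L2 e" "admissible L1 L2 e"
       "cond L1 = l1" "cond L2 = l2" "lprod L1 L2 = P" "Q = pm_coset P e"
       "klat L" "cond L = l" "C = homothety_class K L"
       "L1 = lprod L (Ord l1)" "L2 = lprod (lprod (lift P l) (linv L)) (Ord l2)"
    using assms(2) unfolding code_def i prod.case by blast
  obtain W' L1' L2' e' L' where c': "x' = orbit W'" "flag_type W' L1' L2' e'" "admissible L1' L2' e'"
       "cond L1' = l1" "cond L2' = l2" "lprod L1' L2' = P" "Q = pm_coset P e'"
       "klat L'" "cond L' = l" "C = homothety_class K L'"
       "L1' = lprod L' (Ord l1)" "L2' = lprod (lprod (lift P l) (linv L')) (Ord l2)"
    using assms(3) unfolding code_def i prod.case by blast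
  have kl: "klat L1" "klat L2" using c(3) by (auto simp: admissible_def)
  have sP: "sgrp P" using kl klat_lprod klat_sgrp c(6) by auto
  obtain r where r: "r \<in> K" "r \<noteq> 0" "L' = smul r L"
    using homothety_class_eq_iff[of L L'] c(10) c'(10) by auto
  have L1': "L1' = smul r L1" unfolding c(11) c'(11) r(3) by (simp add: lprod_smul_left)
  have L2': "L2' = smul (1 / r) L2"
    unfolding c(12) c'(12) r(3) linv_smul[OF c(8) r(1,2)] by (simp add: lprod_smul_left lprod_smul_right)
  have "e' - e \<in> P \<or> e' + e \<in> P" using pm_coset_eq_iff[OF sP, of e' e] c(7) c'(7) by simp
  then obtain d where d: "d \<in> K" "d \<noteq> 0" "L2' = smul d L2" "e' - r * d * e \<in> P"
  proof
    assume "e' - e \<in> P"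
    then show ?thesis using r L2' by (intro that[of "1 / r"]) (auto intro: K_closed)
  next
    assume "e' + e \<in> P"
    then show ?thesis using r L2' smul_uminus[OF klat_sgrp[OF kl(2)], of "1 / r"]
      by (intro that[of "- (1 / r)"]) (auto intro!: K_closed)
  qed
  have "orbit W = orbit W'"
    by (rule orbit_eqI[of W L1 L2 e W' r d e', OF c(2)]) (use c'(2,3,6) c(3) r(1,2) d L1' in auto)
  then show ?thesis using c(1) c'(1) by simp
qed

section \<open>Evaluation of the count\<close>

lemma card_index:
  "card index = (\<Sum>l | l dvd f. pic_number K l * phi_u (f div l) *
     (\<Sum>g | g dvd l. 2 ^ omega (l div g) * r_K K (cond b) g (f div l)))"
proof -
  have fl: "f div l > 0" and l0: "l > 0" if "l dvd f" for l
    using that f_pos by (auto simp: div_greater_zero_iff dvd_imp_le intro!: Nat.gr0I)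
  have fin_dvd: "finite {g. g dvd l}" if "l > 0" for l :: nat using that by simp
  have fin_pairs: "finite {(l1, l2). lcm l1 l2 = l \<and> gcd l1 l2 = g}" if "l > 0" for l g :: nat
    by (rule finite_subset[of _ "{..l} \<times> {..l}"]) (use that in \<open>auto simp: dvd_imp_le\<close>)
  have gens: "card (gens P (f div l)) = phi_u (f div l)" if "l dvd f" "P \<in> sub_lats b (f div l) g" for l g P
  proof -
    have "P \<in> sub_lats b (f div l) g" by fact
    then obtain e0 where "klat P" "b = adj P e0" "rel_order P e0 (f div l)" by (auto simp: sub_lats_def)
    then show ?thesis unfolding gens_def by (intro card_generator_classes[OF klat_sgrp fl[OF that(1)]])
  qed
  have fin_gens: "finite (gens P (f div l))" if "l dvd f" "P \<in> sub_lats b (f div l) g" for l g P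
    using gens[OF that] phi_u_pos[OF fl[OF that(1)]] by (metis card_ge_0_finite)
  have fin_sub: "finite (sub_lats b (f div l) g)" if "l dvd f" for l g
    by (rule finite_sub_lats[OF klat_b fl[OF that]])
  have inner: "card (SIGMA P:sub_lats b (f div l) g. gens P (f div l) \<times> pic l)
      = r_K K (cond b) g (f div l) * (phi_u (f div l) * pic_number K l)" if "l dvd f" for l g
  proof -
    have "card (SIGMA P:sub_lats b (f div l) g. gens P (f div l) \<times> pic l)
      = (\<Sum>P\<in>sub_lats b (f div l) g. card (gens P (f div l) \<times> pic l))"
      using that fin_sub fin_gens finite_pic by (intro card_SigmaI) auto
    also have "\<dots> = (\<Sum>P\<in>sub_lats b (f div l) g. phi_u (f div l) * pic_number K l)"
      using that gens by (intro sum.cong) (auto simp: card_cartesian_product card_pic)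
    also have "\<dots> = r_K K (cond b) g (f div l) * (phi_u (f div l) * pic_number K l)"
      using card_sub_lats[OF klat_b fl[OF that]] by simp
    finally show ?thesis .
  qed
  have fin_inner: "finite (SIGMA P:sub_lats b (f div l) g. gens P (f div l) \<times> pic l)" if "l dvd f" for l g
    using that fin_sub fin_gens finite_pic by (intro finite_SigmaI finite_cartesian_product) auto
  have mid: "card (SIGMA g:{g. g dvd l}. {(l1, l2). lcm l1 l2 = l \<and> gcd l1 l2 = g} \<times>
       (SIGMA P:sub_lats b (f div l) g. gens P (f div l) \<times> pic l))
     = pic_number K l * phi_u (f div l) * (\<Sum>g | g dvd l. 2 ^ omega (l div g) * r_K K (cond b) g (f div l))"
    if "l dvd f" for l
  proof -
    have "card (SIGMA g:{g. g dvd l}. {(l1, l2). lcm l1 l2 = l \<and> gcd l1 l2 = g} \<times>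
       (SIGMA P:sub_lats b (f div l) g. gens P (f div l) \<times> pic l))
      = (\<Sum>g | g dvd l. card ({(l1, l2). lcm l1 l2 = l \<and> gcd l1 l2 = g} \<times>
       (SIGMA P:sub_lats b (f div l) g. gens P (f div l) \<times> pic l)))"
      using l0[OF that] that fin_dvd fin_pairs fin_inner by (intro card_SigmaI) (auto intro!: finite_cartesian_product)
    also have "\<dots> = (\<Sum>g | g dvd l. pic_number K l * phi_u (f div l) * (2 ^ omega (l div g) * r_K K (cond b) g (f div l)))"
    proof (rule sum.cong[OF refl])
      fix g assume "g \<in> {g. g dvd l}"
      then show "card ({(l1, l2). lcm l1 l2 = l \<and> gcd l1 l2 = g} \<times>
       (SIGMA P:sub_lats b (f div l) g. gens P (f div l) \<times> pic l))
       = pic_number K l * phi_u (f div l) * (2 ^ omega (l div g) * r_K K (cond b) g (f div l))"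
        using l0[OF that] by (simp only: card_cartesian_product card_lcm_gcd_pairs[of g l] inner[OF that] mem_Collect_eq mult_ac)
    qed
    finally show ?thesis by (simp add: sum_distrib_left)
  qed
  have "card index = (\<Sum>l | l dvd f. card (SIGMA g:{g. g dvd l}. {(l1, l2). lcm l1 l2 = l \<and> gcd l1 l2 = g} \<times>
       (SIGMA P:sub_lats b (f div l) g. gens P (f div l) \<times> pic l)))"
    unfolding index_def using f_pos l0 fin_dvd fin_pairs fin_inner
    by (intro card_SigmaI) (auto intro!: finite_SigmaI finite_cartesian_product)
  also have "\<dots> = (\<Sum>l | l dvd f. pic_number K l * phi_u (f div l) *
     (\<Sum>g | g dvd l. 2 ^ omega (l div g) * r_K K (cond b) g (f div l)))"
    by (rule sum.cong[OF refl]) (use mid in auto)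
  finally show ?thesis .
qed

lemma num_elliptic_curves_eq: "num_elliptic_curves (smul s a) (smul s' a') = card index"
proof -
  have "num_elliptic_curves (smul s a) (smul s' a') = card {orbit W | W. subtorus_line LA W}"
    by (simp add: num_elliptic_curves_def orbit_def LA_def Let_def)
  also have "\<dots> = card index"
  proof (rule card_eq_if_rel[where R = code])
    show "\<exists>i\<in>index. code x i" if "x \<in> {orbit W | W. subtorus_line LA W}" for x
      using that code_total by blast
    show "\<exists>x\<in>{orbit W | W. subtorus_line LA W}. code x i" if "i \<in> index" for i
      using code_onto[OF that] by blast
  qed (use code_unique_right code_unique_left in blast)+
  finally show ?thesis .
qed

end

theorem theorem1p1:
  fixes K Lam Lam' :: "complex set" and c c' :: nat
  assumes "imag_quadratic_field K"
    and "only_roots_of_unity_pm1 K"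
    and "CM_curve_conductor K Lam c"
    and "CM_curve_conductor K Lam' c'"
  shows "num_elliptic_curves Lam Lam' =
    (let f = lcm c c'; f' = gcd c c' in
     (\<Sum>l | l dvd f. pic_number K l * phi_u (f div l) *
        (\<Sum>g | g dvd l. 2 ^ omega (l div g) * r_K K f' g (f div l))))"
proof -
  obtain w t n where "imag_quad K w t n" using imag_quadratic_field_cases[OF assms(1)] .
  then interpret imag_quad K w t n .
  obtain s a where A: "s \<noteq> 0" "klat a" "cond a = c" "Lam = smul s a"
    using assms(3) by (auto simp: CM_curve_conductor_def klat_iff smul_def)
  obtain s' a' where A': "s' \<noteq> 0" "klat a'" "cond a' = c'" "Lam' = smul s' a'"
    using assms(4) by (auto simp: CM_curve_conductor_def klat_iff smul_def)
  interpret product_surface K w t n s s' a a'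
    by unfold_locales (use A A' assms(2) in auto)
  show ?thesis
    using num_elliptic_curves_eq card_index unfolding A(4) A'(4) cond_b by (simp add: f_def A A' Let_def)
qed

end
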